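(* There exist absolute constants $C,K>0$ and $n_0\in\mathbf{N}$ such that for every integer $n\ge n_0$ and every subset $X\subset A_n$ the following hold. (i) If $|X|/|A_n|\ge C\,n^{-1/2}(\log n)^{7/2}$, then $X^2=\{xy:x,y\in X\}$ satisfies $$\frac{|X^2|}{|A_n|}\ \ge\ 1-K\,n^{-1/2}(\log n)^{7/2}.$$ (ii) In particular, if $X$ is product-free, then $$\frac{|X|}{|A_n|}\ \le\ K\,n^{-1/2}(\log n)^{7/2}.$$ (In asymptotic notation, as $n\to\infty$: if $X$ has density $\gg n^{-1/2}(\log n)^{7/2}$ then $X^2$ has density $1-O(n^{-1/2}(\log n)^{7/2})$; in particular if $X$ is product-free then $X$ has density at most $O(n^{-1/2}(\log n)^{7/2})$. Here $U\gg V$ means $V=o(U)$.)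
   Context: $A_n$ is the alternating group on $\{1,\dots,n\}$. The density of $X\subset A_n$ is $|X|/|A_n|$. A subset $X$ of a group is product-free if there are no solutions to $xy=z$ with $x,y,z\in X$. $\log$ is the natural logarithm. *)

theory Defs
  imports Complex_Main "HOL-Algebra.Sym_Groups"
begin

definition density :: "('a, 'b) monoid_scheme \<Rightarrow> 'a set \<Rightarrow> real"
  where "density G X = real (card X) / real (order G)"

definition product_free :: "('a, 'b) monoid_scheme \<Rightarrow> 'a set \<Rightarrow> bool"
  where "product_free G X \<longleftrightarrow>
    \<not> (\<exists>x\<in>X. \<exists>y\<in>X. \<exists>z\<in>X. x \<otimes>\<^bsub>G\<^esub> y = z)"

end

theory Submission
  imports Defs "HOL-Analysis.Function_Topology" "HOL-Analysis.Convex" "HOL-Real_Asymp.Real_Asymp"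
begin

text \<open>
  Let \<open>X\<close> and \<open>Z\<close> be subsets of \<open>A\<^sub>n\<close> of densities \<open>\<alpha>\<close> and \<open>\<gamma>\<close> such that no element of \<open>Z\<close> is a
  product of two elements of \<open>X\<close>. It is enough to contradict this when \<open>\<alpha>\<close> and \<open>\<gamma>\<close> are both at
  least \<open>n\<^sup>-\<^sup>1\<^sup>/\<^sup>2 (log n)\<^sup>7\<^sup>/\<^sup>2\<close> and \<open>n\<close> is large: taking for \<open>Z\<close> the complement of \<open>X\<^sup>2\<close> gives the first
  claim, with both constants equal to 1, and the second claim follows because the square of a
  product-free set is disjoint from it.

  The number of solutions of \<open>x y = z\<close> is the sum over \<open>Z\<close> of the convolution of the indicator of
  \<open>X\<close> with itself. Split the second copy of the indicator into its orthogonal projection \<open>u\<close> onto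
  the span of the degree one functions \<open>[p i = j]\<close> and a remainder \<open>g\<close> orthogonal to all of them.
  In terms of representations, \<open>u\<close> collects the trivial and the standard representation, and \<open>g\<close>
  lives in representations whose dimension is of order \<open>n\<^sup>2\<close>.

  The remainder is handled as in Gowers's theory of quasirandom groups. On the space of functions
  orthogonal to degree one, take the functions on which convolution by \<open>X\<close> is stretched most. They
  form a space invariant under translations, and such a space contains at least a constant times
  \<open>n\<^sup>2\<close> pairwise orthogonal functions (\<open>ex_orthogonal_family\<close>); comparison with the
  Hilbert-Schmidt norm bounds the largest singular value (\<open>conv_norm_bound\<close>). The dimension bound
  needs no character theory: commuting Klein four-groups on disjoint blocks of four points have a
  joint eigenvector in the space, and even permutations of the blocks carry it to many others with
  different eigenvalues. The eigenvector is nontrivial on two blocks because a nonzero invariant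
  space on which disjoint double transpositions never act nontrivially at the same time would
  contain a function of degree one (\<open>ex_moving_pair\<close>).

  The contribution of \<open>u\<close> is \<open>\<alpha> |X| |Z| (1 + (n - 1) T)\<close>, where \<open>T\<close> is the trace-like sum
  \<open>\<Sum> P i j * P j k * R i k\<close> over the centred matrices \<open>P\<close> and \<open>R\<close> of the probabilities that a random
  element of \<open>X\<close>, respectively \<open>Z\<close>, maps \<open>i\<close> to \<open>j\<close> (\<open>conv_deg1_part_sum\<close>). Only a lower bound
  \<open>T \<ge> -1/(2n)\<close> is needed. Entries of \<open>P\<close> and \<open>R\<close> that exceed \<open>1/n\<close> are positive, so a
  product of three of them only helps, and their total mass is of order \<open>log n\<close>
  (\<open>large_entries_mass\<close>); the other entries have square sum of order \<open>(log n)\<^sup>2 / n\<close>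
  (\<open>small_entries_square_sum\<close>). Both facts express that a set of density \<open>\<alpha>\<close> can shift the mean of
  a sum \<open>\<Sum> a i (p i)\<close> only as far as large deviations of probability \<open>\<alpha>\<close> permit, and the
  deviations are controlled by exchangeable pairs (\<open>rearr_mgf_bound\<close>). The mixed terms of \<open>T\<close> are
  then negligible by the Cauchy-Schwarz inequality; the worst of them, with two large factors, is
  what forces \<open>\<alpha>\<close> and \<open>\<gamma>\<close> to be of order \<open>n\<^sup>-\<^sup>1\<^sup>/\<^sup>2\<close> up to logarithms.
\<close>

section \<open>The alternating group acting on points\<close>


abbreviation Alt :: "nat \<Rightarrow> (nat \<Rightarrow> nat) set"
  where "Alt n \<equiv> carrier (alt_group n)"

lemma AltI: "p permutes {1..n} \<Longrightarrow> evenperm p \<Longrightarrow> p \<in> Alt n"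
  by (simp add: alt_group_carrier)

lemma Alt_permutes: "p \<in> Alt n \<Longrightarrow> p permutes {1..n}"
  by (simp add: alt_group_carrier)

lemma Alt_bij: "p \<in> Alt n \<Longrightarrow> bij p"
  using Alt_permutes permutes_bij by blast

lemma Alt_in_range [simp]: "p \<in> Alt n \<Longrightarrow> p i \<in> {1..n} \<longleftrightarrow> i \<in> {1..n}"
  using Alt_permutes permutes_in_image by metis

lemma Alt_eq_iff [simp]: "p \<in> Alt n \<Longrightarrow> p i = p j \<longleftrightarrow> i = j"
  using Alt_bij bij_is_inj inj_eq by metis

lemma finite_Alt [simp]: "finite (Alt n)"
  by (rule finite_subset[OF _ finite_permutations[of "{1..n}"]]) (auto simp: alt_group_carrier)

lemma id_Alt [simp]: "id \<in> Alt n"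
  by (simp add: alt_group_carrier permutes_id)

lemma comp_Alt [simp]: "p \<in> Alt n \<Longrightarrow> q \<in> Alt n \<Longrightarrow> p \<circ> q \<in> Alt n"
  by (metis alt_group_carrier alt_group_carrier' evenperm_comp permutes_compose)

lemma inv_Alt [simp]: "p \<in> Alt n \<Longrightarrow> inv' p \<in> Alt n"
  by (rule alt_group_inv_closed)

lemma inv_comp_Alt: "p \<in> Alt n \<Longrightarrow> inv' p \<circ> p = id" "p \<in> Alt n \<Longrightarrow> p \<circ> inv' p = id"
  using Alt_permutes permutes_inv_o by blast+

lemma comp_Alt_iff [simp]: "s \<in> Alt n \<Longrightarrow> p \<circ> s \<in> Alt n \<longleftrightarrow> p \<in> Alt n"
  using comp_Alt[of "p \<circ> s" n "inv' s"] comp_Alt[of p n s] by (auto simp: comp_assoc inv_comp_Alt)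

lemma card_Alt_pos: "real (card (Alt n)) > 0"
  using id_Alt[of n] finite_Alt[of n] by (metis card_gt_0_iff empty_iff of_nat_0_less_iff)

lemma bij_betw_comp_right_Alt: "s \<in> Alt n \<Longrightarrow> bij_betw (\<lambda>p. p \<circ> s) (Alt n) (Alt n)"
  by (rule bij_betw_byWitness[where f' = "\<lambda>p. p \<circ> inv' s"])
    (auto simp: comp_assoc inv_comp_Alt)

lemma ex_two_distinct:
  assumes "2 \<le> card A" obtains u v where "u \<in> A" "v \<in> A" "u \<noteq> v"
  using obtain_subset_with_card_n[OF assms] by (metis card_2_iff' subsetD)

text \<open>
  The two spare points are used to correct the sign: a transposition of points outside \<open>xs\<close>
  does not disturb the prescribed values.
\<close>
lemma Alt_transitive:
  assumes "distinct xs" "distinct ys" "set xs \<subseteq> {1..n}" "set ys \<subseteq> {1..n}"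
    and "length xs = length ys" "length xs + 2 \<le> n"
  obtains p where "p \<in> Alt n" "\<And>k. k < length xs \<Longrightarrow> p (xs ! k) = ys ! k"
proof -
  have c: "card ({1..n} - set xs) = n - length xs" "card ({1..n} - set ys) = n - length ys"
    using assms by (auto simp: card_Diff_subset distinct_card)
  then obtain h where h: "bij_betw h ({1..n} - set xs) ({1..n} - set ys)"
    using assms finite_same_card_bij[of "{1..n} - set xs" "{1..n} - set ys"] by auto
  define g where "g = (\<lambda>x. ys ! (THE k. k < length xs \<and> xs ! k = x))"
  have g: "g (xs ! k) = ys ! k" if "k < length xs" for k
    unfolding g_def using that assms(1)
    by (intro arg_cong[where f = "\<lambda>k. ys ! k"] the_equality) (auto simp: nth_eq_iff_index_eq)
  have "bij_betw g (set xs) (set ys)"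
    unfolding bij_betw_def
  proof
    show "inj_on g (set xs)"
      using assms by (auto simp: inj_on_def in_set_conv_nth g nth_eq_iff_index_eq)
    have im: "set zs = (\<lambda>k. zs ! k) ` {..<length zs}" for zs :: "nat list"
      by (auto simp: set_conv_nth)
    show "g ` set xs = set ys"
      unfolding im[of xs] im[of ys] image_image using assms(5) by (auto simp: g)
  qed
  then have "bij_betw (\<lambda>x. if x \<in> set xs then g x else h x) (set xs \<union> ({1..n} - set xs)) (set ys \<union> ({1..n} - set ys))"
    by (intro bij_betw_disjoint_Un) (use h in auto)
  moreover have "set xs \<union> ({1..n} - set xs) = {1..n}" "set ys \<union> ({1..n} - set ys) = {1..n}"
    using assms by auto
  ultimately have b: "bij_betw (\<lambda>x. if x \<in> set xs then g x else h x) {1..n} {1..n}" by simp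
  define p where "p = (\<lambda>x. if x \<in> {1..n} then (if x \<in> set xs then g x else h x) else x)"
  have p: "p permutes {1..n}"
  proof (rule bij_imp_permutes)
    show "bij_betw p {1..n} {1..n}"
      using b by (rule bij_betw_cong[THEN iffD1, rotated]) (simp add: p_def)
    show "p x = x" if "x \<notin> {1..n}" for x
      unfolding p_def by (rule if_not_P[OF that])
  qed
  have pk: "p (xs ! k) = ys ! k" if "k < length xs" for k
  proof -
    have "xs ! k \<in> set xs" "xs ! k \<in> {1..n}" using nth_mem[OF that] assms(3) by auto
    then show ?thesis using g[OF that] unfolding p_def by simp
  qed
  show ?thesis
  proof (cases "evenperm p")
    case True
    then show ?thesis using AltI[OF p] pk that by blast
  next
    case False
    have "2 \<le> card ({1..n} - set xs)" using c assms by simp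
    then obtain u v where uv: "u \<in> {1..n} - set xs" "v \<in> {1..n} - set xs" "u \<noteq> v"
      by (rule ex_two_distinct)
    have perm: "permutation p" using p permutation_permutes by blast
    have "p \<circ> transpose u v \<in> Alt n"
      using uv p False perm
      by (auto intro!: AltI permutes_compose permutes_swap_id simp: evenperm_comp permutation_swap_id evenperm_swap)
    moreover have "(p \<circ> transpose u v) (xs ! k) = ys ! k" if "k < length xs" for k
      using pk[OF that] uv nth_mem[OF that] by (auto simp: transpose_def)
    ultimately show ?thesis using that by blast
  qed
qed

definition dbl_transp :: "nat \<Rightarrow> nat \<Rightarrow> nat \<Rightarrow> nat \<Rightarrow> nat \<Rightarrow> nat"
  where "dbl_transp a b c d = transpose a b \<circ> transpose c d"

definition three_cycle :: "nat \<Rightarrow> nat \<Rightarrow> nat \<Rightarrow> nat \<Rightarrow> nat"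
  where "three_cycle a b c = transpose a b \<circ> transpose b c"

lemma evenperm_dbl_transp: "a \<noteq> b \<Longrightarrow> c \<noteq> d \<Longrightarrow> evenperm (dbl_transp a b c d)"
  by (simp add: dbl_transp_def evenperm_comp permutation_swap_id evenperm_swap)

lemma permutes_dbl_transp: "{a, b, c, d} \<subseteq> J \<Longrightarrow> dbl_transp a b c d permutes J"
  unfolding dbl_transp_def by (intro permutes_compose permutes_swap_id) auto

lemma dbl_transp_Alt: "distinct [a, b, c, d] \<Longrightarrow> {a, b, c, d} \<subseteq> {1..n} \<Longrightarrow> dbl_transp a b c d \<in> Alt n"
  by (intro AltI evenperm_dbl_transp permutes_dbl_transp) auto

lemma evenperm_three_cycle: "distinct [a, b, c] \<Longrightarrow> evenperm (three_cycle a b c)"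
  by (simp add: three_cycle_def evenperm_comp permutation_swap_id evenperm_swap)

lemma permutes_three_cycle: "{a, b, c} \<subseteq> J \<Longrightarrow> three_cycle a b c permutes J"
  unfolding three_cycle_def by (intro permutes_compose permutes_swap_id) auto

lemma three_cycle_Alt: "distinct [a, b, c] \<Longrightarrow> {a, b, c} \<subseteq> {1..n} \<Longrightarrow> three_cycle a b c \<in> Alt n"
  by (intro AltI evenperm_three_cycle permutes_three_cycle) auto

lemma three_cycle_apply [simp]:
  assumes "distinct [a, b, c]"
  shows "three_cycle a b c a = b" "three_cycle a b c b = c" "three_cycle a b c c = a"
  using assms by (auto simp: three_cycle_def transpose_def)

lemma three_cycle_other: "x \<notin> {a, b, c} \<Longrightarrow> three_cycle a b c x = x"
  by (auto simp: three_cycle_def transpose_def)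

lemma three_cycle_cubed:
  assumes "distinct [a, b, c]"
  shows "three_cycle a b c \<circ> three_cycle a b c \<circ> three_cycle a b c = id"
proof
  fix x show "(three_cycle a b c \<circ> three_cycle a b c \<circ> three_cycle a b c) x = id x"
    using assms by (cases "x \<in> {a, b, c}") (auto simp: three_cycle_other)
qed

lemma transpose_conj:
  assumes "bij p" shows "p \<circ> transpose a b = transpose (p a) (p b) \<circ> p"
  using assms by (auto simp: fun_eq_iff transpose_def bij_is_inj inj_eq)

lemma dbl_transp_conj:
  assumes "bij p" shows "p \<circ> dbl_transp a b c d = dbl_transp (p a) (p b) (p c) (p d) \<circ> p"
  unfolding dbl_transp_def
  by (metis (no_types, lifting) assms comp_assoc transpose_conj)

lemma dbl_transp_other: "x \<notin> {a, b, c, d} \<Longrightarrow> dbl_transp a b c d x = x"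
  by (auto simp: dbl_transp_def transpose_def)

text \<open>
  Even permutations are products of pairs of transpositions. If the two transpositions of a pair
  overlap, a transposition of two fresh points is inserted twice between them; this is where five
  points are needed.
\<close>
lemma even_permutes_dbl_transp_induct:
  assumes p: "p permutes J" "evenperm p" and J: "finite J" "card J \<ge> 5"
    and id: "P id"
    and step: "\<And>a b c d p. distinct [a, b, c, d] \<Longrightarrow> {a, b, c, d} \<subseteq> J \<Longrightarrow> P p \<Longrightarrow> P (dbl_transp a b c d \<circ> p)"
  shows "P p"
proof -
  obtain xs where xs: "\<forall>(a,b)\<in>set xs. a \<noteq> b \<and> a \<in> J \<and> b \<in> J" "apply_transps xs = p"
    using permutes_from_transpositions[OF p(1) J(1)] by blast
  have ev: "even (length xs)"
    using evenperm_apply_transps_iff[of xs] xs p(2) by auto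
  have "P (apply_transps xs)"
    using ev xs(1)
  proof (induction xs rule: length_induct)
    case (1 xs)
    show ?case
    proof (cases xs)
      case (Cons x xs')
      then obtain y ys where xs: "xs = x # y # ys"
        using 1(2) by (cases xs') auto
      obtain a b where x: "x = (a, b)" by (cases x)
      obtain c d where y: "y = (c, d)" by (cases y)
      have ab: "a \<noteq> b" "a \<in> J" "b \<in> J" "c \<noteq> d" "c \<in> J" "d \<in> J"
        using 1(3) by (auto simp: xs x y)
      have IH: "P (apply_transps ys)"
        using 1 by (auto simp: xs)
      have eq: "apply_transps xs = transpose a b \<circ> transpose c d \<circ> apply_transps ys"
        by (simp add: xs x y comp_assoc)
      consider "distinct [a, b, c, d]" | "{a, b} = {c, d}" | "\<not> distinct [a, b, c, d]" "{a, b} \<noteq> {c, d}" by blast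
      then show ?thesis
      proof cases
        case 1
        then show ?thesis
          using step[OF 1 _ IH] ab unfolding eq dbl_transp_def by blast
      next
        case 2
        then have "transpose a b \<circ> transpose c d = id"
          by (auto simp: doubleton_eq_iff transpose_commute)
        then show ?thesis using IH unfolding eq by simp
      next
        case 3
        then have "card {a, b, c, d} \<le> 3"
          using ab by (auto simp: card_insert_if)
        then have "2 \<le> card (J - {a, b, c, d})"
          using J(2) diff_card_le_card_Diff[of "{a, b, c, d}" J] by simp
        then obtain e f where ef: "e \<in> J - {a, b, c, d}" "f \<in> J - {a, b, c, d}" "e \<noteq> f"
          by (rule ex_two_distinct)
        have "P (dbl_transp a b e f \<circ> (dbl_transp e f c d \<circ> apply_transps ys))"
          using ef ab by (intro step IH) auto
        moreover have "dbl_transp a b e f \<circ> (dbl_transp e f c d \<circ> apply_transps ys)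
            = transpose a b \<circ> (transpose e f \<circ> transpose e f) \<circ> transpose c d \<circ> apply_transps ys"
          unfolding dbl_transp_def by (simp only: comp_assoc)
        ultimately show ?thesis unfolding eq transpose_comp_involutory comp_id by (simp only:)
      qed
    next
      case Nil
      show ?thesis using id unfolding Nil apply_transps_Nil .
    qed
  qed
  then show ?thesis using xs by simp
qed

section \<open>Translation-invariant spaces of functions\<close>

definition rtrans :: "(nat \<Rightarrow> nat) \<Rightarrow> ((nat \<Rightarrow> nat) \<Rightarrow> real) \<Rightarrow> (nat \<Rightarrow> nat) \<Rightarrow> real"
  where "rtrans s g = (\<lambda>p. g (p \<circ> s))"

lemma rtrans_rtrans: "rtrans s (rtrans t g) = rtrans (s \<circ> t) g"
  by (simp add: rtrans_def comp_assoc)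

lemma rtrans_id [simp]: "rtrans id g = g"
  by (simp add: rtrans_def)

lemma rtrans_diff: "rtrans s (\<lambda>p. g p - h p) = (\<lambda>p. rtrans s g p - rtrans s h p)"
  by (simp add: rtrans_def)

text \<open>
  An abstract right-invariant space of functions on the alternating group that is orthogonal to all
  degree one functions. Values outside the group are zero, so that equality of functions is
  equality on the group.
\<close>
locale transl_module =
  fixes n :: nat and E :: "((nat \<Rightarrow> nat) \<Rightarrow> real) set"
  assumes n: "n \<ge> 9"
    and supp: "g \<in> E \<Longrightarrow> p \<notin> Alt n \<Longrightarrow> g p = 0"
    and lin: "g \<in> E \<Longrightarrow> h \<in> E \<Longrightarrow> (\<lambda>p. a * g p + b * h p) \<in> E"
    and transl: "g \<in> E \<Longrightarrow> s \<in> Alt n \<Longrightarrow> rtrans s g \<in> E"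
    and ortho: "g \<in> E \<Longrightarrow> i \<in> {1..n} \<Longrightarrow> j \<in> {1..n} \<Longrightarrow> (\<Sum>p | p \<in> Alt n \<and> p i = j. g p) = 0"
begin

lemma diff: "g \<in> E \<Longrightarrow> h \<in> E \<Longrightarrow> (\<lambda>p. g p - h p) \<in> E"
  using lin[of g h 1 "-1"] by simp

lemma sum_mem:
  assumes "E \<noteq> {}" "finite K" "\<And>k. k \<in> K \<Longrightarrow> G k \<in> E"
  shows "(\<lambda>p. \<Sum>k\<in>K. G k p) \<in> E"
  using assms(2,3)
proof (induction K rule: finite_induct)
  case empty
  obtain g where "g \<in> E" using assms(1) by blast
  then show ?case using lin[of g g 0 0] by simp
next
  case (insert k K)
  then show ?case using lin[of "G k" "\<lambda>p. \<Sum>k\<in>K. G k p" 1 1] by simp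
qed

text \<open>
  A function of the single value \<open>p i\<close> has degree one, so it can only lie in the space if it is
  zero.
\<close>
lemma point_fixed_zero:
  assumes "g \<in> E" "i \<in> {1..n}" and f: "\<And>p. p \<in> Alt n \<Longrightarrow> g p = f (p i)" and j: "j \<in> {1..n}"
  shows "f j = 0"
proof -
  have "0 = (\<Sum>p | p \<in> Alt n \<and> p i = j. g p)" using ortho[OF assms(1,2) j] by simp
  also have "\<dots> = (\<Sum>p | p \<in> Alt n \<and> p i = j. f j)" by (intro sum.cong) (auto simp: f)
  also have "\<dots> = card {p. p \<in> Alt n \<and> p i = j} * f j" by simp
  finally have *: "card {p. p \<in> Alt n \<and> p i = j} * f j = 0" by (rule sym)
  obtain p where "p \<in> Alt n" "p i = j"
    using Alt_transitive[of "[i]" "[j]" n] assms n by auto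
  then have "card {p. p \<in> Alt n \<and> p i = j} \<noteq> 0" by auto
  with * show ?thesis by simp
qed

text \<open>
  The assumption \<open>loc\<close> says that differences along a three-cycle only see the three points moved. For
  \<open>w p = H (p x) (p y) (p z)\<close> this makes \<open>H a b c - H a b d\<close> a function \<open>F c d\<close> of the last two
  arguments alone. \<open>F\<close> is additive, and \<open>F (p i) (p j)\<close> lies in the space for all \<open>i\<close> and \<open>j\<close>;
  summing over \<open>j\<close> produces a function of \<open>p i\<close>, which must vanish, and additivity turns this into
  \<open>n * F c d = 0\<close>.
\<close>
lemma coordinate_independent:
  assumes w: "w \<in> E" and xyz: "distinct [x, y, z]" "{x, y, z} \<subseteq> {1..n}"
    and H: "\<And>p. p \<in> Alt n \<Longrightarrow> w p = H (p x) (p y) (p z)"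
    and loc: "\<And>v a b c s. v \<in> E \<Longrightarrow> distinct [a, b, c] \<Longrightarrow> {a, b, c} \<subseteq> {1..n} \<Longrightarrow>
      s permutes ({1..n} - {a, b, c}) \<Longrightarrow> evenperm s \<Longrightarrow>
      rtrans s (\<lambda>p. v p - rtrans (three_cycle a b c) v p) = (\<lambda>p. v p - rtrans (three_cycle a b c) v p)"
    and abcd: "distinct [a, b, c, d]" "{a, b, c, d} \<subseteq> {1..n}"
  shows "H a b c = H a b d"
proof -
  have fresh: "\<exists>e. e \<in> {1..n} \<and> e \<notin> A" if "finite A" "card A < 9" for A
    using that n card_mono[of A "{1..n}"] by fastforce
  have fresh2: "\<exists>e f. e \<in> {1..n} \<and> f \<in> {1..n} \<and> e \<notin> A \<and> f \<notin> A \<and> e \<noteq> f"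
    if A: "finite A" "card A < 8" for A
  proof -
    obtain e where e: "e \<in> {1..n}" "e \<notin> A" using fresh[of A] A by force
    obtain f where "f \<in> {1..n}" "f \<notin> insert e A" using fresh[of "insert e A"] A e by force
    then show ?thesis using e by auto
  qed
  have c6: "card {a1, a2, a3, a4, a5, a6} < 9" for a1 a2 a3 a4 a5 a6 :: nat
    using card_length[of "[a1, a2, a3, a4, a5, a6]"] by simp
  have c3: "card {a1, a2, a3} < 8" for a1 a2 a3 :: nat
    using card_length[of "[a1, a2, a3]"] by simp
  have c2: "card {a1, a2} < 8" for a1 a2 :: nat
    using card_length[of "[a1, a2]"] by simp
  \<comment> \<open>differences in the third coordinate do not depend on the first two\<close>
  have indep: "H a b c - H a b d = H a' b' c - H a' b' d"
    if d1: "distinct [a, b, c, d]" "{a, b, c, d} \<subseteq> {1..n}"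
      and d2: "distinct [a', b', c, d]" "{a', b', c, d} \<subseteq> {1..n}" for a b c d a' b'
  proof -
    obtain j k where jk: "j \<in> {1..n}" "k \<in> {1..n}" "j \<notin> {x, y, z}" "k \<notin> {x, y, z}" "j \<noteq> k"
      using fresh2[of "{x, y, z}"] c3 by blast
    obtain e where e: "e \<in> {1..n}" "e \<notin> {a, b, a', b', c, d}"
      using fresh[of "{a, b, a', b', c, d}"] c6 by blast
    obtain p where p: "p \<in> Alt n" "\<And>i. i < 5 \<Longrightarrow> p ([x, y, z, j, k] ! i) = [a, b, c, d, e] ! i"
      by (rule Alt_transitive[of "[x, y, z, j, k]" "[a, b, c, d, e]" n])
        (use xyz jk d1 e n in auto)
    obtain q where q: "q \<in> Alt n" "\<And>i. i < 5 \<Longrightarrow> q ([x, y, z, j, k] ! i) = [a', b', c, d, e] ! i"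
      by (rule Alt_transitive[of "[x, y, z, j, k]" "[a', b', c, d, e]" n])
        (use xyz jk d2 e n in auto)
    have pv: "p x = a" "p y = b" "p z = c" "p j = d" "p k = e"
      using p(2)[of 0] p(2)[of 1] p(2)[of 2] p(2)[of 3] p(2)[of 4] by simp_all
    have qv: "q x = a'" "q y = b'" "q z = c" "q j = d" "q k = e"
      using q(2)[of 0] q(2)[of 1] q(2)[of 2] q(2)[of 3] q(2)[of 4] by simp_all
    define s where "s = inv' p \<circ> q"
    have s: "s \<in> Alt n" using p q by (simp add: s_def)
    have ps: "p \<circ> s = q" unfolding s_def o_assoc inv_comp_Alt(2)[OF p(1)] by simp
    have fixd: "s z = z" "s j = j" "s k = k"
      using pv qv ps p(1) Alt_eq_iff[OF p(1)] by (metis comp_apply)+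
    have sp: "s permutes ({1..n} - {z, j, k})"
      by (rule permutes_superset[OF Alt_permutes[OF s]]) (use fixd in auto)
    let ?t = "three_cycle z j k"
    have dz: "distinct [z, j, k]" using jk by auto
    have t: "?t \<in> Alt n" using jk xyz by (intro three_cycle_Alt) auto
    have D: "w r - rtrans ?t w r = H (r x) (r y) (r z) - H (r x) (r y) (r j)" if "r \<in> Alt n" for r
    proof -
      have "?t x = x" "?t y = y" using xyz jk by (auto simp: three_cycle_other)
      then show ?thesis using H[of r] H[of "r \<circ> ?t"] that t three_cycle_apply(1)[OF dz] by (simp add: rtrans_def)
    qed
    have inv: "rtrans s (\<lambda>p. w p - rtrans ?t w p) = (\<lambda>p. w p - rtrans ?t w p)"
      using s jk xyz by (intro loc w sp) (auto simp: alt_group_carrier)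
    have "w (p \<circ> s) - rtrans ?t w (p \<circ> s) = w p - rtrans ?t w p"
      using fun_cong[OF inv, of p] by (simp add: rtrans_def)
    then show ?thesis using D[OF p(1)] D[OF q(1)] ps pv qv by simp
  qed
  define pr where "pr = (\<lambda>c d. SOME ab. distinct [fst ab, snd ab, c, d] \<and> {fst ab, snd ab, c, d} \<subseteq> {1..n})"
  define F where "F = (\<lambda>c d. H (fst (pr c d)) (snd (pr c d)) c - H (fst (pr c d)) (snd (pr c d)) d)"
  have F: "H a b c - H a b d = F c d" if "distinct [a, b, c, d]" "{a, b, c, d} \<subseteq> {1..n}" for a b c d
  proof -
    have "distinct [fst (pr c d), snd (pr c d), c, d] \<and> {fst (pr c d), snd (pr c d), c, d} \<subseteq> {1..n}"
      unfolding pr_def by (rule someI[where x = "(a, b)"]) (use that in simp)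
    then show ?thesis unfolding F_def using indep[OF that] by blast
  qed
  have F_add: "F c d + F d e = F c e" if "distinct [c, d, e]" "{c, d, e} \<subseteq> {1..n}" for c d e
  proof -
    obtain a b where "a \<in> {1..n}" "b \<in> {1..n}" "a \<notin> {c, d, e}" "b \<notin> {c, d, e}" "a \<noteq> b"
      using fresh2[of "{c, d, e}"] c3 by blast
    then show ?thesis using that F[of a b c d] F[of a b d e] F[of a b c e] by auto
  qed
  have F_anti: "F d c = - F c d" if cd: "c \<noteq> d" "c \<in> {1..n}" "d \<in> {1..n}" for c d
  proof -
    obtain a b where ab: "a \<in> {1..n}" "b \<in> {1..n}" "a \<notin> {c, d}" "b \<notin> {c, d}" "a \<noteq> b"
      using fresh2[of "{c, d}"] c2 by blast
    have "H a b c - H a b d = F c d" "H a b d - H a b c = F d c"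
      using ab cd by (auto intro!: F)
    then show ?thesis by simp
  qed
  define U where "U = (\<lambda>i j p. if p \<in> Alt n then F (p i) (p j) else 0)"
  have U: "U i j \<in> E" if ij: "i \<noteq> j" "i \<in> {1..n}" "j \<in> {1..n}" for i j
  proof -
    obtain x' y' where xy': "x' \<in> {1..n}" "y' \<in> {1..n}" "x' \<notin> {i, j}" "y' \<notin> {i, j}" "x' \<noteq> y'"
      using fresh2[of "{i, j}"] c2 by blast
    have tr: "\<exists>s\<in>Alt n. s x = x' \<and> s y = y' \<and> s z = k" if k: "k = i \<or> k = j" for k
    proof -
      obtain s where s: "s \<in> Alt n" "\<And>l. l < 3 \<Longrightarrow> s ([x, y, z] ! l) = [x', y', k] ! l"
        by (rule Alt_transitive[of "[x, y, z]" "[x', y', k]" n]) (use xyz xy' k ij n in auto)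
      then show ?thesis using s(2)[of 0] s(2)[of 1] s(2)[of 2] by auto
    qed
    obtain s where s: "s \<in> Alt n" "s x = x'" "s y = y'" "s z = i" using tr[of i] by blast
    obtain s' where s': "s' \<in> Alt n" "s' x = x'" "s' y = y'" "s' z = j" using tr[of j] by blast
    have "(\<lambda>p. rtrans s w p - rtrans s' w p) \<in> E"
      using s s' w by (intro diff transl)
    also have "(\<lambda>p. rtrans s w p - rtrans s' w p) = U i j"
    proof
      fix p
      show "rtrans s w p - rtrans s' w p = U i j p"
      proof (cases "p \<in> Alt n")
        case True
        then have "rtrans s w p - rtrans s' w p = H (p x') (p y') (p i) - H (p x') (p y') (p j)"
          using s s' H[of "p \<circ> s"] H[of "p \<circ> s'"] by (simp add: rtrans_def)
        also have "\<dots> = F (p i) (p j)"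
        proof (rule F)
          show "distinct [p x', p y', p i, p j]" using True xy' ij by simp
          show "{p x', p y', p i, p j} \<subseteq> {1..n}"
            using True xy' ij Alt_in_range[OF True] by blast
        qed
        finally show ?thesis using True by (simp add: U_def)
      next
        case False
        then show ?thesis using s s' supp[OF w] by (simp add: U_def rtrans_def)
      qed
    qed
    finally show ?thesis .
  qed
  have Phi: "(\<Sum>k\<in>{1..n} - {j}. F j k) = 0" if j: "j \<in> {1..n}" for j
  proof (rule point_fixed_zero[where g = "\<lambda>p. \<Sum>k\<in>{1..n} - {1}. U 1 k p" and i = 1 and f = "\<lambda>j. \<Sum>k\<in>{1..n} - {j}. F j k"])
    show "(\<lambda>p. \<Sum>k\<in>{1..n} - {1}. U 1 k p) \<in> E"
      using w n by (intro sum_mem U) auto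
    show "1 \<in> {1..n}" using n by simp
    show "j \<in> {1..n}" by fact
    fix p assume p: "p \<in> Alt n"
    have "p ` ({1..n} - {1}) = {1..n} - {p 1}"
      using permutes_image[OF Alt_permutes[OF p]] Alt_bij[OF p]
      by (simp add: image_set_diff[OF bij_is_inj])
    moreover have "inj_on p ({1..n} - {1})" using Alt_bij[OF p] by (meson bij_is_inj inj_on_subset subset_UNIV)
    ultimately have "bij_betw p ({1..n} - {1}) ({1..n} - {p 1})" by (simp add: bij_betw_def)
    from sum.reindex_bij_betw[OF this, of "F (p 1)"]
    show "(\<Sum>k\<in>{1..n} - {1}. U 1 k p) = (\<Sum>k\<in>{1..n} - {p 1}. F (p 1) k)"
      using p by (simp add: U_def)
  qed
  have F0: "F c d = 0" if cd: "c \<noteq> d" "c \<in> {1..n}" "d \<in> {1..n}" for c d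
  proof -
    let ?R = "{1..n} - {c, d}"
    have cR: "card ?R = n - 2" using cd by (simp add: card_Diff_subset)
    have 1: "{1..n} - {c} = insert d ?R" "{1..n} - {d} = insert c ?R" using cd by auto
    have "0 = (\<Sum>k\<in>{1..n} - {c}. F c k) - (\<Sum>k\<in>{1..n} - {d}. F d k)"
      using Phi cd by simp
    also have "\<dots> = F c d - F d c + (\<Sum>k\<in>?R. F c k - F d k)"
      unfolding 1 by (simp add: sum_subtractf)
    also have "(\<Sum>k\<in>?R. F c k - F d k) = (\<Sum>k\<in>?R. F c d)"
      using cd F_add[of c d] by (intro sum.cong) (auto simp: algebra_simps)
    also have "F c d - F d c + (\<Sum>k\<in>?R. F c d) = real n * F c d"
      using F_anti[OF cd] n unfolding sum_constant cR by (simp add: of_nat_diff algebra_simps)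
    finally show ?thesis using n by simp
  qed
  have "H a b c - H a b d = F c d" by (rule F) (use abcd in auto)
  also have "F c d = 0" by (rule F0) (use abcd in auto)
  finally show ?thesis by simp
qed

end


lemma three_cycle_comp_three_cycle:
  "three_cycle a b c \<circ> three_cycle b c d = dbl_transp a b c d"
proof -
  have "three_cycle a b c \<circ> three_cycle b c d
      = transpose a b \<circ> (transpose b c \<circ> transpose b c) \<circ> transpose c d"
    unfolding three_cycle_def by (simp only: comp_assoc)
  then show ?thesis unfolding dbl_transp_def transpose_comp_involutory comp_id .
qed

context transl_module
begin

text \<open>
  Two disjoint double transpositions can always be made to act nontrivially on a common vector.
  Otherwise \<open>v - t v\<close> is fixed by everything disjoint from the double transposition \<open>t\<close>, and by
  commutation the same holds for three-cycles \<open>k\<close>. Then \<open>v - k v\<close> depends on three values only, by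
  \<open>coordinate_independent\<close> on none of them, and summing its translates by the powers of \<open>k\<close>
  shows that it is zero. So all three-cycles act trivially, the space consists of constants, and a
  nonzero constant is not orthogonal to degree one.
\<close>
lemma ex_moving_pair:
  assumes "g \<in> E" "g \<noteq> (\<lambda>p. 0)"
  obtains a b c d a' b' c' d' v where
    "distinct [a, b, c, d, a', b', c', d']" "{a, b, c, d, a', b', c', d'} \<subseteq> {1..n}" "v \<in> E"
    "rtrans (dbl_transp a b c d) (\<lambda>p. v p - rtrans (dbl_transp a' b' c' d') v p)
      \<noteq> (\<lambda>p. v p - rtrans (dbl_transp a' b' c' d') v p)"
proof (rule ccontr)
  note witness = that
  assume contra: "\<not> thesis"
  have H: "rtrans (dbl_transp a b c d) (\<lambda>p. v p - rtrans (dbl_transp a' b' c' d') v p)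
      = (\<lambda>p. v p - rtrans (dbl_transp a' b' c' d') v p)"
    if "distinct [a, b, c, d, a', b', c', d']" "{a, b, c, d, a', b', c', d'} \<subseteq> {1..n}" "v \<in> E"
    for a b c d a' b' c' d' v
    by (rule ccontr) (rule contra[THEN notE], rule witness[OF that])
  have ext: "rtrans s u = u"
    if J: "finite J" "card J \<ge> 5" and s: "s permutes J" "evenperm s"
      and u: "\<And>a b c d. distinct [a, b, c, d] \<Longrightarrow> {a, b, c, d} \<subseteq> J \<Longrightarrow> rtrans (dbl_transp a b c d) u = u"
    for J s u
    by (rule even_permutes_dbl_transp_induct[OF s J, where P = "\<lambda>s. rtrans s u = u"])
      (simp_all add: u rtrans_rtrans[symmetric])
  have dt_fix: "rtrans s (\<lambda>p. v p - rtrans (dbl_transp a b c d) v p) = (\<lambda>p. v p - rtrans (dbl_transp a b c d) v p)"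
    if d: "distinct [a, b, c, d]" "{a, b, c, d} \<subseteq> {1..n}" and v: "v \<in> E"
      and s: "s permutes ({1..n} - {a, b, c, d})" "evenperm s" for a b c d v s
  proof (rule ext[OF _ _ s])
    show "card ({1..n} - {a, b, c, d}) \<ge> 5"
      using d n by (subst card_Diff_subset) auto
    fix a' b' c' d' assume "distinct [a', b', c', d']" "{a', b', c', d'} \<subseteq> {1..n} - {a, b, c, d}"
    then show "rtrans (dbl_transp a' b' c' d') (\<lambda>p. v p - rtrans (dbl_transp a b c d) v p)
        = (\<lambda>p. v p - rtrans (dbl_transp a b c d) v p)"
      using d v by (intro H) auto
  qed simp
  have loc: "rtrans s (\<lambda>p. v p - rtrans (three_cycle x y z) v p) = (\<lambda>p. v p - rtrans (three_cycle x y z) v p)"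
    if v: "v \<in> E" and d: "distinct [x, y, z]" "{x, y, z} \<subseteq> {1..n}"
      and s: "s permutes ({1..n} - {x, y, z})" "evenperm s" for v x y z s
  proof (rule ext[OF _ _ s])
    show "card ({1..n} - {x, y, z}) \<ge> 5"
      using d n by (subst card_Diff_subset) auto
    fix a b c e assume a: "distinct [a, b, c, e]" "{a, b, c, e} \<subseteq> {1..n} - {x, y, z}"
    define t where "t = dbl_transp a b c e"
    define k where "k = three_cycle x y z"
    have k: "bij k" unfolding k_def using permutes_bij permutes_three_cycle by blast
    have "k permutes ({1..n} - {a, b, c, e})" "evenperm k"
      unfolding k_def using a d by (auto intro!: permutes_three_cycle evenperm_three_cycle)
    then have 1: "rtrans k (\<lambda>p. v p - rtrans t v p) = (\<lambda>p. v p - rtrans t v p)"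
      unfolding t_def by (intro dt_fix) (use a d v in auto)
    have "k \<circ> t = t \<circ> k"
      unfolding t_def dbl_transp_conj[OF k] using a by (auto simp: k_def three_cycle_other)
    with 1 have 2: "(\<lambda>p. rtrans k v p - rtrans t (rtrans k v) p) = (\<lambda>p. v p - rtrans t v p)"
      by (simp add: rtrans_diff rtrans_rtrans)
    show "rtrans t (\<lambda>p. v p - rtrans k v p) = (\<lambda>p. v p - rtrans k v p)"
    proof
      fix p
      show "rtrans t (\<lambda>p. v p - rtrans k v p) p = v p - rtrans k v p"
        using fun_cong[OF 2, of p] unfolding rtrans_diff by simp
    qed
  qed simp
  have three_fix: "rtrans (three_cycle x y z) v = v"
    if v: "v \<in> E" and d: "distinct [x, y, z]" "{x, y, z} \<subseteq> {1..n}" for v x y z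
  proof -
    define k where "k = three_cycle x y z"
    define w where "w = (\<lambda>p. v p - rtrans k v p)"
    have k: "k \<in> Alt n" unfolding k_def using d by (rule three_cycle_Alt)
    have w: "w \<in> E" unfolding w_def by (intro diff transl v k)
    have dep: "w p = w q" if pq: "p \<in> Alt n" "q \<in> Alt n" "p x = q x" "p y = q y" "p z = q z" for p q
    proof -
      define s where "s = inv' p \<circ> q"
      have ps: "p \<circ> s = q"
        unfolding s_def o_assoc inv_comp_Alt(2)[OF pq(1)] by simp
      have s: "s \<in> Alt n" unfolding s_def by (intro comp_Alt inv_Alt pq)
      have "p (s x) = p x" "p (s y) = p y" "p (s z) = p z" using ps pq by auto
      then have "s x = x" "s y = y" "s z = z" using Alt_eq_iff[OF pq(1)] by blast+
      then have "s permutes ({1..n} - {x, y, z})"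
        by (intro permutes_superset[OF Alt_permutes[OF s]]) auto
      moreover have "evenperm s" using s by (simp add: alt_group_carrier)
      ultimately have "rtrans s w = w" unfolding w_def k_def by (intro loc v d)
      from fun_cong[OF this, of p] show ?thesis by (simp add: rtrans_def ps)
    qed
    define H where "H = (\<lambda>a b c. w (SOME p. p \<in> Alt n \<and> p x = a \<and> p y = b \<and> p z = c))"
    have H: "w p = H (p x) (p y) (p z)" if "p \<in> Alt n" for p
      using someI[of "\<lambda>q. q \<in> Alt n \<and> q x = p x \<and> q y = p y \<and> q z = p z" p] that
      unfolding H_def by (intro dep) auto
    have H3: "H a b c = H a b d" if "distinct [a, b, c, d]" "{a, b, c, d} \<subseteq> {1..n}" for a b c d
      by (rule coordinate_independent[OF w d H loc that]) (assumption+)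
    have H2: "H a b c = H a d c" if "distinct [a, b, c, d]" "{a, b, c, d} \<subseteq> {1..n}" for a b c d
    proof (rule coordinate_independent[OF w, of z x y "\<lambda>c a b. H a b c" c a b d])
      fix p assume "p \<in> Alt n"
      then show "w p = H (p x) (p y) (p z)" by (rule H)
    next
      fix v a b c s
      assume "v \<in> E" "distinct [a, b, c]" "{a, b, c} \<subseteq> {1..n}" "s permutes ({1..n} - {a, b, c})" "evenperm s"
      then show "rtrans s (\<lambda>p. v p - rtrans (three_cycle a b c) v p) = (\<lambda>p. v p - rtrans (three_cycle a b c) v p)"
        by (rule loc)
    qed (use d that in auto)
    have H1: "H a b c = H d b c" if "distinct [a, b, c, d]" "{a, b, c, d} \<subseteq> {1..n}" for a b c d
    proof (rule coordinate_independent[OF w, of y z x "\<lambda>b c a. H a b c" b c a d])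
      fix p assume "p \<in> Alt n"
      then show "w p = H (p x) (p y) (p z)" by (rule H)
    next
      fix v a b c s
      assume "v \<in> E" "distinct [a, b, c]" "{a, b, c} \<subseteq> {1..n}" "s permutes ({1..n} - {a, b, c})" "evenperm s"
      then show "rtrans s (\<lambda>p. v p - rtrans (three_cycle a b c) v p) = (\<lambda>p. v p - rtrans (three_cycle a b c) v p)"
        by (rule loc)
    qed (use d that in auto)
    have Hcyc: "H a b c = H b c a" if abc: "distinct [a, b, c]" "{a, b, c} \<subseteq> {1..n}" for a b c
    proof -
      have "2 \<le> card ({1..n} - {a, b, c})"
        using abc n by (subst card_Diff_subset) auto
      then obtain d e where de: "d \<in> {1..n} - {a, b, c}" "e \<in> {1..n} - {a, b, c}" "d \<noteq> e"
        by (rule ex_two_distinct)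
      have "H a b c = H d b c" by (rule H1) (use abc de in auto)
      also have "\<dots> = H d e c" by (rule H2) (use abc de in auto)
      also have "\<dots> = H d e a" by (rule H3) (use abc de in auto)
      also have "\<dots> = H d c a" by (rule H2) (use abc de in auto)
      also have "\<dots> = H b c a" by (rule H1) (use abc de in auto)
      finally show ?thesis .
    qed
    have kw: "rtrans k w = w"
    proof
      fix p
      show "rtrans k w p = w p"
      proof (cases "p \<in> Alt n")
        case True
        have "rtrans k w p = H (p y) (p z) (p x)"
          using H[of "p \<circ> k"] True k d by (simp add: rtrans_def k_def)
        also have "\<dots> = H (p x) (p y) (p z)"
        proof (rule Hcyc[symmetric])
          show "distinct [p x, p y, p z]" using d True by simp
          show "{p x, p y, p z} \<subseteq> {1..n}" using d True Alt_in_range[OF True] by blast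
        qed
        finally show ?thesis using H[OF True] by simp
      next
        case False
        then show ?thesis using supp[OF w] k by (simp add: rtrans_def)
      qed
    qed
    show "rtrans k v = v"
    proof
      fix p
      have e1: "w q = v q - v (q \<circ> k)" for q by (simp add: w_def rtrans_def)
      have e2: "w (q \<circ> k) = w q" for q using fun_cong[OF kw, of q] by (simp add: rtrans_def)
      have "w (p \<circ> k) = w p" "w (p \<circ> k \<circ> k) = w p" using e2[of p] e2[of "p \<circ> k"] by simp_all
      moreover have "p \<circ> k \<circ> k \<circ> k = p"
        using three_cycle_cubed[OF d(1)] by (simp only: comp_assoc k_def comp_id)
      ultimately have "w p = 0"
        using e1[of p] e1[of "p \<circ> k"] e1[of "p \<circ> k \<circ> k"] by simp
      then show "rtrans k v p = v p" by (simp add: w_def)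
    qed
  qed
  have alt_fix: "rtrans s g = g" if "s \<in> Alt n" for s
  proof (rule ext[of "{1..n}"])
    show "s permutes {1..n}" "evenperm s" using that by (auto simp: alt_group_carrier)
    fix a b c d assume "distinct [a, b, c, d]" "{a, b, c, d} \<subseteq> {1..n}"
    then have "rtrans (three_cycle a b c) (rtrans (three_cycle b c d) g) = g"
      using assms(1) by (simp add: three_fix)
    then show "rtrans (dbl_transp a b c d) g = g"
      by (simp add: rtrans_rtrans three_cycle_comp_three_cycle)
  qed (use n in auto)
  define c where "c = g id"
  have const: "g p = c" if "p \<in> Alt n" for p
    using fun_cong[OF alt_fix[OF that], of id] by (simp add: rtrans_def c_def)
  have "c = 0"
    by (rule point_fixed_zero[OF assms(1), where i = 1 and j = 1 and f = "\<lambda>_. c"])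
      (use n const in auto)
  then have "g p = 0" for p using const supp[OF assms(1)] by (cases "p \<in> Alt n") auto
  then show False using assms(2) by auto
qed

end


section \<open>Many orthogonal translates of a joint eigenvector\<close>

lemma dbl_transp_apply [simp]:
  assumes "distinct [a, b, c, d]"
  shows "dbl_transp a b c d a = b" "dbl_transp a b c d b = a"
    "dbl_transp a b c d c = d" "dbl_transp a b c d d = c"
  using assms by (auto simp: dbl_transp_def transpose_def)

lemma dbl_transp_involution:
  assumes "distinct [a, b, c, d]"
  shows "dbl_transp a b c d \<circ> dbl_transp a b c d = id"
proof
  fix x show "(dbl_transp a b c d \<circ> dbl_transp a b c d) x = id x"
    using assms by (cases "x \<in> {a, b, c, d}") (auto simp: dbl_transp_other)
qed

lemma dbl_transp_klein:
  assumes "distinct [a, b, c, d]"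
  shows "dbl_transp a b c d \<circ> dbl_transp a c b d = dbl_transp a d b c"
    "dbl_transp a c b d \<circ> dbl_transp a b c d = dbl_transp a d b c"
proof -
  have d: "distinct [a, c, b, d]" "distinct [a, d, b, c]" using assms by auto
  show "dbl_transp a b c d \<circ> dbl_transp a c b d = dbl_transp a d b c"
  proof
    fix x show "(dbl_transp a b c d \<circ> dbl_transp a c b d) x = dbl_transp a d b c x"
      using assms d by (cases "x \<in> {a, b, c, d}") (auto simp: dbl_transp_other)
  qed
  show "dbl_transp a c b d \<circ> dbl_transp a b c d = dbl_transp a d b c"
  proof
    fix x show "(dbl_transp a c b d \<circ> dbl_transp a b c d) x = dbl_transp a d b c x"
      using assms d by (cases "x \<in> {a, b, c, d}") (auto simp: dbl_transp_other)
  qed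
qed

lemma rtrans_scale: "rtrans s (\<lambda>p. c * g p) = (\<lambda>p. c * rtrans s g p)"
  by (simp add: rtrans_def)

lemma rtrans_eigen_conj:
  assumes "m \<circ> s' = s \<circ> m" "rtrans s' v = (\<lambda>p. c * v p)"
  shows "rtrans s (rtrans m v) = (\<lambda>p. c * rtrans m v p)"
  unfolding rtrans_rtrans assms(1)[symmetric]
  unfolding rtrans_rtrans[symmetric] assms(2) rtrans_scale ..

lemma conj_comp:
  fixes A B :: "'a \<Rightarrow> 'a"
  assumes "A \<circ> s = s1 \<circ> A" "B \<circ> s1 = s2 \<circ> B" shows "(B \<circ> A) \<circ> s = s2 \<circ> (B \<circ> A)"
proof
  fix x
  show "((B \<circ> A) \<circ> s) x = (s2 \<circ> (B \<circ> A)) x"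
    using fun_cong[OF assms(1), of x] fun_cong[OF assms(2), of "A x"] by simp
qed

lemma opposite_eigen_orthogonal:
  assumes s: "s \<in> Alt n" and u: "rtrans s u = (\<lambda>p. a * u p)" and v: "rtrans s v = (\<lambda>p. b * v p)"
    and ab: "a * b = -1"
  shows "(\<Sum>p\<in>Alt n. u p * v p) = 0"
proof -
  have "(\<Sum>p\<in>Alt n. u p * v p) = (\<Sum>p\<in>Alt n. u (p \<circ> s) * v (p \<circ> s))"
    by (rule sum.reindex_bij_betw[OF bij_betw_comp_right_Alt[OF s], symmetric])
  also have "\<dots> = (\<Sum>p\<in>Alt n. - (u p * v p))"
  proof (rule sum.cong)
    fix p
    have "u (p \<circ> s) * v (p \<circ> s) = (a * b) * (u p * v p)"
      using fun_cong[OF u, of p] fun_cong[OF v, of p] by (simp add: rtrans_def)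
    then show "u (p \<circ> s) * v (p \<circ> s) = - (u p * v p)" by (simp add: ab)
  qed simp
  finally show ?thesis by (simp add: sum_negf)
qed

context transl_module
begin

text \<open>
  Symmetrising \<open>w\<close> over one involution after the other either keeps it nonzero or shows that it is
  already an eigenvector for the eigenvalue \<open>-1\<close>. Eigenvalues of \<open>w\<close> under permutations commuting
  with the whole list survive, which later guarantees that the eigenvector is nontrivial on the
  first two blocks.
\<close>
lemma joint_eigenvector:
  assumes "w \<in> E" "w \<noteq> (\<lambda>p. 0)" "set ts \<subseteq> Alt n"
    and "\<And>s. s \<in> set ts \<Longrightarrow> s \<circ> s = id"
    and "\<And>s t. s \<in> set ts \<Longrightarrow> t \<in> set ts \<Longrightarrow> s \<circ> t = t \<circ> s"
  shows "\<exists>v\<in>E. v \<noteq> (\<lambda>p. 0)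
    \<and> (\<forall>s\<in>set ts. rtrans s v = (\<lambda>p. 1 * v p) \<or> rtrans s v = (\<lambda>p. -1 * v p))
    \<and> (\<forall>u c. (\<forall>s\<in>set ts. u \<circ> s = s \<circ> u) \<longrightarrow> rtrans u w = (\<lambda>p. c * w p) \<longrightarrow> rtrans u v = (\<lambda>p. c * v p))"
  using assms(3-5)
proof (induction ts)
  case Nil
  then show ?case using assms(1,2) by auto
next
  case (Cons s ts)
  obtain v where v: "v \<in> E" "v \<noteq> (\<lambda>p. 0)"
    "\<And>s. s \<in> set ts \<Longrightarrow> rtrans s v = (\<lambda>p. 1 * v p) \<or> rtrans s v = (\<lambda>p. -1 * v p)"
    "\<And>u c. (\<forall>s\<in>set ts. u \<circ> s = s \<circ> u) \<Longrightarrow> rtrans u w = (\<lambda>p. c * w p) \<Longrightarrow> rtrans u v = (\<lambda>p. c * v p)"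
  proof -
    have "set ts \<subseteq> Alt n" "\<And>s. s \<in> set ts \<Longrightarrow> s \<circ> s = id"
      "\<And>s t. s \<in> set ts \<Longrightarrow> t \<in> set ts \<Longrightarrow> s \<circ> t = t \<circ> s"
      using Cons.prems by (auto simp only: list.set)
    from Cons.IH[OF this] show thesis using that by blast
  qed
  define v' where "v' = (\<lambda>p. v p + rtrans s v p)"
  show ?case
  proof (cases "v' = (\<lambda>p. 0)")
    case True
    have sv: "rtrans s v = (\<lambda>p. -1 * v p)"
    proof
      fix p show "rtrans s v p = -1 * v p"
        using fun_cong[OF True, of p] by (simp add: v'_def)
    qed
    show ?thesis
    proof (intro bexI[of _ v] conjI v(1,2) ballI allI impI)
      fix t assume "t \<in> set (s # ts)"
      then consider "t = s" | "t \<in> set ts" by auto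
      then show "rtrans t v = (\<lambda>p. 1 * v p) \<or> rtrans t v = (\<lambda>p. -1 * v p)"
        using sv v(3) by cases blast+
    next
      fix u c
      assume u: "\<forall>t\<in>set (s # ts). u \<circ> t = t \<circ> u" "rtrans u w = (\<lambda>p. c * w p)"
      show "rtrans u v = (\<lambda>p. c * v p)"
        by (rule v(4)[OF _ u(2)]) (use u(1) in \<open>unfold list.set, blast\<close>)
    qed
  next
    case False
    have s: "s \<in> Alt n" using Cons.prems(1) by auto
    have ss: "s \<circ> s = id" by (rule Cons.prems(2)) simp
    have mem: "v' \<in> E"
      using lin[OF v(1) transl[OF v(1) s], of 1 1] by (simp add: v'_def)
    have sv: "rtrans s v' = (\<lambda>p. 1 * v' p)"
    proof
      fix p :: "nat \<Rightarrow> nat"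
      have "p \<circ> s \<circ> s = p" using ss by (simp only: comp_assoc comp_id)
      then show "rtrans s v' p = 1 * v' p" by (simp add: v'_def rtrans_def)
    qed
    have eig: "rtrans u v' = (\<lambda>p. c * v' p)" if "u \<circ> s = s \<circ> u" "rtrans u v = (\<lambda>p. c * v p)" for u c
    proof
      fix p
      have "rtrans u (rtrans s v) = (\<lambda>p. c * rtrans s v p)"
        by (rule rtrans_eigen_conj[OF that(1)[symmetric] that(2)])
      from fun_cong[OF this, of p] fun_cong[OF that(2), of p]
      show "rtrans u v' p = c * v' p"
        unfolding v'_def by (simp add: rtrans_def distrib_left)
    qed
    show ?thesis
    proof (intro bexI[of _ v'] conjI mem False ballI allI impI)
      fix t assume t: "t \<in> set (s # ts)"
      show "rtrans t v' = (\<lambda>p. 1 * v' p) \<or> rtrans t v' = (\<lambda>p. -1 * v' p)"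
      proof (cases "t = s")
        case True then show ?thesis using sv by simp
      next
        case False
        then have "t \<in> set ts" using t by simp
        moreover have "t \<circ> s = s \<circ> t" using Cons.prems(3) t by (meson list.set_intros(1))
        ultimately show ?thesis using v(3)[of t] eig[of t 1] eig[of t "-1"] by blast
      qed
    next
      fix u c
      assume u: "\<forall>t\<in>set (s # ts). u \<circ> t = t \<circ> u" "rtrans u w = (\<lambda>p. c * w p)"
      then have "u \<circ> s = s \<circ> u" by (meson list.set_intros(1))
      moreover have "rtrans u v = (\<lambda>p. c * v p)" by (rule v(4)[OF _ u(2)]) (use u(1) in \<open>unfold list.set, blast\<close>)
      ultimately show "rtrans u v' = (\<lambda>p. c * v' p)" by (rule eig)
    qed
  qed
qed

text \<open>
  Cut the points into blocks of four, so that the eight points of \<open>ex_moving_pair\<close> form the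
  first two blocks, and let \<open>t0 i\<close> and \<open>t1 i\<close> generate the Klein four-group on block \<open>i\<close>. A joint
  eigenvector has a support \<open>S\<close>, the set of blocks on which some eigenvalue is \<open>-1\<close>. If \<open>S\<close> contains
  about half of the blocks, three-cycles inside two blocks of \<open>S\<close> permute the nontrivial characters there
  and leave all other blocks alone. If not, the first two blocks, which lie in \<open>S\<close>, are exchanged
  with two blocks outside \<open>S\<close>. In both cases different pairs of blocks give different characters,
  hence orthogonal vectors.
\<close>
lemma ex_orthogonal_family:
  assumes "g \<in> E" "g \<noteq> (\<lambda>p. 0)"
  shows "\<exists>(K :: nat set set) e. finite K \<and> (n div 8) choose 2 \<le> card K
    \<and> (\<forall>k\<in>K. e k \<in> E \<and> e k \<noteq> (\<lambda>p. 0))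
    \<and> (\<forall>k\<in>K. \<forall>l\<in>K. k \<noteq> l \<longrightarrow> (\<Sum>p\<in>Alt n. e k p * e l p) = 0)"
proof -
  obtain a b c d a' b' c' d' g' where
    dist: "distinct [a, b, c, d, a', b', c', d']" and sub: "{a, b, c, d, a', b', c', d'} \<subseteq> {1..n}"
    and g': "g' \<in> E"
    and move: "rtrans (dbl_transp a b c d) (\<lambda>p. g' p - rtrans (dbl_transp a' b' c' d') g' p)
      \<noteq> (\<lambda>p. g' p - rtrans (dbl_transp a' b' c' d') g' p)"
    using ex_moving_pair[OF assms] .
  define t where "t = dbl_transp a b c d"
  define t' where "t' = dbl_transp a' b' c' d'"
  define w1 where "w1 = (\<lambda>p. g' p - rtrans t' g' p)"
  define w where "w = (\<lambda>p. w1 p - rtrans t w1 p)"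
  have tA: "t \<in> Alt n" "t' \<in> Alt n"
    unfolding t_def t'_def using dist sub by (auto intro!: dbl_transp_Alt)
  have tinv: "t \<circ> t = id" "t' \<circ> t' = id"
    unfolding t_def t'_def using dist by (auto intro!: dbl_transp_involution)
  have tt: "t \<circ> t' = t' \<circ> t"
    unfolding t'_def dbl_transp_conj[OF Alt_bij[OF tA(1)]]
    using dist by (auto simp: t_def dbl_transp_other)
  have w1: "w1 \<in> E" unfolding w1_def by (intro diff transl g' tA)
  have w: "w \<in> E" unfolding w_def by (intro diff transl w1 tA)
  have w0: "w \<noteq> (\<lambda>p. 0)"
  proof
    assume "w = (\<lambda>p. 0)"
    then have "rtrans t w1 p = w1 p" for p by (metis (no_types) eq_iff_diff_eq_0 w_def)
    then show False using move unfolding w1_def t_def t'_def by blast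
  qed
  have neg: "rtrans s (\<lambda>p. h p - rtrans s h p) = (\<lambda>p. -1 * (h p - rtrans s h p))" if "s \<circ> s = id" for s h
    using that by (simp add: rtrans_diff rtrans_rtrans)
  have tw: "rtrans t w = (\<lambda>p. -1 * w p)"
    unfolding w_def by (rule neg[OF tinv(1)])
  have t'w: "rtrans t' w = (\<lambda>p. -1 * w p)"
  proof -
    have 1: "rtrans t' w1 = (\<lambda>p. -1 * w1 p)" unfolding w1_def by (rule neg[OF tinv(2)])
    have 2: "rtrans t' (rtrans t w1) = (\<lambda>p. -1 * rtrans t w1 p)"
      by (rule rtrans_eigen_conj[OF tt 1])
    show ?thesis unfolding w_def rtrans_diff 1 2 by (simp add: fun_eq_iff)
  qed

  obtain zs where zs: "set zs = {1..n} - {a, b, c, d, a', b', c', d'}" "distinct zs"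
    using finite_distinct_list[OF finite_Diff[OF finite_atLeastAtMost]] by blast
  define xs where "xs = [a, b, c, d, a', b', c', d'] @ zs"
  have "set [a, b, c, d, a', b', c', d'] \<inter> set zs = {}" unfolding zs by auto
  then have xs: "distinct xs" unfolding xs_def distinct_append using zs(2) dist by blast
  have xs': "set xs = {1..n}" unfolding xs_def set_append zs using sub by auto
  have len: "length xs = n" using distinct_card[OF xs] xs' by simp
  define m where "m = n div 4"
  have m2: "m \<ge> 2" using n by (simp add: m_def)
  define q where "q = (\<lambda>i r. xs ! (4 * i + r))"
  have bound: "4 * i + r < n" if "i < m" "r < 4" for i r
    using that by (simp add: m_def)
  have q_eq: "q i r = q j s \<longleftrightarrow> i = j \<and> r = s" if "i < m" "j < m" "r < 4" "s < 4" for i j r s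
  proof -
    have "q i r = q j s \<longleftrightarrow> 4 * i + r = 4 * j + s"
      unfolding q_def using bound that len xs by (simp add: nth_eq_iff_index_eq)
    also have "\<dots> \<longleftrightarrow> i = j \<and> r = s" using that by presburger
    finally show ?thesis .
  qed
  have q_in: "q i r \<in> {1..n}" if "i < m" "r < 4" for i r
    unfolding q_def using nth_mem[of "4 * i + r" xs] bound[OF that] len xs' by simp
  define t0 where "t0 = (\<lambda>i. dbl_transp (q i 0) (q i 1) (q i 2) (q i 3))"
  define t1 where "t1 = (\<lambda>i. dbl_transp (q i 0) (q i 2) (q i 1) (q i 3))"
  have d0: "distinct [q i 0, q i 1, q i 2, q i 3]" if "i < m" for i
    using that by (simp add: q_eq)
  have d1: "distinct [q i 0, q i 2, q i 1, q i 3]" if "i < m" for i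
    using that by (simp add: q_eq)
  have in4: "{q i 0, q i 1, q i 2, q i 3} \<subseteq> {1..n}" if "i < m" for i
    using that q_in by simp
  have in4': "{q i 0, q i 2, q i 1, q i 3} \<subseteq> {1..n}" if "i < m" for i
    using that q_in by simp
  have t0A: "t0 i \<in> Alt n" if "i < m" for i
    unfolding t0_def by (rule dbl_transp_Alt[OF d0[OF that] in4[OF that]])
  have t1A: "t1 i \<in> Alt n" if "i < m" for i
    unfolding t1_def by (rule dbl_transp_Alt[OF d1[OF that] in4'[OF that]])
  have t_eq: "t = t0 0" "t' = t0 1"
    by (simp_all add: t_def t'_def t0_def q_def xs_def)
  \<comment> \<open>a permutation fixing block \<open>i\<close> commutes with the Klein four-group there\<close>
  have fixes0: "k \<circ> t0 i = t0 i \<circ> k" and fixes1: "k \<circ> t1 i = t1 i \<circ> k"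
    if "bij k" "\<And>r. r < 4 \<Longrightarrow> k (q i r) = q i r" for k i
    using that by (simp_all add: t0_def t1_def dbl_transp_conj)
  have t0_fix: "t0 j (q i r) = q i r" and t1_fix: "t1 j (q i r) = q i r"
    if "i < m" "j < m" "i \<noteq> j" "r < 4" for i j r
    using that by (simp_all add: t0_def t1_def dbl_transp_other q_eq)
  have V4: "t0 i \<circ> t1 i = dbl_transp (q i 0) (q i 3) (q i 1) (q i 2)"
    "t1 i \<circ> t0 i = dbl_transp (q i 0) (q i 3) (q i 1) (q i 2)" if "i < m" for i
    unfolding t0_def t1_def by (rule dbl_transp_klein[OF d0[OF that]])+
  define ts where "ts = map t0 [0..<m] @ map t1 [0..<m]"
  have ts: "set ts = t0 ` {..<m} \<union> t1 ` {..<m}" by (auto simp: ts_def)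
  have c00: "t0 i \<circ> t0 j = t0 j \<circ> t0 i" if "i < m" "j < m" for i j
  proof (cases "i = j")
    case False
    show ?thesis by (rule fixes0) (use that False in \<open>auto intro: t0_fix Alt_bij[OF t0A]\<close>)
  qed simp
  have c11: "t1 i \<circ> t1 j = t1 j \<circ> t1 i" if "i < m" "j < m" for i j
  proof (cases "i = j")
    case False
    show ?thesis by (rule fixes1) (use that False in \<open>auto intro: t1_fix Alt_bij[OF t1A]\<close>)
  qed simp
  have c01: "t0 i \<circ> t1 j = t1 j \<circ> t0 i" if "i < m" "j < m" for i j
  proof (cases "i = j")
    case True
    show ?thesis unfolding True V4[OF that(2)] ..
  next
    case False
    show ?thesis by (rule fixes1) (use that False in \<open>auto intro: t0_fix Alt_bij[OF t0A]\<close>)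
  qed
  have tcomm: "s \<circ> s' = s' \<circ> s" if "s \<in> set ts" "s' \<in> set ts" for s s'
    using that c00 c11 c01 c01[symmetric] unfolding ts by blast
  have "\<exists>v\<in>E. v \<noteq> (\<lambda>p. 0)
    \<and> (\<forall>s\<in>set ts. rtrans s v = (\<lambda>p. 1 * v p) \<or> rtrans s v = (\<lambda>p. -1 * v p))
    \<and> (\<forall>u c. (\<forall>s\<in>set ts. u \<circ> s = s \<circ> u) \<longrightarrow> rtrans u w = (\<lambda>p. c * w p) \<longrightarrow> rtrans u v = (\<lambda>p. c * v p))"
  proof (rule joint_eigenvector[OF w w0])
    show "set ts \<subseteq> Alt n" using t0A t1A by (auto simp: ts)
    fix s assume "s \<in> set ts"
    then obtain i where i: "i < m" "s = t0 i \<or> s = t1 i" unfolding ts by blast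
    have "t0 i \<circ> t0 i = id" unfolding t0_def by (rule dbl_transp_involution[OF d0[OF i(1)]])
    moreover have "t1 i \<circ> t1 i = id" unfolding t1_def by (rule dbl_transp_involution[OF d1[OF i(1)]])
    ultimately show "s \<circ> s = id" using i(2) by blast
  qed (rule tcomm)
  then obtain v where v: "v \<in> E" "v \<noteq> (\<lambda>p. 0)"
    and eig: "\<And>s. s \<in> set ts \<Longrightarrow> rtrans s v = (\<lambda>p. 1 * v p) \<or> rtrans s v = (\<lambda>p. -1 * v p)"
    and keep: "\<And>u c. (\<forall>s\<in>set ts. u \<circ> s = s \<circ> u) \<Longrightarrow> rtrans u w = (\<lambda>p. c * w p) \<Longrightarrow> rtrans u v = (\<lambda>p. c * v p)"
    by blast
  define e0 where "e0 = (\<lambda>i. if rtrans (t0 i) v = (\<lambda>p. 1 * v p) then 1 else (-1::real))"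
  define e1 where "e1 = (\<lambda>i. if rtrans (t1 i) v = (\<lambda>p. 1 * v p) then 1 else (-1::real))"
  have e0: "rtrans (t0 i) v = (\<lambda>p. e0 i * v p)" if "i < m" for i
    using eig[of "t0 i"] that by (auto simp: e0_def ts)
  have e1: "rtrans (t1 i) v = (\<lambda>p. e1 i * v p)" if "i < m" for i
    using eig[of "t1 i"] that by (auto simp: e1_def ts)
  have e01: "rtrans (t0 i \<circ> t1 i) v = (\<lambda>p. e0 i * e1 i * v p)" if "i < m" for i
    unfolding rtrans_rtrans[symmetric] e1[OF that] rtrans_scale e0[OF that] by (simp add: fun_eq_iff)
  have e_val: "e0 i = 1 \<or> e0 i = -1" "e1 i = 1 \<or> e1 i = -1" for i by (simp_all add: e0_def e1_def)
  have nz: "rtrans s v \<noteq> (\<lambda>p. 0)" if "s \<in> Alt n" for s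
  proof
    assume 0: "rtrans s v = (\<lambda>p. 0)"
    have "v p = 0" for p :: "nat \<Rightarrow> nat"
    proof -
      have "p \<circ> inv' s \<circ> s = p" using inv_comp_Alt(1)[OF that] by (simp only: comp_assoc comp_id)
      then show ?thesis using fun_cong[OF 0, of "p \<circ> inv' s"] by (simp add: rtrans_def)
    qed
    then show False using v(2) by blast
  qed
  have e00: "e0 0 = -1" and e01': "e0 1 = -1"
  proof -
    obtain p where p: "v p \<noteq> 0" using v(2) by blast
    have comm: "\<forall>s\<in>set ts. t0 i \<circ> s = s \<circ> t0 i" if "i < m" for i
      unfolding ts using c00 c01 that by blast
    have "rtrans (t0 0) v = (\<lambda>p. -1 * v p)"
      by (rule keep[OF comm tw[unfolded t_eq]]) (use m2 in simp)
    then have "e0 0 * v p = -1 * v p" using fun_cong[OF e0[of 0], of p] m2 by simp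
    then show "e0 0 = -1" unfolding mult_cancel_right using p by blast
    have "rtrans (t0 1) v = (\<lambda>p. -1 * v p)"
      by (rule keep[OF comm t'w[unfolded t_eq]]) (use m2 in simp)
    then have "e0 1 * v p = -1 * v p" using fun_cong[OF e0[of 1], of p] m2 by simp
    then show "e0 1 = -1" unfolding mult_cancel_right using p by blast
  qed
  define S where "S = {i. i < m \<and> \<not> (e0 i = 1 \<and> e1 i = 1)}"
  define pairs where "pairs = (\<lambda>M :: nat set. {P. P \<subseteq> M \<and> card P = 2})"
  have pairs: "finite (pairs M)" "(n div 8) choose 2 \<le> card (pairs M)"
    if "finite M" "card M \<ge> n div 8" for M
  proof -
    show "finite (pairs M)" unfolding pairs_def using that(1) by simp
    show "(n div 8) choose 2 \<le> card (pairs M)"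
      unfolding pairs_def n_subsets[OF that(1)] unfolding choose_two
      using that(2) by (intro div_le_mono mult_le_mono diff_le_mono)
  qed
  have pairE: "\<exists>x y. P = {x, y} \<and> x \<noteq> y \<and> Min P = x \<and> Max P = y \<and> x \<in> M \<and> y \<in> M"
    if P: "P \<in> pairs M" for P M
  proof -
    have fP: "finite P" "P \<noteq> {}" "card P = 2" "P \<subseteq> M" using P by (auto simp: pairs_def intro: card_ge_0_finite)
    have "Min P \<noteq> Max P"
    proof
      assume "Min P = Max P"
      then have "P \<subseteq> {Min P}" using fP by (metis Max_ge Min_le antisym singletonI subsetI)
      then show False using card_mono[of "{Min P}" P] fP by simp
    qed
    moreover have "{Min P, Max P} \<subseteq> P" using fP by simp
    ultimately have "P = {Min P, Max P}" using fP by (intro card_seteq[symmetric]) auto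
    then show ?thesis using \<open>Min P \<noteq> Max P\<close> fP by blast
  qed
  have differ: "\<exists>i. (i \<in> P \<and> i \<notin> P') " if "P \<in> pairs M" "P' \<in> pairs M" "P \<noteq> P'" for P P' M
  proof (rule ccontr)
    assume "\<not> ?thesis"
    then have "P \<subseteq> P'" by blast
    moreover have "finite P'" "card P = card P'" using that by (auto simp: pairs_def intro: card_ge_0_finite)
    ultimately show False using that(3) card_subset_eq by blast
  qed
  have cardS: "card S \<ge> n div 8 \<or> card ({..<m} - S) \<ge> n div 8"
  proof -
    have "S \<subseteq> {..<m}" by (auto simp: S_def)
    then have "card S + card ({..<m} - S) = m"
      by (metis card_Diff_subset card_lessThan card_mono finite_lessThan finite_subset le_add_diff_inverse)
    then show ?thesis by (simp add: m_def) linarith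
  qed
  then show ?thesis
  proof
    assume big: "card S \<ge> n div 8"
    define k where "k = (\<lambda>i. three_cycle (q i 1) (q i 2) (q i 3))"
    have dk: "distinct [q i 1, q i 2, q i 3]" if "i < m" for i using that by (simp add: q_eq)
    have kA: "k i \<in> Alt n" if "i < m" for i
      unfolding k_def using that q_in by (intro three_cycle_Alt dk) auto
    have k_fix: "k j (q i r) = q i r" if "i < m" "j < m" "i \<noteq> j" "r < 4" for i j r
      using that by (simp add: k_def three_cycle_other q_eq)
    have k0: "k i \<circ> t0 i = t1 i \<circ> k i" and k1: "k i \<circ> t1 i = (t0 i \<circ> t1 i) \<circ> k i" if i: "i < m" for i
    proof -
      have "k i (q i 0) = q i 0" using i by (simp add: k_def three_cycle_other q_eq)
      then show "k i \<circ> t0 i = t1 i \<circ> k i" "k i \<circ> t1 i = (t0 i \<circ> t1 i) \<circ> k i"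
        unfolding V4[OF i] unfolding t0_def t1_def dbl_transp_conj[OF Alt_bij[OF kA[OF i]]]
        using three_cycle_apply[OF dk[OF i]]
        by (simp_all add: k_def dbl_transp_def transpose_commute)
    qed
    have kc0: "k j \<circ> t0 i = t0 i \<circ> k j" and kc1: "k j \<circ> t1 i = t1 i \<circ> k j" if "i < m" "j < m" "i \<noteq> j" for i j
      by (rule fixes0 fixes1; use that in \<open>simp add: Alt_bij[OF kA] k_fix\<close>)+
    have kc01: "k j \<circ> (t0 i \<circ> t1 i) = (t0 i \<circ> t1 i) \<circ> k j" if "i < m" "j < m" "i \<noteq> j" for i j
      unfolding comp_assoc[symmetric] kc0[OF that] unfolding comp_assoc kc1[OF that] ..
    \<comment> \<open>the translate belonging to a pair of blocks; \<open>Min\<close> and \<open>Max\<close> name its two elements\<close>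
    define \<mu> where "\<mu> = (\<lambda>P. k (Min P) \<circ> k (Max P))"
    define e where "e = (\<lambda>P. rtrans (\<mu> P) v)"
    have SM: "i < m" if "i \<in> S" for i using that by (simp add: S_def)
    have \<mu>A: "\<mu> P \<in> Alt n" if "P \<in> pairs S" for P
      using pairE[OF that] SM by (auto simp: \<mu>_def intro!: comp_Alt kA)
    have in0: "rtrans (t1 i) (e P) = (\<lambda>p. e0 i * e P p)"
      and in1: "rtrans (t0 i \<circ> t1 i) (e P) = (\<lambda>p. e1 i * e P p)" if P: "P \<in> pairs S" and i: "i \<in> P" for P i
    proof -
      obtain x y where xy: "P = {x, y}" "x \<noteq> y" "Min P = x" "Max P = y" "x \<in> S" "y \<in> S"
        using pairE[OF P] by blast
      have l: "x < m" "y < m" using xy SM by auto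
      have 0: "\<mu> P \<circ> t0 i = t1 i \<circ> \<mu> P"
      proof (cases "i = x")
        case True
        show ?thesis unfolding \<mu>_def xy(3,4) True
          by (rule conj_comp[OF kc0 k0]) (use l xy in auto)
      next
        case False
        then have "i = y" using i xy by simp
        then show ?thesis unfolding \<mu>_def xy(3,4)
          using conj_comp[OF k0[of y] kc1[of y x]] l xy by auto
      qed
      have 1: "\<mu> P \<circ> t1 i = (t0 i \<circ> t1 i) \<circ> \<mu> P"
      proof (cases "i = x")
        case True
        show ?thesis unfolding \<mu>_def xy(3,4) True
          by (rule conj_comp[OF kc1 k1]) (use l xy in auto)
      next
        case False
        then have "i = y" using i xy by simp
        then show ?thesis unfolding \<mu>_def xy(3,4)
          using conj_comp[OF k1[of y] kc01[of y x]] l xy by auto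
      qed
      have "i < m" using i xy l by auto
      then show "rtrans (t1 i) (e P) = (\<lambda>p. e0 i * e P p)" "rtrans (t0 i \<circ> t1 i) (e P) = (\<lambda>p. e1 i * e P p)"
        unfolding e_def by (rule rtrans_eigen_conj[OF 0 e0] rtrans_eigen_conj[OF 1 e1])+
    qed
    have out0: "rtrans (t1 i) (e P) = (\<lambda>p. e1 i * e P p)"
      and out1: "rtrans (t0 i \<circ> t1 i) (e P) = (\<lambda>p. e0 i * e1 i * e P p)" if P: "P \<in> pairs S" and i: "i \<notin> P" "i < m" for P i
    proof -
      obtain x y where xy: "P = {x, y}" "x \<noteq> y" "Min P = x" "Max P = y" "x \<in> S" "y \<in> S"
        using pairE[OF P] by blast
      have l: "x < m" "y < m" using xy SM by auto
      have 0: "\<mu> P \<circ> t1 i = t1 i \<circ> \<mu> P"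
        unfolding \<mu>_def xy(3,4) by (rule conj_comp[OF kc1 kc1]) (use l xy i in auto)
      have 1: "\<mu> P \<circ> (t0 i \<circ> t1 i) = (t0 i \<circ> t1 i) \<circ> \<mu> P"
        unfolding \<mu>_def xy(3,4) by (rule conj_comp[OF kc01 kc01]) (use l xy i in auto)
      show "rtrans (t1 i) (e P) = (\<lambda>p. e1 i * e P p)" "rtrans (t0 i \<circ> t1 i) (e P) = (\<lambda>p. e0 i * e1 i * e P p)"
        unfolding e_def using rtrans_eigen_conj[OF 0 e1[OF i(2)]] rtrans_eigen_conj[OF 1 e01[OF i(2)]] by blast+
    qed
    have "(\<Sum>p\<in>Alt n. e P p * e P' p) = 0" if P: "P \<in> pairs S" "P' \<in> pairs S" "P \<noteq> P'" for P P'
    proof -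
      obtain i where i: "i \<in> P" "i \<notin> P'" using differ[OF P] by blast
      have iS: "i \<in> S" using i P(1) by (auto simp: pairs_def)
      then have im: "i < m" "\<not> (e0 i = 1 \<and> e1 i = 1)" by (auto simp: S_def)
      show ?thesis
      proof (cases "e0 i * e1 i = -1")
        case True
        show ?thesis
          by (rule opposite_eigen_orthogonal[OF t1A[OF im(1)] in0[OF P(1) i(1)] out0[OF P(2) i(2) im(1)] True])
      next
        case False
        \<comment> \<open>both signs are \<open>-1\<close> because block \<open>i\<close> lies in \<open>S\<close>; the product of the two involutions separates\<close>
        then have "e1 i * (e0 i * e1 i) = -1" using im(2) e_val[of i] by auto
        then show ?thesis
          by (rule opposite_eigen_orthogonal[OF comp_Alt[OF t0A[OF im(1)] t1A[OF im(1)]] in1[OF P(1) i(1)] out1[OF P(2) i(2) im(1)]])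
      qed
    qed
    moreover have "e P \<in> E \<and> e P \<noteq> (\<lambda>p. 0)" if "P \<in> pairs S" for P
      unfolding e_def by (intro conjI transl v(1) \<mu>A[OF that] nz)
    ultimately show ?thesis
      using pairs[of S] big by (intro exI[of _ "pairs S"] exI[of _ e]) (auto simp: S_def)
  next
    define M where "M = {..<m} - S"
    assume big: "card ({..<m} - S) \<ge> n div 8"
    \<comment> \<open>exchanging two blocks takes four transpositions, hence is even\<close>
    define k where "k = (\<lambda>i j. dbl_transp (q i 0) (q j 0) (q i 1) (q j 1) \<circ> dbl_transp (q i 2) (q j 2) (q i 3) (q j 3))"
    have dk: "distinct [q i 0, q j 0, q i 1, q j 1]" "distinct [q i 2, q j 2, q i 3, q j 3]"
      if "i < m" "j < m" "i \<noteq> j" for i j using that by (simp_all add: q_eq)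
    have kA: "k i j \<in> Alt n" if "i < m" "j < m" "i \<noteq> j" for i j
      unfolding k_def using that q_in by (intro comp_Alt dbl_transp_Alt dk) auto
    have k_fix: "k i j (q l r) = q l r" if "i < m" "j < m" "i \<noteq> j" "l < m" "l \<noteq> i" "l \<noteq> j" "r < 4" for i j l r
      using that by (simp add: k_def dbl_transp_other q_eq)
    have k_move: "k i j (q i 0) = q j 0" "k i j (q i 1) = q j 1" "k i j (q i 2) = q j 2" "k i j (q i 3) = q j 3"
      if ij: "i < m" "j < m" "i \<noteq> j" for i j
      using dbl_transp_apply[OF dk(1)[OF ij]] dbl_transp_apply[OF dk(2)[OF ij]] ij
      by (simp_all add: k_def dbl_transp_other q_eq)
    have km: "k i j \<circ> t0 i = t0 j \<circ> k i j" if "i < m" "j < m" "i \<noteq> j" for i j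
      unfolding t0_def dbl_transp_conj[OF Alt_bij[OF kA[OF that]]] k_move[OF that] ..
    have kc: "k i j \<circ> t0 l = t0 l \<circ> k i j" if "i < m" "j < m" "i \<noteq> j" "l < m" "l \<noteq> i" "l \<noteq> j" for i j l
      by (rule fixes0) (use that in \<open>simp_all add: Alt_bij[OF kA] k_fix\<close>)
    define \<mu> where "\<mu> = (\<lambda>P. k 0 (Min P) \<circ> k 1 (Max P))"
    define e where "e = (\<lambda>P. rtrans (\<mu> P) v)"
    have M: "i < m" "i \<noteq> 0" "i \<noteq> 1" "e0 i = 1" if "i \<in> M" for i
    proof -
      show "i < m" "e0 i = 1" using that by (auto simp: M_def S_def)
      then show "i \<noteq> 0" "i \<noteq> 1" using e00 e01' by (metis one_neq_neg_one)+
    qed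
    have m01: "0 < m" "1 < m" using m2 by auto
    have \<mu>A: "\<mu> P \<in> Alt n" if P: "P \<in> pairs M" for P
    proof -
      obtain x y where xy: "P = {x, y}" "x \<noteq> y" "Min P = x" "Max P = y" "x \<in> M" "y \<in> M"
        using pairE[OF P] by blast
      show ?thesis unfolding \<mu>_def xy(3,4) using M[OF xy(5)] M[OF xy(6)] m01 by (intro comp_Alt kA) auto
    qed
    have inn: "rtrans (t0 i) (e P) = (\<lambda>p. -1 * e P p)" if P: "P \<in> pairs M" and i: "i \<in> P" for P i
    proof -
      obtain x y where xy: "P = {x, y}" "x \<noteq> y" "Min P = x" "Max P = y" "x \<in> M" "y \<in> M"
        using pairE[OF P] by blast
      note l = M[OF xy(5)] M[OF xy(6)] m01
      show ?thesis
      proof (cases "i = x")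
        case True
        have "\<mu> P \<circ> t0 0 = t0 x \<circ> \<mu> P" unfolding \<mu>_def xy(3,4)
          by (rule conj_comp[OF kc km]) (use l xy in auto)
        then show ?thesis unfolding e_def True using e0[of 0] m01 e00 by (intro rtrans_eigen_conj) auto
      next
        case False
        then have "i = y" using i xy by simp
        have "\<mu> P \<circ> t0 1 = t0 y \<circ> \<mu> P" unfolding \<mu>_def xy(3,4)
          by (rule conj_comp[OF km kc]) (use l xy in auto)
        then show ?thesis unfolding e_def \<open>i = y\<close> using e0[of 1] m01 e01' by (intro rtrans_eigen_conj) auto
      qed
    qed
    have out: "rtrans (t0 i) (e P) = (\<lambda>p. 1 * e P p)" if P: "P \<in> pairs M" and i: "i \<notin> P" "i \<in> M" for P i
    proof -
      obtain x y where xy: "P = {x, y}" "x \<noteq> y" "Min P = x" "Max P = y" "x \<in> M" "y \<in> M"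
        using pairE[OF P] by blast
      note l = M[OF xy(5)] M[OF xy(6)] m01 M[OF i(2)]
      have "\<mu> P \<circ> t0 i = t0 i \<circ> \<mu> P" unfolding \<mu>_def xy(3,4)
        by (rule conj_comp[OF kc kc]) (use l xy i in auto)
      then show ?thesis unfolding e_def using e0[of i] l by (intro rtrans_eigen_conj) auto
    qed
    have "(\<Sum>p\<in>Alt n. e P p * e P' p) = 0" if P: "P \<in> pairs M" "P' \<in> pairs M" "P \<noteq> P'" for P P'
    proof -
      obtain i where i: "i \<in> P" "i \<notin> P'" using differ[OF P] by blast
      have iM: "i \<in> M" using i P(1) by (auto simp: pairs_def)
      show ?thesis
        by (rule opposite_eigen_orthogonal[OF t0A[OF M(1)[OF iM]] inn[OF P(1) i(1)] out[OF P(2) i(2) iM]]) simp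
    qed
    moreover have "e P \<in> E \<and> e P \<noteq> (\<lambda>p. 0)" if "P \<in> pairs M" for P
      unfolding e_def by (intro conjI transl v(1) \<mu>A[OF that] nz)
    ultimately show ?thesis
      using pairs[of M] big by (intro exI[of _ "pairs M"] exI[of _ e]) (auto simp: M_def)
  qed
qed

end


section \<open>Convolution on the orthogonal complement of degree one\<close>

definition ip :: "nat \<Rightarrow> ((nat \<Rightarrow> nat) \<Rightarrow> real) \<Rightarrow> ((nat \<Rightarrow> nat) \<Rightarrow> real) \<Rightarrow> real"
  where "ip n g h = (\<Sum>p\<in>Alt n. g p * h p)"

definition deg1_perp :: "nat \<Rightarrow> ((nat \<Rightarrow> nat) \<Rightarrow> real) set"
  where "deg1_perp n = {g. (\<forall>p. p \<notin> Alt n \<longrightarrow> g p = 0) \<and>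
    (\<forall>i\<in>{1..n}. \<forall>j\<in>{1..n}. (\<Sum>p | p \<in> Alt n \<and> p i = j. g p) = 0)}"

text \<open>Left convolution with the indicator of \<open>X\<close>; it commutes with right translations.\<close>
definition conv :: "(nat \<Rightarrow> nat) set \<Rightarrow> ((nat \<Rightarrow> nat) \<Rightarrow> real) \<Rightarrow> (nat \<Rightarrow> nat) \<Rightarrow> real"
  where "conv X g = (\<lambda>z. \<Sum>x\<in>X. g (inv' x \<circ> z))"

lemma ip_nonneg: "ip n g g \<ge> 0"
  by (simp add: ip_def sum_nonneg)

lemma ip_pos: "p \<in> Alt n \<Longrightarrow> g p \<noteq> 0 \<Longrightarrow> ip n g g > 0"
  unfolding ip_def by (rule sum_pos2[of _ p]) (auto simp flip: power2_eq_square)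

lemma ip_scale: "ip n (\<lambda>p. a * g p) (\<lambda>p. a * g p) = a\<^sup>2 * ip n g g"
  by (simp add: ip_def sum_distrib_left power2_eq_square mult_ac)

lemma ip_parallelogram:
  "ip n (\<lambda>p. a * g p + b * h p) (\<lambda>p. a * g p + b * h p) + ip n (\<lambda>p. a * g p + (- b) * h p) (\<lambda>p. a * g p + (- b) * h p)
    = 2 * a\<^sup>2 * ip n g g + 2 * b\<^sup>2 * ip n h h"
  unfolding ip_def sum.distrib[symmetric] sum_distrib_left
  by (intro sum.cong) (auto simp: power2_eq_square algebra_simps)

lemma ip_rtrans: "s \<in> Alt n \<Longrightarrow> ip n (rtrans s g) (rtrans s g) = ip n g g"
  unfolding ip_def rtrans_def
  by (rule sum.reindex_bij_betw[OF bij_betw_comp_right_Alt, where g = "\<lambda>p. g p * g p"])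

lemma conv_lin: "conv X (\<lambda>p. a * g p + b * h p) = (\<lambda>p. a * conv X g p + b * conv X h p)"
  by (simp add: conv_def sum.distrib sum_distrib_left)

lemma conv_scale: "conv X (\<lambda>p. a * g p) = (\<lambda>p. a * conv X g p)"
  by (simp add: conv_def sum_distrib_left)

lemma conv_rtrans: "conv X (rtrans s g) = rtrans s (conv X g)"
  by (simp add: conv_def rtrans_def comp_assoc)

lemma deg1_perp_lin:
  "g \<in> deg1_perp n \<Longrightarrow> h \<in> deg1_perp n \<Longrightarrow> (\<lambda>p. a * g p + b * h p) \<in> deg1_perp n"
  by (simp add: deg1_perp_def sum.distrib sum_distrib_left[symmetric])

lemma deg1_perp_scale: "g \<in> deg1_perp n \<Longrightarrow> (\<lambda>p. a * g p) \<in> deg1_perp n"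
  using deg1_perp_lin[of g n g a 0] by simp

lemma deg1_perp_rtrans:
  assumes g: "g \<in> deg1_perp n" and s: "s \<in> Alt n" shows "rtrans s g \<in> deg1_perp n"
proof -
  have "(\<Sum>p | p \<in> Alt n \<and> p i = j. rtrans s g p) = 0" if ij: "i \<in> {1..n}" "j \<in> {1..n}" for i j
  proof -
    have si: "s (inv' s i) = i" using inv_comp_Alt(2)[OF s] by (metis comp_apply id_apply)
    have "bij_betw (\<lambda>p. p \<circ> s) {p \<in> Alt n. p i = j} {p \<in> Alt n. p (inv' s i) = j}"
      using bij_betw_comp_right_Alt[OF s]
    proof (rule bij_betw_subset)
      show "(\<lambda>p. p \<circ> s) ` {p \<in> Alt n. p i = j} = {p \<in> Alt n. p (inv' s i) = j}"
      proof (intro equalityI subsetI)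
        fix p assume "p \<in> (\<lambda>p. p \<circ> s) ` {p \<in> Alt n. p i = j}"
        then show "p \<in> {p \<in> Alt n. p (inv' s i) = j}" using s si by auto
      next
        fix p assume p: "p \<in> {p \<in> Alt n. p (inv' s i) = j}"
        have "p = (p \<circ> inv' s) \<circ> s" using inv_comp_Alt(1)[OF s] by (simp only: comp_assoc comp_id)
        then show "p \<in> (\<lambda>p. p \<circ> s) ` {p \<in> Alt n. p i = j}"
          using p s by (intro image_eqI[where x = "p \<circ> inv' s"]) auto
      qed
    qed auto
    from sum.reindex_bij_betw[OF this, of g]
    have "(\<Sum>p | p \<in> Alt n \<and> p i = j. rtrans s g p) = (\<Sum>p | p \<in> Alt n \<and> p (inv' s i) = j. g p)"
      by (simp add: rtrans_def)
    also have "\<dots> = 0"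
      using g ij Alt_in_range[OF inv_Alt[OF s], of i] unfolding deg1_perp_def by blast
    finally show ?thesis .
  qed
  moreover have "rtrans s g p = 0" if "p \<notin> Alt n" for p
    using that s g by (simp add: rtrans_def deg1_perp_def)
  ultimately show ?thesis unfolding deg1_perp_def by blast
qed

lemma bessel_inequality:
  assumes K: "finite K" and pos: "\<And>k. k \<in> K \<Longrightarrow> ip n (e k) (e k) > 0"
    and orth: "\<And>k l. k \<in> K \<Longrightarrow> l \<in> K \<Longrightarrow> k \<noteq> l \<Longrightarrow> ip n (e k) (e l) = 0"
  shows "(\<Sum>k\<in>K. (ip n f (e k))\<^sup>2 / ip n (e k) (e k)) \<le> ip n f f"
proof -
  define c where "c = (\<lambda>k. ip n f (e k) / ip n (e k) (e k))"
  define u where "u = (\<lambda>p. \<Sum>k\<in>K. c k * e k p)"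
  have fu: "ip n f u = (\<Sum>k\<in>K. (ip n f (e k))\<^sup>2 / ip n (e k) (e k))"
  proof -
    have "ip n f u = (\<Sum>k\<in>K. c k * ip n f (e k))"
      unfolding ip_def u_def sum_distrib_left by (subst sum.swap) (simp add: mult_ac)
    then show ?thesis by (simp add: c_def power2_eq_square)
  qed
  have eu: "ip n u (e k) = ip n f (e k)" if "k \<in> K" for k
  proof -
    have "ip n u (e k) = (\<Sum>l\<in>K. c l * ip n (e l) (e k))"
      unfolding ip_def u_def sum_distrib_left sum_distrib_right by (subst sum.swap) (simp add: mult_ac)
    also have "\<dots> = (\<Sum>l\<in>K. if l = k then c l * ip n (e l) (e k) else 0)"
      using that orth by (intro sum.cong) auto
    also have "\<dots> = ip n f (e k)"
      using K that pos[OF that] by (simp add: c_def)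
    finally show ?thesis .
  qed
  have uu: "ip n u u = ip n f u"
  proof -
    have "ip n u u = (\<Sum>k\<in>K. c k * ip n u (e k))"
      unfolding ip_def by (subst (2) u_def, unfold sum_distrib_left) (subst sum.swap, simp add: mult_ac)
    also have "\<dots> = (\<Sum>k\<in>K. c k * ip n f (e k))"
      by (intro sum.cong) (auto simp: eu)
    also have "\<dots> = ip n f u" unfolding fu by (simp add: c_def power2_eq_square)
    finally show ?thesis .
  qed
  have "0 \<le> ip n (\<lambda>p. f p - u p) (\<lambda>p. f p - u p)" by (rule ip_nonneg)
  also have "\<dots> = ip n f f - 2 * ip n f u + ip n u u"
    by (simp add: ip_def sum_subtractf sum.distrib sum_distrib_left algebra_simps)
  finally show ?thesis using uu fu by simp
qed

text \<open>
  For fixed \<open>z\<close>, convolution evaluated at \<open>z\<close> is the inner product with the indicator of a set of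
  the size of \<open>X\<close>, so this is Bessel's inequality summed over \<open>z\<close>: the left-hand side is at most the
  squared Hilbert-Schmidt norm of the convolution operator.
\<close>
lemma conv_bessel:
  assumes X: "X \<subseteq> Alt n" and K: "finite K" and pos: "\<And>k. k \<in> K \<Longrightarrow> ip n (e k) (e k) > 0"
    and orth: "\<And>k l. k \<in> K \<Longrightarrow> l \<in> K \<Longrightarrow> k \<noteq> l \<Longrightarrow> ip n (e k) (e l) = 0"
  shows "(\<Sum>k\<in>K. ip n (conv X (e k)) (conv X (e k)) / ip n (e k) (e k)) \<le> card (Alt n) * card X"
proof -
  have 1: "(\<Sum>k\<in>K. (conv X (e k) z)\<^sup>2 / ip n (e k) (e k)) \<le> card X" if z: "z \<in> Alt n" for z
  proof -
    define Y where "Y = (\<lambda>x. inv' x \<circ> z) ` X"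
    have inj: "inj_on (\<lambda>x. inv' x \<circ> z) X"
    proof (rule inj_onI)
      fix x y assume xy: "x \<in> X" "y \<in> X" "inv' x \<circ> z = inv' y \<circ> z"
      have "inv' x \<circ> (z \<circ> inv' z) = inv' y \<circ> (z \<circ> inv' z)"
        unfolding o_assoc xy(3) ..
      then have "inv' x = inv' y" by (simp only: inv_comp_Alt(2)[OF z] comp_id)
      then show "x = y" using X xy inv_inv_eq Alt_bij by (metis subsetD)
    qed
    have Y: "Y \<subseteq> Alt n" using X z by (auto simp: Y_def)
    have cY: "card Y = card X" unfolding Y_def by (rule card_image[OF inj])
    define f where "f = (\<lambda>y. if y \<in> Y then 1 else (0::real))"
    have "ip n f (e k) = conv X (e k) z" for k
    proof -
      have "ip n f (e k) = (\<Sum>y\<in>Alt n. if y \<in> Y then e k y else 0)"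
        unfolding ip_def f_def by (intro sum.cong) auto
      also have "\<dots> = (\<Sum>y\<in>Y. e k y)" using Y by (simp add: sum.inter_restrict[symmetric] Int_absorb1)
      also have "\<dots> = conv X (e k) z" unfolding Y_def conv_def by (simp add: sum.reindex[OF inj])
      finally show ?thesis .
    qed
    moreover have "ip n f f = card X"
    proof -
      have "ip n f f = (\<Sum>y\<in>Alt n. if y \<in> Y then 1 else 0)"
        unfolding ip_def f_def by (intro sum.cong) auto
      also have "\<dots> = card Y" using Y by (simp add: sum.inter_restrict[symmetric] Int_absorb1)
      finally show ?thesis by (simp add: cY)
    qed
    ultimately show ?thesis using bessel_inequality[OF K pos orth, where f = f] by simp
  qed
  have "(\<Sum>k\<in>K. ip n (conv X (e k)) (conv X (e k)) / ip n (e k) (e k))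
      = (\<Sum>k\<in>K. \<Sum>z\<in>Alt n. (conv X (e k) z)\<^sup>2 / ip n (e k) (e k))"
    by (simp add: ip_def[of n "conv X _"] sum_divide_distrib power2_eq_square)
  also have "\<dots> = (\<Sum>z\<in>Alt n. \<Sum>k\<in>K. (conv X (e k) z)\<^sup>2 / ip n (e k) (e k))"
    by (rule sum.swap)
  also have "\<dots> \<le> (\<Sum>z\<in>Alt n. real (card X))" by (intro sum_mono 1)
  finally show ?thesis by simp
qed

lemma compact_unit_sphere_deg1_perp: "compact {g \<in> deg1_perp n. ip n g g = 1}" (is "compact ?S")
proof -
  define B where "B = (\<lambda>p. if p \<in> Alt n then {-1..1} else {0::real})"
  have "compactin (product_topology (\<lambda>_. euclidean) UNIV) (PiE UNIV B)"
    unfolding compactin_PiE by (auto simp: B_def)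
  then have cB: "compact (PiE UNIV B)" by (simp add: euclidean_product_topology)
  have cc: "continuous_on UNIV (\<lambda>g :: (nat \<Rightarrow> nat) \<Rightarrow> real. g p)" for p by simp
  have "closed ?S"
    unfolding deg1_perp_def ip_def mem_Collect_eq Ball_def
    by (intro closed_Collect_conj closed_Collect_all closed_Collect_imp closed_Collect_eq open_Collect_const
        continuous_intros cc)
  moreover have "?S \<subseteq> PiE UNIV B"
  proof
    fix g assume g: "g \<in> ?S"
    have "g p \<in> B p" for p
    proof (cases "p \<in> Alt n")
      case True
      have "(g p)\<^sup>2 \<le> ip n g g"
        unfolding ip_def power2_eq_square using True by (intro member_le_sum) auto
      then have "\<bar>g p\<bar> \<le> 1" using g by (simp add: abs_square_le_1)
      then show ?thesis using True by (simp add: B_def abs_le_iff)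
    next
      case False
      then show ?thesis using g by (simp add: B_def deg1_perp_def)
    qed
    then show "g \<in> PiE UNIV B" by auto
  qed
  ultimately have "compact (PiE UNIV B \<inter> ?S)" "PiE UNIV B \<inter> ?S = ?S"
    using compact_Int_closed[OF cB] by blast+
  then show ?thesis by (simp only:)
qed

text \<open>
  Let \<open>l\<close> be the maximum of the quadratic form \<open>q\<close>, the squared norm of the convolution, on the unit
  sphere. The difference \<open>l |h|\<^sup>2 - q h\<close> is a nonnegative quadratic form, so its zeros form a
  subspace by the parallelogram law; this subspace is translation-invariant and contains many
  orthogonal functions, each of which contributes \<open>l\<close> to the Hilbert-Schmidt norm.
\<close>
lemma conv_norm_bound:
  assumes n: "n \<ge> 9" and X: "X \<subseteq> Alt n" and g: "g \<in> deg1_perp n"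
  shows "ip n (conv X g) (conv X g) * real ((n div 8) choose 2) \<le> card (Alt n) * card X * ip n g g"
proof (cases "ip n g g = 0")
  case True
  have "g p = 0" for p
    using True ip_pos[of p n g] g by (cases "p \<in> Alt n") (auto simp: deg1_perp_def)
  then show ?thesis by (simp add: conv_def ip_def)
next
  case False
  then have gpos: "ip n g g > 0" using ip_nonneg[of n g] by simp
  let ?S = "{g \<in> deg1_perp n. ip n g g = 1}"
  define q where "q = (\<lambda>g. ip n (conv X g) (conv X g))"
  have q_scale: "q (\<lambda>p. a * g p) = a\<^sup>2 * q g" for a g
    by (simp add: q_def conv_scale ip_scale)
  have normalize: "(\<lambda>p. (1 / sqrt (ip n h h)) * h p) \<in> ?S" if "h \<in> deg1_perp n" "ip n h h > 0" for h
    using that deg1_perp_scale[OF that(1), of "1 / sqrt (ip n h h)"] ip_scale[of n "1 / sqrt (ip n h h)" h]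
    by (simp add: power_divide)
  have ne: "?S \<noteq> {}" using normalize[OF g gpos] by blast
  have "continuous_on ?S q"
    unfolding q_def ip_def conv_def
    by (intro continuous_intros continuous_on_subset[OF continuous_on_product_coordinates subset_UNIV])
  then obtain g0 where g0: "g0 \<in> ?S" "\<And>h. h \<in> ?S \<Longrightarrow> q h \<le> q g0"
    using continuous_attains_sup[OF compact_unit_sphere_deg1_perp ne] by blast
  define l where "l = q g0"
  have q_le: "q h \<le> l * ip n h h" if h: "h \<in> deg1_perp n" for h
  proof (cases "ip n h h = 0")
    case True
    have "h p = 0" for p
      using True ip_pos[of p n h] h by (cases "p \<in> Alt n") (auto simp: deg1_perp_def)
    then show ?thesis by (simp add: q_def conv_def ip_def)
  next
    case False
    then have pos: "ip n h h > 0" using ip_nonneg[of n h] by simp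
    have "(1 / sqrt (ip n h h))\<^sup>2 * q h \<le> l"
      using g0(2)[OF normalize[OF h pos]] unfolding q_scale l_def .
    then show ?thesis using pos by (simp add: power_divide field_simps)
  qed
  define E where "E = {h \<in> deg1_perp n. q h = l * ip n h h}"
  interpret transl_module n E
  proof
    show "9 \<le> n" by fact
    show "h p = 0" if "h \<in> E" "p \<notin> Alt n" for h p using that by (simp add: E_def deg1_perp_def)
    show "(\<Sum>p | p \<in> Alt n \<and> p i = j. h p) = 0" if "h \<in> E" "i \<in> {1..n}" "j \<in> {1..n}" for h i j
      using that by (simp add: E_def deg1_perp_def)
    show "rtrans s h \<in> E" if "h \<in> E" "s \<in> Alt n" for h s
      using that by (simp add: E_def deg1_perp_rtrans ip_rtrans q_def conv_rtrans)
    show "(\<lambda>p. a * h p + b * k p) \<in> E" if "h \<in> E" "k \<in> E" for h k a b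
    proof -
      let ?u = "\<lambda>p. a * h p + b * k p" and ?v = "\<lambda>p. a * h p + (- b) * k p"
      have uv: "?u \<in> deg1_perp n" "?v \<in> deg1_perp n"
        using that by (auto simp only: E_def mem_Collect_eq intro!: deg1_perp_lin)
      have "q ?u + q ?v = 2 * a\<^sup>2 * q h + 2 * b\<^sup>2 * q k"
        unfolding q_def conv_lin by (rule ip_parallelogram)
      also have "\<dots> = l * (2 * a\<^sup>2 * ip n h h + 2 * b\<^sup>2 * ip n k k)"
        using that by (simp add: E_def algebra_simps)
      also have "\<dots> = l * ip n ?u ?u + l * ip n ?v ?v"
        unfolding ip_parallelogram[symmetric] by (simp add: distrib_left)
      finally have "q ?u = l * ip n ?u ?u"
        using q_le[OF uv(1)] q_le[OF uv(2)] by linarith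
      then show ?thesis using uv by (simp add: E_def)
    qed
  qed
  have g0E: "g0 \<in> E" using g0 by (simp add: E_def l_def)
  have g00: "g0 \<noteq> (\<lambda>p. 0)" using g0(1) by (auto simp: ip_def)
  obtain K :: "nat set set" and e where
    Ke: "finite K \<and> (n div 8) choose 2 \<le> card K
      \<and> (\<forall>k\<in>K. e k \<in> E \<and> e k \<noteq> (\<lambda>p. 0))
      \<and> (\<forall>k\<in>K. \<forall>l\<in>K. k \<noteq> l \<longrightarrow> (\<Sum>p\<in>Alt n. e k p * e l p) = 0)"
    using ex_orthogonal_family[OF g0E g00] by (elim exE)
  have K: "finite K" "(n div 8) choose 2 \<le> card K" using Ke by simp_all
  have e: "e k \<in> E" "e k \<noteq> (\<lambda>p. 0)" if "k \<in> K" for k using Ke that by blast+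
  have orth: "ip n (e k) (e l) = 0" if "k \<in> K" "l \<in> K" "k \<noteq> l" for k l
    using Ke that unfolding ip_def by blast
  have pos: "ip n (e k) (e k) > 0" if k: "k \<in> K" for k
  proof -
    obtain p where "e k p \<noteq> 0" using e(2)[OF k] by blast
    moreover from this have "p \<in> Alt n" using supp[OF e(1)[OF k]] by blast
    ultimately show ?thesis using ip_pos by blast
  qed
  have "card K * l = (\<Sum>k\<in>K. q (e k) / ip n (e k) (e k))"
    using e(1) pos by (simp add: E_def less_imp_neq[symmetric])
  also have "\<dots> \<le> card (Alt n) * card X"
    unfolding q_def by (rule conv_bessel[OF X K(1) pos orth])
  finally have lK: "card K * l \<le> card (Alt n) * card X" .
  have l0: "l \<ge> 0" unfolding l_def q_def by (rule ip_nonneg)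
  have "q g * real ((n div 8) choose 2) \<le> (l * ip n g g) * card K"
    using K(2) q_le[OF g] by (intro mult_mono) (auto simp: q_def l0 ip_nonneg)
  also have "\<dots> = (card K * l) * ip n g g" by simp
  also have "\<dots> \<le> (card (Alt n) * card X) * ip n g g"
    using lK gpos by (intro mult_right_mono) auto
  finally show ?thesis by (simp add: q_def)
qed


section \<open>Concentration of sums along a random permutation\<close>

lemma exp_difference_bound:
  fixes x y t :: real
  assumes "t \<ge> 0"
  shows "0 \<le> (x - y) * (exp (t * x) - exp (t * y))"
    and "(x - y) * (exp (t * x) - exp (t * y)) \<le> t * (x - y)\<^sup>2 * (exp (t * x) + exp (t * y))"
proof -
  have *: "0 \<le> (u - v) * (exp (t * u) - exp (t * v)) \<and>
      (u - v) * (exp (t * u) - exp (t * v)) \<le> t * (u - v)\<^sup>2 * (exp (t * u) + exp (t * v))"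
    if "u \<ge> v" for u v :: real
  proof -
    have "exp (t * v) \<ge> exp (t * u) * (1 + (t * v - t * u))"
      using exp_ge_add_one_self[of "t * v - t * u"]
      by (metis exp_diff exp_gt_zero mult.commute pos_le_divide_eq)
    then have 1: "exp (t * u) - exp (t * v) \<le> t * (u - v) * exp (t * u)"
      by (simp add: algebra_simps)
    have 2: "exp (t * u) - exp (t * v) \<ge> 0"
      using that assms by (simp add: mult_left_mono)
    have "t * (u - v) * exp (t * u) \<le> t * (u - v) * (exp (t * u) + exp (t * v))"
      using that assms by (intro mult_left_mono) auto
    then have "(u - v) * (exp (t * u) - exp (t * v))
        \<le> (u - v) * (t * (u - v) * (exp (t * u) + exp (t * v)))"
      using 1 that by (intro mult_left_mono) auto
    moreover have "0 \<le> (u - v) * (exp (t * u) - exp (t * v))"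
      using 2 that by (intro mult_nonneg_nonneg) auto
    ultimately show ?thesis
      by (simp only: power2_eq_square mult_ac conj_absorb)
  qed
  show "0 \<le> (x - y) * (exp (t * x) - exp (t * y))"
    using *[of x y] *[of y x] by (cases "x \<ge> y") (auto simp: algebra_simps)
  show "(x - y) * (exp (t * x) - exp (t * y)) \<le> t * (x - y)\<^sup>2 * (exp (t * x) + exp (t * y))"
    using *[of x y] *[of y x] by (cases "x \<ge> y") (auto simp: algebra_simps power2_commute)
qed

definition rearr_sum :: "'a set \<Rightarrow> ('a \<Rightarrow> 'a \<Rightarrow> real) \<Rightarrow> ('a \<Rightarrow> 'a) \<Rightarrow> real"
  where "rearr_sum I a p = (\<Sum>i\<in>I. a i (p i))"

definition rearr_mean :: "'a set \<Rightarrow> ('a \<Rightarrow> 'a \<Rightarrow> real) \<Rightarrow> real"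
  where "rearr_mean I a = (\<Sum>i\<in>I. \<Sum>j\<in>I. a i j) / real (card I)"

lemma rearr_sum_transpose:
  assumes "finite I" "i \<in> I" "j \<in> I"
  shows "rearr_sum I a p - rearr_sum I a (p \<circ> transpose i j)
    = a i (p i) + a j (p j) - a i (p j) - a j (p i)"
proof (cases "i = j")
  case False
  have "rearr_sum I a q = a i (q i) + a j (q j) + (\<Sum>k\<in>I - {i, j}. a k (q k))" for q
    unfolding rearr_sum_def using assms False
    by (simp add: sum.remove[of I i] sum.remove[of "I - {i}" j] Diff_insert2[symmetric] insert_commute)
  moreover have "(\<Sum>k\<in>I - {i, j}. a k ((p \<circ> transpose i j) k)) = (\<Sum>k\<in>I - {i, j}. a k (p k))"
    by (intro sum.cong) (auto simp: transpose_def)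
  ultimately show ?thesis by simp
qed simp

text \<open>
  Exchanging two random values of the permutation is an exchangeable pair for which the deviation
  from the mean is, up to a factor, the average change of the sum.
\<close>
lemma sum_rearr_sum_transpose:
  assumes "finite I" "p permutes I"
  shows "(\<Sum>i\<in>I. \<Sum>j\<in>I. rearr_sum I a p - rearr_sum I a (p \<circ> transpose i j))
    = 2 * real (card I) * (rearr_sum I a p - rearr_mean I a)"
proof (cases "I = {}")
  case False
  have r: "(\<Sum>j\<in>I. f (p j)) = sum f I" for f :: "_ \<Rightarrow> real"
    using sum.permute[OF assms(2), of f] by (simp add: o_def)
  have "(\<Sum>i\<in>I. \<Sum>j\<in>I. rearr_sum I a p - rearr_sum I a (p \<circ> transpose i j))
    = (\<Sum>i\<in>I. \<Sum>j\<in>I. a i (p i) + a j (p j) - a i (p j) - a j (p i))"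
    using assms by (intro sum.cong refl rearr_sum_transpose) auto
  also have "\<dots> = 2 * real (card I) * rearr_sum I a p
      - (\<Sum>i\<in>I. \<Sum>j\<in>I. a i (p j)) - (\<Sum>i\<in>I. \<Sum>j\<in>I. a j (p i))"
    by (simp add: sum_subtractf sum.distrib rearr_sum_def sum_distrib_left[symmetric] algebra_simps)
  also have "(\<Sum>i\<in>I. \<Sum>j\<in>I. a j (p i)) = (\<Sum>i\<in>I. \<Sum>j\<in>I. a i (p j))"
    by (rule sum.swap)
  also have "(\<Sum>i\<in>I. \<Sum>j\<in>I. a i (p j)) = (\<Sum>i\<in>I. \<Sum>j\<in>I. a i j)"
    by (simp add: r)
  finally have "(\<Sum>i\<in>I. \<Sum>j\<in>I. rearr_sum I a p - rearr_sum I a (p \<circ> transpose i j))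
    = 2 * real (card I) * rearr_sum I a p - 2 * (\<Sum>i\<in>I. \<Sum>j\<in>I. a i j)"
    by linarith
  also have "\<dots> = 2 * real (card I) * (rearr_sum I a p - rearr_mean I a)"
    using False assms(1) by (simp add: rearr_mean_def field_simps)
  finally show ?thesis .
qed simp

text \<open>
  Each change is at most 2 in absolute value and at most the sum of its four terms, so the
  square is at most twice that sum. The bound by the sum itself closes the differential inequality
  for the moment generating function.
\<close>
lemma sum_rearr_sum_transpose_square:
  assumes "finite I" "p permutes I" and a: "\<And>i j. 0 \<le> a i j \<and> a i j \<le> 1"
  shows "(\<Sum>i\<in>I. \<Sum>j\<in>I. (rearr_sum I a p - rearr_sum I a (p \<circ> transpose i j))\<^sup>2)
    \<le> 4 * real (card I) * (rearr_sum I a p + rearr_mean I a)"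
proof (cases "I = {}")
  case False
  have r: "(\<Sum>j\<in>I. f (p j)) = sum f I" for f :: "_ \<Rightarrow> real"
    using sum.permute[OF assms(2), of f] by (simp add: o_def)
  have sq: "(w + x - y - z)\<^sup>2 \<le> 2 * (w + x + y + z)"
    if "0 \<le> w" "w \<le> 1" "0 \<le> x" "x \<le> 1" "0 \<le> y" "y \<le> 1" "0 \<le> z" "z \<le> 1" for w x y z :: real
  proof -
    have "(w + x - y - z)\<^sup>2 = \<bar>w + x - y - z\<bar> * \<bar>w + x - y - z\<bar>"
      by (simp add: power2_eq_square)
    also have "\<dots> \<le> 2 * (w + x + y + z)"
      using that by (intro mult_mono) auto
    finally show ?thesis .
  qed
  have "(\<Sum>i\<in>I. \<Sum>j\<in>I. (rearr_sum I a p - rearr_sum I a (p \<circ> transpose i j))\<^sup>2)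
    \<le> (\<Sum>i\<in>I. \<Sum>j\<in>I. 2 * (a i (p i) + a j (p j) + a i (p j) + a j (p i)))"
  proof (intro sum_mono)
    fix i j assume "i \<in> I" "j \<in> I"
    then show "(rearr_sum I a p - rearr_sum I a (p \<circ> transpose i j))\<^sup>2
        \<le> 2 * (a i (p i) + a j (p j) + a i (p j) + a j (p i))"
      unfolding rearr_sum_transpose[OF assms(1) \<open>i \<in> I\<close> \<open>j \<in> I\<close>] by (intro sq) (use a in auto)
  qed
  also have "\<dots> = 2 * (2 * real (card I) * rearr_sum I a p
      + (\<Sum>i\<in>I. \<Sum>j\<in>I. a i (p j)) + (\<Sum>i\<in>I. \<Sum>j\<in>I. a j (p i)))"
    by (simp add: sum.distrib rearr_sum_def sum_distrib_left[symmetric] algebra_simps)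
  also have "(\<Sum>i\<in>I. \<Sum>j\<in>I. a j (p i)) = (\<Sum>i\<in>I. \<Sum>j\<in>I. a i (p j))"
    by (rule sum.swap)
  also have "(\<Sum>i\<in>I. \<Sum>j\<in>I. a i (p j)) = (\<Sum>i\<in>I. \<Sum>j\<in>I. a i j)"
    by (simp add: r)
  finally have "(\<Sum>i\<in>I. \<Sum>j\<in>I. (rearr_sum I a p - rearr_sum I a (p \<circ> transpose i j))\<^sup>2)
    \<le> 4 * real (card I) * rearr_sum I a p + 4 * (\<Sum>i\<in>I. \<Sum>j\<in>I. a i j)"
    by (rule order_trans) (simp add: algebra_simps)
  also have "\<dots> = 4 * real (card I) * (rearr_sum I a p + rearr_mean I a)"
    using False assms(1) by (simp add: rearr_mean_def field_simps)
  finally show ?thesis .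
qed simp

text \<open>
  The sum on the left is the derivative \<open>m'\<close> of the moment generating function \<open>m\<close> on the right.
  Writing the deviation as an average over exchanges and symmetrising each exchange replaces
  \<open>D exp (t Y)\<close> by half of \<open>D (exp (t Y) - exp (t Y'))\<close>, where \<open>D = Y - Y'\<close>; the mean value theorem
  bounds this in terms of \<open>D\<^sup>2\<close>, giving \<open>m' \<le> 2 t (m' + 2 \<mu> m)\<close>. For \<open>t \<le> 1/4\<close> the term \<open>m'\<close> is absorbed. The sign
  \<open>s\<close> treats both tails at once.
\<close>
lemma rearr_mgf_derivative_bound:
  fixes I :: "'a set" and a :: "'a \<Rightarrow> 'a \<Rightarrow> real" and s t :: real
  defines "Y \<equiv> \<lambda>p. s * (rearr_sum I a p - rearr_mean I a)"
  defines "S \<equiv> {p. p permutes I}"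
  assumes I: "finite I" "I \<noteq> {}" and a: "\<And>i j. 0 \<le> a i j \<and> a i j \<le> 1"
    and s: "s = 1 \<or> s = -1" and t: "0 \<le> t" "t \<le> 1/4"
  shows "(\<Sum>p\<in>S. Y p * exp (t * Y p)) \<le> 8 * t * rearr_mean I a * (\<Sum>p\<in>S. exp (t * Y p))"
proof -
  define n where "n = real (card I)"
  define \<mu> where "\<mu> = rearr_mean I a"
  define m where "m = (\<Sum>p\<in>S. exp (t * Y p))"
  define m' where "m' = (\<Sum>p\<in>S. Y p * exp (t * Y p))"
  have n: "n > 0" using I by (simp add: n_def card_gt_0_iff)
  have \<mu>: "\<mu> \<ge> 0" using a by (simp add: \<mu>_def rearr_mean_def sum_nonneg)
  have m: "m \<ge> 0" by (simp add: m_def sum_nonneg)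
  define D where "D = (\<lambda>i j p. Y p - Y (p \<circ> transpose i j))"
  have D: "D i j p = s * (rearr_sum I a p - rearr_sum I a (p \<circ> transpose i j))" for i j p
    by (simp add: D_def Y_def algebra_simps)
  have Dsq: "(D i j p)\<^sup>2 = (rearr_sum I a p - rearr_sum I a (p \<circ> transpose i j))\<^sup>2" for i j p
    using s by (auto simp: D power2_eq_square)
  have rei: "(\<Sum>p\<in>S. F (p \<circ> transpose i j)) = sum F S" if "i \<in> I" "j \<in> I" for F :: "('a \<Rightarrow> 'a) \<Rightarrow> real" and i j
    unfolding S_def using sum_permutations_compose_right[OF permutes_swap_id[OF that], of F] by simp
  have invol: "p \<circ> transpose i j \<circ> transpose i j = p" for p :: "'a \<Rightarrow> 'a" and i j
    by (simp add: o_assoc[symmetric])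
  have pair: "2 * (\<Sum>p\<in>S. D i j p * exp (t * Y p))
      = (\<Sum>p\<in>S. D i j p * (exp (t * Y p) - exp (t * Y (p \<circ> transpose i j))))"
    if "i \<in> I" "j \<in> I" for i j
  proof -
    have "(\<Sum>p\<in>S. D i j p * exp (t * Y p))
        = (\<Sum>p\<in>S. D i j (p \<circ> transpose i j) * exp (t * Y (p \<circ> transpose i j)))"
      by (rule rei[OF that, symmetric])
    also have "\<dots> = (\<Sum>p\<in>S. - (D i j p * exp (t * Y (p \<circ> transpose i j))))"
      by (intro sum.cong) (auto simp: D_def invol algebra_simps)
    finally show ?thesis
      by (simp add: sum_subtractf sum_negf algebra_simps)
  qed
  have sum1: "2 * n * m' = (\<Sum>i\<in>I. \<Sum>j\<in>I. \<Sum>p\<in>S. D i j p * exp (t * Y p))"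
  proof -
    have "(\<Sum>i\<in>I. \<Sum>j\<in>I. \<Sum>p\<in>S. D i j p * exp (t * Y p))
        = (\<Sum>p\<in>S. (\<Sum>i\<in>I. \<Sum>j\<in>I. D i j p) * exp (t * Y p))"
      by (simp add: sum_distrib_right sum.swap[of _ _ S])
    also have "\<dots> = (\<Sum>p\<in>S. 2 * n * Y p * exp (t * Y p))"
    proof (intro sum.cong refl)
      fix p assume "p \<in> S"
      then have "(\<Sum>i\<in>I. \<Sum>j\<in>I. D i j p) = 2 * n * Y p"
        using sum_rearr_sum_transpose[OF I(1), of p a]
        by (simp add: D sum_distrib_left[symmetric] S_def n_def Y_def)
      then show "(\<Sum>i\<in>I. \<Sum>j\<in>I. D i j p) * exp (t * Y p) = 2 * n * Y p * exp (t * Y p)"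
        by simp
    qed
    finally show ?thesis by (simp add: m'_def sum_distrib_left mult.assoc)
  qed
  have low: "0 \<le> (\<Sum>p\<in>S. D i j p * exp (t * Y p))"
    and up: "(\<Sum>p\<in>S. D i j p * exp (t * Y p)) \<le> t * (\<Sum>p\<in>S. (D i j p)\<^sup>2 * exp (t * Y p))"
    if ij: "i \<in> I" "j \<in> I" for i j
  proof -
    have "0 \<le> (\<Sum>p\<in>S. D i j p * (exp (t * Y p) - exp (t * Y (p \<circ> transpose i j))))"
      by (intro sum_nonneg) (simp add: D_def exp_difference_bound t)
    then show "0 \<le> (\<Sum>p\<in>S. D i j p * exp (t * Y p))" unfolding pair[OF ij, symmetric] by linarith
    have "(\<Sum>p\<in>S. D i j p * (exp (t * Y p) - exp (t * Y (p \<circ> transpose i j))))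
        \<le> (\<Sum>p\<in>S. t * (D i j p)\<^sup>2 * (exp (t * Y p) + exp (t * Y (p \<circ> transpose i j))))"
      unfolding D_def by (intro sum_mono exp_difference_bound t)
    also have "\<dots> = t * (\<Sum>p\<in>S. (D i j p)\<^sup>2 * exp (t * Y p))
        + t * (\<Sum>p\<in>S. (D i j p)\<^sup>2 * exp (t * Y (p \<circ> transpose i j)))"
      by (simp add: sum_distrib_left sum.distrib algebra_simps)
    also have "(\<Sum>p\<in>S. (D i j p)\<^sup>2 * exp (t * Y (p \<circ> transpose i j)))
        = (\<Sum>p\<in>S. (D i j (p \<circ> transpose i j))\<^sup>2 * exp (t * Y (p \<circ> transpose i j)))"
      by (intro sum.cong) (auto simp: D_def invol power2_commute)
    also have "\<dots> = (\<Sum>p\<in>S. (D i j p)\<^sup>2 * exp (t * Y p))"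
      by (rule rei[OF ij])
    finally show "(\<Sum>p\<in>S. D i j p * exp (t * Y p)) \<le> t * (\<Sum>p\<in>S. (D i j p)\<^sup>2 * exp (t * Y p))"
      unfolding pair[OF ij, symmetric] by linarith
  qed
  have "0 \<le> 2 * n * m'"
    unfolding sum1 by (intro sum_nonneg low)
  then have m'0: "m' \<ge> 0" using n by (simp add: zero_le_mult_iff)
  have "2 * n * m' \<le> (\<Sum>i\<in>I. \<Sum>j\<in>I. t * (\<Sum>p\<in>S. (D i j p)\<^sup>2 * exp (t * Y p)))"
    unfolding sum1 by (intro sum_mono up)
  also have "\<dots> = t * (\<Sum>p\<in>S. (\<Sum>i\<in>I. \<Sum>j\<in>I. (D i j p)\<^sup>2) * exp (t * Y p))"
    by (simp add: sum_distrib_right sum_distrib_left sum.swap[of _ _ S])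
  also have "\<dots> \<le> t * (\<Sum>p\<in>S. (4 * n * (rearr_sum I a p + \<mu>)) * exp (t * Y p))"
    using sum_rearr_sum_transpose_square[OF I(1), of _ a] a t
    by (intro mult_left_mono sum_mono mult_right_mono) (auto simp: Dsq n_def \<mu>_def S_def)
  also have "\<dots> = t * (\<Sum>p\<in>S. 4 * n * (s * Y p + 2 * \<mu>) * exp (t * Y p))"
    using s by (intro arg_cong[where f = "\<lambda>x. t * x"] sum.cong) (auto simp: Y_def \<mu>_def)
  also have "\<dots> = 4 * n * t * (s * m' + 2 * \<mu> * m)"
    by (simp add: m_def m'_def sum_distrib_left sum.distrib algebra_simps)
  also have "\<dots> \<le> 4 * n * t * (m' + 2 * \<mu> * m)"
    using s m'0 n t by (intro mult_left_mono) auto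
  finally have "2 * n * m' \<le> 2 * n * (2 * t * m' + 4 * t * \<mu> * m)" by (simp add: algebra_simps)
  then have "m' \<le> 2 * t * m' + 4 * t * \<mu> * m"
    using mult_le_cancel_left_pos[of "2 * n"] n by simp
  moreover have "2 * t * m' \<le> m' / 2"
    using mult_right_mono[of t "1/4" m'] t m'0 by simp
  ultimately have "m' \<le> 8 * t * \<mu> * m" by simp
  then show ?thesis by (simp add: m'_def m_def \<mu>_def)
qed

lemma rearr_mgf_bound:
  fixes I :: "'a set" and a :: "'a \<Rightarrow> 'a \<Rightarrow> real" and s t :: real
  assumes I: "finite I" "I \<noteq> {}" and a: "\<And>i j. 0 \<le> a i j \<and> a i j \<le> 1"
    and s: "s = 1 \<or> s = -1" and t: "0 \<le> t" "t \<le> 1/4"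
  shows "(\<Sum>p | p permutes I. exp (t * (s * (rearr_sum I a p - rearr_mean I a))))
    \<le> fact (card I) * exp (4 * rearr_mean I a * t\<^sup>2)"
proof -
  define Y where "Y = (\<lambda>p. s * (rearr_sum I a p - rearr_mean I a))"
  define S where "S = {p. p permutes I}"
  define \<mu> where "\<mu> = rearr_mean I a"
  define m where "m = (\<lambda>t. \<Sum>p\<in>S. exp (t * Y p))"
  define \<phi> where "\<phi> = (\<lambda>t. m t * exp (- 4 * \<mu> * t\<^sup>2))"
  have dm: "(m has_real_derivative (\<Sum>p\<in>S. Y p * exp (t * Y p))) (at t)" for t
    unfolding m_def by (auto intro!: derivative_eq_intros simp: mult.commute)
  have der: "(\<phi> has_real_derivative ((\<Sum>p\<in>S. Y p * exp (t * Y p)) - 8 * t * \<mu> * m t) * exp (- 4 * \<mu> * t\<^sup>2)) (at t)" for t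
    unfolding \<phi>_def by (rule derivative_eq_intros dm refl)+ (simp add: algebra_simps)
  have "\<phi> t \<le> \<phi> 0"
  proof (rule DERIV_nonpos_imp_nonincreasing[where f = \<phi> and a = 0 and b = t])
    show "0 \<le> t" by fact
    fix x assume x: "0 \<le> x" "x \<le> t"
    then have "(\<Sum>p\<in>S. Y p * exp (x * Y p)) \<le> 8 * x * \<mu> * m x"
      using rearr_mgf_derivative_bound[OF I a s, of x] t unfolding Y_def S_def \<mu>_def m_def by simp
    then have "((\<Sum>p\<in>S. Y p * exp (x * Y p)) - 8 * x * \<mu> * m x) * exp (- 4 * \<mu> * x\<^sup>2) \<le> 0"
      by (intro mult_nonpos_nonneg) auto
    then show "\<exists>y. (\<phi> has_real_derivative y) (at x) \<and> y \<le> 0"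
      using der by blast
  qed
  also have "\<phi> 0 = fact (card I)"
    using card_permutations[OF refl I(1)] by (simp add: \<phi>_def m_def S_def)
  finally have "m t * exp (- 4 * \<mu> * t\<^sup>2) * exp (4 * \<mu> * t\<^sup>2) \<le> fact (card I) * exp (4 * \<mu> * t\<^sup>2)"
    unfolding \<phi>_def by (intro mult_right_mono) auto
  then have "m t \<le> fact (card I) * exp (4 * \<mu> * t\<^sup>2)"
    by (simp add: mult.assoc exp_add[symmetric])
  then show ?thesis by (simp add: m_def Y_def S_def \<mu>_def)
qed

text \<open>
  Jensen's inequality on \<open>X\<close>: the exponential of the mean of a function over \<open>X\<close> is at most the mean
  over all permutations divided by the density of \<open>X\<close>.
\<close>
lemma rearr_average_deviation:
  fixes I :: "'a set" and a :: "'a \<Rightarrow> 'a \<Rightarrow> real" and t :: real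
  assumes I: "finite I" "I \<noteq> {}" and a: "\<And>i j. 0 \<le> a i j \<and> a i j \<le> 1"
    and t: "0 < t" "t \<le> 1/4"
    and X: "X \<subseteq> {p. p permutes I}" "X \<noteq> {}"
  shows "\<bar>(\<Sum>p\<in>X. rearr_sum I a p) / card X - rearr_mean I a\<bar>
    \<le> ln (fact (card I) / card X) / t + 4 * rearr_mean I a * t"
proof -
  define \<mu> where "\<mu> = rearr_mean I a"
  have finite_X: "finite X" using X(1) finite_permutations[OF I(1)] finite_subset by blast
  then have k: "real (card X) > 0" using X(2) by (simp add: card_gt_0_iff)
  have one: "s * ((\<Sum>p\<in>X. rearr_sum I a p) / card X - \<mu>)
    \<le> ln (fact (card I) / card X) / t + 4 * \<mu> * t" if s: "s = 1 \<or> s = -1" for s :: real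
  proof -
    define Y where "Y = (\<lambda>p. t * (s * (rearr_sum I a p - \<mu>)))"
    define c where "c = (\<Sum>p\<in>X. Y p) / card X"
    have c: "c = t * (s * ((\<Sum>p\<in>X. rearr_sum I a p) / card X - \<mu>))"
      using k by (simp add: c_def Y_def sum_distrib_left[symmetric] sum_subtractf field_simps)
    have "card X = (\<Sum>p\<in>X. 1 + (Y p - c))"
      using k by (simp add: sum.distrib sum_subtractf c_def)
    also have "\<dots> \<le> (\<Sum>p\<in>X. exp (Y p - c))"
      by (intro sum_mono) (use exp_ge_add_one_self in auto)
    also have "\<dots> = (\<Sum>p\<in>X. exp (Y p)) * exp (- c)"
      by (simp add: sum_distrib_right exp_diff exp_minus divide_inverse)
    also have "\<dots> \<le> (\<Sum>p | p permutes I. exp (Y p)) * exp (- c)"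
      using X finite_permutations[OF I(1)] by (intro mult_right_mono sum_mono2) auto
    also have "\<dots> \<le> (fact (card I) * exp (4 * \<mu> * t\<^sup>2)) * exp (- c)"
      unfolding Y_def \<mu>_def using t by (intro mult_right_mono rearr_mgf_bound I a s) auto
    finally have "real (card X) * exp c \<le> (fact (card I) * exp (4 * \<mu> * t\<^sup>2)) * exp (- c) * exp c"
      by (intro mult_right_mono) auto
    then have "exp c \<le> fact (card I) / card X * exp (4 * \<mu> * t\<^sup>2)"
      using k by (simp add: mult.assoc exp_minus field_simps)
    then have "ln (exp c) \<le> ln (fact (card I) / card X * exp (4 * \<mu> * t\<^sup>2))"
      using k by (subst ln_le_cancel_iff) auto
    then have "c \<le> ln (fact (card I) / card X) + 4 * \<mu> * t\<^sup>2"
      using k by (simp add: ln_mult ln_div)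
    then have "c / t \<le> (ln (fact (card I) / card X) + 4 * \<mu> * t\<^sup>2) / t"
      using t by (intro divide_right_mono) auto
    then show ?thesis using t by (simp add: c add_divide_distrib power2_eq_square)
  qed
  show ?thesis
    using one[of 1] one[of "-1"] unfolding \<mu>_def[symmetric] abs_le_iff by simp
qed


section \<open>Frequency matrices of dense sets of permutations\<close>

definition freq :: "('a \<Rightarrow> 'a) set \<Rightarrow> 'a \<Rightarrow> 'a \<Rightarrow> real"
  where "freq X i j = card {p \<in> X. p i = j} / card X"

definition centred :: "'a set \<Rightarrow> ('a \<Rightarrow> 'a) set \<Rightarrow> 'a \<Rightarrow> 'a \<Rightarrow> real"
  where "centred I X i j = freq X i j - 1 / card I"

lemma freq_nonneg: "freq X i j \<ge> 0"
  by (simp add: freq_def)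

lemma average_rearr_sum:
  assumes "finite I" "X \<subseteq> {p. p permutes I}"
  shows "(\<Sum>p\<in>X. rearr_sum I a p) / card X = (\<Sum>i\<in>I. \<Sum>j\<in>I. a i j * freq X i j)"
proof -
  have finite_X: "finite X" using assms finite_permutations finite_subset by blast
  have "(\<Sum>p\<in>X. a i (p i)) = (\<Sum>j\<in>I. a i j * card {p \<in> X. p i = j})" if i: "i \<in> I" for i
  proof -
    have "(\<Sum>p\<in>X. a i (p i)) = (\<Sum>j\<in>I. \<Sum>p\<in>{p \<in> X. p i = j}. a i (p i))"
      using assms i finite_X by (intro sum.group[symmetric]) (auto simp: permutes_in_image)
    also have "\<dots> = (\<Sum>j\<in>I. \<Sum>p\<in>{p \<in> X. p i = j}. a i j)"
      by (intro sum.cong) auto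
    finally show ?thesis by (simp add: mult.commute)
  qed
  then have "(\<Sum>p\<in>X. rearr_sum I a p) = (\<Sum>i\<in>I. \<Sum>j\<in>I. a i j * card {p \<in> X. p i = j})"
    unfolding rearr_sum_def by (subst sum.swap) simp
  then show ?thesis by (simp add: freq_def sum_divide_distrib)
qed

lemma freq_row_sum:
  assumes "finite I" "X \<subseteq> {p. p permutes I}" "X \<noteq> {}" "i \<in> I"
  shows "(\<Sum>j\<in>I. freq X i j) = 1"
proof -
  have finite_X: "finite X" using assms finite_permutations finite_subset by blast
  have "(\<lambda>p. p i) ` X \<subseteq> I" using assms(2,4) permutes_in_image by fastforce
  then have "(\<Sum>j\<in>I. card {p \<in> X. p i = j}) = card X"
    using sum.group[OF finite_X assms(1), of "\<lambda>p. p i" "\<lambda>_. 1::nat"] by simp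
  then show ?thesis
    using assms(3) finite_X by (simp add: freq_def sum_divide_distrib[symmetric] of_nat_sum[symmetric] del: of_nat_sum)
qed

lemma freq_column_sum:
  assumes "finite I" "X \<subseteq> {p. p permutes I}" "X \<noteq> {}" "j \<in> I"
  shows "(\<Sum>i\<in>I. freq X i j) = 1"
proof -
  have finite_X: "finite X" using assms finite_permutations finite_subset by blast
  have eq: "{p \<in> X. p i = j} = {p \<in> X. inv' p j = i}" for i
    using assms(2) permutes_inv_eq by fastforce
  have "(\<lambda>p. inv' p j) ` X \<subseteq> I"
    using assms(2,4) permutes_in_image[OF permutes_inv] by fastforce
  then have "(\<Sum>i\<in>I. card {p \<in> X. inv' p j = i}) = card X"
    using sum.group[OF finite_X assms(1), of "\<lambda>p. inv' p j" "\<lambda>_. 1::nat"] by simp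
  then show ?thesis
    using assms(3) finite_X by (simp add: eq freq_def sum_divide_distrib[symmetric] of_nat_sum[symmetric] del: of_nat_sum)
qed

text \<open>
  On the level set \<open>B\<close> the mean number of \<open>i\<close> with \<open>(i, p i)\<close> in \<open>B\<close>, taken over \<open>X\<close>, differs from its
  mean \<open>\<mu>\<close> over all permutations by at least \<open>\<epsilon> \<mu>\<close>. The deviation bound with \<open>t = \<epsilon>/8\<close> allows at
  most \<open>8 \<Lambda> / \<epsilon> + \<epsilon> \<mu> / 2\<close>.
\<close>
lemma level_set_bound:
  fixes I :: "'a set" and \<epsilon> \<Lambda> :: real
  assumes I: "finite I" "I \<noteq> {}" and X: "X \<subseteq> {p. p permutes I}" "X \<noteq> {}"
    and eps: "0 < \<epsilon>" "\<epsilon> \<le> 1" and \<Lambda>: "ln (fact (card I) / card X) \<le> \<Lambda>"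
    and s: "s = 1 \<or> s = (-1::real)"
  shows "real (card {(i, j) \<in> I \<times> I. s * centred I X i j > \<epsilon> / card I}) / card I \<le> 16 * \<Lambda> / \<epsilon>\<^sup>2"
proof -
  define B where "B = {(i, j) \<in> I \<times> I. s * centred I X i j > \<epsilon> / card I}"
  define n where "n = real (card I)"
  define a where "a = (\<lambda>i j. if (i, j) \<in> B then 1 else (0::real))"
  have n: "n > 0" using I by (simp add: n_def card_gt_0_iff)
  have BI: "B \<subseteq> I \<times> I" by (auto simp: B_def)
  have sumB: "(\<Sum>i\<in>I. \<Sum>j\<in>I. a i j * f i j) = (\<Sum>(i,j)\<in>B. f i j)" for f
  proof -
    have "(\<Sum>i\<in>I. \<Sum>j\<in>I. a i j * f i j) = (\<Sum>x\<in>I \<times> I. if x \<in> B then (case x of (i, j) \<Rightarrow> f i j) else 0)"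
      unfolding sum.cartesian_product by (intro sum.cong) (auto simp: a_def)
    also have "\<dots> = (\<Sum>(i,j)\<in>B. f i j)"
      using BI I(1) by (simp add: sum.inter_restrict[symmetric] Int_absorb1)
    finally show ?thesis .
  qed
  define \<mu> where "\<mu> = card B / n"
  have mean: "rearr_mean I a = \<mu>"
    using sumB[of "\<lambda>_ _. 1"] by (simp add: rearr_mean_def \<mu>_def n_def case_prod_beta)
  have "\<bar>(\<Sum>p\<in>X. rearr_sum I a p) / card X - rearr_mean I a\<bar>
      \<le> ln (fact (card I) / card X) / (\<epsilon> / 8) + 4 * rearr_mean I a * (\<epsilon> / 8)"
    by (rule rearr_average_deviation[OF I _ _ _ X]) (use eps in \<open>auto simp: a_def\<close>)
  also have "\<dots> \<le> \<Lambda> / (\<epsilon> / 8) + \<mu> * \<epsilon> / 2"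
    unfolding mean using \<Lambda> eps by (intro add_mono divide_right_mono) auto
  finally have dev: "\<bar>(\<Sum>(i,j)\<in>B. freq X i j) - \<mu>\<bar> \<le> 8 * \<Lambda> / \<epsilon> + \<mu> * \<epsilon> / 2"
    unfolding average_rearr_sum[OF I(1) X(1)] sumB mean by (simp add: field_simps)
  have "\<epsilon> * \<mu> = (\<Sum>(i,j)\<in>B. \<epsilon> / n)" by (simp add: \<mu>_def case_prod_beta)
  also have "\<dots> \<le> (\<Sum>(i,j)\<in>B. s * centred I X i j)"
    by (intro sum_mono) (auto simp: B_def n_def)
  also have "\<dots> = s * ((\<Sum>(i,j)\<in>B. freq X i j) - \<mu>)"
    by (simp add: centred_def case_prod_beta sum_distrib_left[symmetric] sum_subtractf \<mu>_def n_def)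
  also have "\<dots> \<le> \<bar>(\<Sum>(i,j)\<in>B. freq X i j) - \<mu>\<bar>" using s by auto
  finally have "\<epsilon> * \<mu> \<le> 8 * \<Lambda> / \<epsilon> + \<mu> * \<epsilon> / 2" using dev by linarith
  then have "\<mu> * (\<epsilon> * \<epsilon>) \<le> 16 * \<Lambda>" using eps by (simp add: field_simps)
  then have "\<mu> \<le> 16 * \<Lambda> / \<epsilon>\<^sup>2" using eps by (simp add: pos_le_divide_eq power2_eq_square)
  then show ?thesis by (simp add: \<mu>_def B_def n_def)
qed

text \<open>
  Here the mean over \<open>X\<close> is at least twice the mean over all permutations, so it is comparable with
  the deviation, which is bounded with \<open>t = 1/8\<close>.
\<close>
lemma large_entries_mass:
  fixes I :: "'a set" and \<Lambda> :: real
  assumes I: "finite I" "I \<noteq> {}" and X: "X \<subseteq> {p. p permutes I}" "X \<noteq> {}"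
    and \<Lambda>: "ln (fact (card I) / card X) \<le> \<Lambda>"
  shows "(\<Sum>i\<in>I. \<Sum>j\<in>I. if centred I X i j > 1 / card I then freq X i j else 0) \<le> 32 * \<Lambda>"
proof -
  define n where "n = real (card I)"
  define a where "a = (\<lambda>i j. if i \<in> I \<and> j \<in> I \<and> centred I X i j > 1 / card I then 1 else (0::real))"
  have n: "n > 0" using I by (simp add: n_def card_gt_0_iff)
  define \<mu> where "\<mu> = rearr_mean I a"
  define N where "N = (\<Sum>i\<in>I. \<Sum>j\<in>I. a i j * freq X i j)"
  have "\<bar>(\<Sum>p\<in>X. rearr_sum I a p) / card X - rearr_mean I a\<bar>
      \<le> ln (fact (card I) / card X) / (1 / 8) + 4 * rearr_mean I a * (1 / 8)"
    by (rule rearr_average_deviation[OF I _ _ _ X]) (auto simp: a_def)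
  then have dev: "N - \<mu> \<le> 8 * \<Lambda> + \<mu> / 2"
    unfolding average_rearr_sum[OF I(1) X(1)] N_def[symmetric] \<mu>_def[symmetric] abs_le_iff using \<Lambda> by simp
  have "2 * \<mu> = (\<Sum>i\<in>I. \<Sum>j\<in>I. a i j * (2 / n))"
    unfolding sum_distrib_right[symmetric] by (simp add: \<mu>_def rearr_mean_def n_def)
  also have "\<dots> \<le> N"
    unfolding N_def by (intro sum_mono) (auto simp: a_def centred_def n_def)
  finally have "2 * \<mu> \<le> N" .
  with dev have "N \<le> 32 * \<Lambda>" by linarith
  moreover have "N = (\<Sum>i\<in>I. \<Sum>j\<in>I. if centred I X i j > 1 / card I then freq X i j else 0)"
    unfolding N_def a_def by (intro sum.cong) auto
  ultimately show ?thesis by simp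
qed

lemma square_le_dyadic_levels:
  fixes u :: real
  assumes "\<bar>u\<bar> \<le> 1"
  shows "u\<^sup>2 \<le> (1/4) ^ K + (\<Sum>k<K. 4 * (1/4) ^ Suc k * (if \<bar>u\<bar> > (1/2) ^ Suc k then 1 else 0))"
proof (induction K)
  case 0
  then show ?case using assms by (simp add: abs_square_le_1)
next
  case (Suc K)
  show ?case
  proof (cases "\<bar>u\<bar> > (1/2) ^ Suc K")
    case True
    then have "(\<Sum>k<Suc K. 4 * (1/4::real) ^ Suc k * (if \<bar>u\<bar> > (1/2) ^ Suc k then 1 else 0))
      = (\<Sum>k<K. 4 * (1/4) ^ Suc k * (if \<bar>u\<bar> > (1/2) ^ Suc k then 1 else 0)) + (1/4) ^ K"
      by simp
    moreover have "(1/4::real) ^ Suc K \<ge> 0" by simp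
    ultimately show ?thesis using Suc by linarith
  next
    case False
    then have "\<bar>u\<bar>\<^sup>2 \<le> ((1/2) ^ Suc K)\<^sup>2" by (intro power_mono) auto
    also have "((1/2) ^ Suc K)\<^sup>2 = (1/4::real) ^ Suc K"
      by (simp only: power2_eq_square power_mult_distrib[symmetric]) simp
    finally have "u\<^sup>2 \<le> (1/4) ^ Suc K" by simp
    also have "\<dots> \<le> (1/4) ^ Suc K + (\<Sum>k<Suc K. 4 * (1/4) ^ Suc k * (if \<bar>u\<bar> > (1/2) ^ Suc k then 1 else 0))"
      by (simp add: sum_nonneg)
    finally show ?thesis .
  qed
qed

text \<open>
  Entries are sorted into dyadic levels of their size relative to \<open>1/n\<close>. The level \<open>(1/2)^k\<close> has at
  most \<open>16 \<Lambda> 4^k n\<close> entries of either sign, each contributing about \<open>(1/4)^k / n\<^sup>2\<close>, so all levels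
  contribute equally; the entries below the last level have squares at most \<open>(1/4)^K / n\<^sup>2\<close>.
\<close>
lemma small_entries_square_sum:
  fixes I :: "'a set" and \<Lambda> :: real
  assumes I: "finite I" "I \<noteq> {}" and X: "X \<subseteq> {p. p permutes I}" "X \<noteq> {}"
    and \<Lambda>: "ln (fact (card I) / card X) \<le> \<Lambda>" "\<Lambda> \<ge> 0"
  shows "(\<Sum>i\<in>I. \<Sum>j\<in>I. if centred I X i j > 1 / card I then 0 else (centred I X i j)\<^sup>2)
    \<le> (real (card I) * (1/4) ^ K + 128 * real K * \<Lambda>) / card I"
proof -
  define n where "n = real (card I)"
  have n: "n > 0" using I by (simp add: n_def card_gt_0_iff)
  define u where "u = (\<lambda>i j. n * centred I X i j)"
  define B where "B = (\<lambda>s k. {(i, j) \<in> I \<times> I. s * centred I X i j > (1/2) ^ Suc k / card I})"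
  have lv: "real (card (B s k)) \<le> 16 * \<Lambda> * 4 ^ Suc k * n" if "s = 1 \<or> s = -1" for s :: real and k
  proof -
    have "real (card (B s k)) / card I \<le> 16 * \<Lambda> / ((1/2) ^ Suc k)\<^sup>2"
      unfolding B_def by (rule level_set_bound[OF I X _ _ \<Lambda>(1) that], simp)
        (rule power_le_one, auto)
    also have "((1/2::real) ^ Suc k)\<^sup>2 = 1 / 4 ^ Suc k"
      by (simp add: power_divide power2_eq_square power_mult_distrib[symmetric])
    finally show ?thesis using n by (simp add: n_def field_simps)
  qed
  have pw: "(if centred I X i j > 1 / card I then 0 else (u i j)\<^sup>2)
    \<le> (1/4) ^ K + (\<Sum>k<K. 4 * (1/4) ^ Suc k * ((if (i, j) \<in> B 1 k then 1 else 0) + (if (i, j) \<in> B (-1) k then 1 else 0)))"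
    if ij: "i \<in> I" "j \<in> I" for i j
  proof (cases "centred I X i j > 1 / card I")
    case True
    then show ?thesis by (simp add: sum_nonneg)
  next
    case False
    have "u i j \<le> 1" using False n by (simp add: u_def n_def field_simps)
    moreover have "u i j \<ge> -1" using n freq_nonneg[of X i j] by (simp add: u_def centred_def n_def field_simps)
    ultimately have "\<bar>u i j\<bar> \<le> 1" by simp
    from square_le_dyadic_levels[OF this, of K]
    have "(u i j)\<^sup>2 \<le> (1/4) ^ K + (\<Sum>k<K. 4 * (1/4) ^ Suc k * (if \<bar>u i j\<bar> > (1/2) ^ Suc k then 1 else 0))" .
    also have "\<dots> \<le> (1/4) ^ K + (\<Sum>k<K. 4 * (1/4) ^ Suc k * ((if (i, j) \<in> B 1 k then 1 else 0) + (if (i, j) \<in> B (-1) k then 1 else 0)))"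
    proof (intro add_left_mono sum_mono mult_left_mono)
      fix k
      have "(i, j) \<in> B 1 k \<or> (i, j) \<in> B (-1) k" if "\<bar>u i j\<bar> > (1/2) ^ Suc k"
      proof -
        have "u i j > (1/2) ^ Suc k \<or> - u i j > (1/2) ^ Suc k" using that by linarith
        then show ?thesis using ij n unfolding B_def u_def n_def by (auto simp: field_simps)
      qed
      then show "(if \<bar>u i j\<bar> > (1/2) ^ Suc k then 1 else (0::real))
          \<le> (if (i, j) \<in> B 1 k then 1 else 0) + (if (i, j) \<in> B (-1) k then 1 else 0)" by auto
    qed auto
    finally show ?thesis using False by simp
  qed
  have cardB: "(\<Sum>i\<in>I. \<Sum>j\<in>I. if (i, j) \<in> B s k then 1 else 0) = real (card (B s k))" for s k
  proof -
    have "B s k \<subseteq> I \<times> I" by (auto simp: B_def)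
    then have "real (card (B s k)) = (\<Sum>x\<in>I \<times> I. if x \<in> B s k then 1 else 0)"
      using I(1) by (simp add: sum.inter_restrict[symmetric] Int_absorb1)
    then show ?thesis by (simp add: sum.cartesian_product case_prod_beta)
  qed
  have "n\<^sup>2 * (\<Sum>i\<in>I. \<Sum>j\<in>I. if centred I X i j > 1 / card I then 0 else (centred I X i j)\<^sup>2)
      = (\<Sum>i\<in>I. \<Sum>j\<in>I. if centred I X i j > 1 / card I then 0 else (u i j)\<^sup>2)"
    unfolding sum_distrib_left by (intro sum.cong) (auto simp: u_def power_mult_distrib)
  also have "\<dots> \<le> (\<Sum>i\<in>I. \<Sum>j\<in>I. (1/4) ^ K + (\<Sum>k<K. 4 * (1/4) ^ Suc k * ((if (i, j) \<in> B 1 k then 1 else 0) + (if (i, j) \<in> B (-1) k then 1 else 0))))"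
    by (intro sum_mono pw)
  also have "\<dots> = n\<^sup>2 * (1/4) ^ K + (\<Sum>k<K. 4 * (1/4) ^ Suc k * (real (card (B 1 k)) + real (card (B (-1) k))))"
    by (simp only: sum.distrib sum_constant sum.swap[of _ "{..<K}"] sum_distrib_left[symmetric] cardB)
      (simp add: n_def power2_eq_square)
  also have "\<dots> \<le> n\<^sup>2 * (1/4) ^ K + (\<Sum>k<K. 4 * (1/4) ^ Suc k * (16 * \<Lambda> * 4 ^ Suc k * n + 16 * \<Lambda> * 4 ^ Suc k * n))"
    by (intro add_left_mono sum_mono mult_left_mono add_mono lv) auto
  also have "(\<Sum>k<K. 4 * (1/4) ^ Suc k * (16 * \<Lambda> * 4 ^ Suc k * n + 16 * \<Lambda> * 4 ^ Suc k * n)) = (\<Sum>k<K. 128 * \<Lambda> * n)"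
    by (intro sum.cong) (auto simp: power_divide field_simps)
  finally have "n * (n * (\<Sum>i\<in>I. \<Sum>j\<in>I. if centred I X i j > 1 / card I then 0 else (centred I X i j)\<^sup>2))
      \<le> n * (n * (1/4) ^ K + 128 * real K * \<Lambda>)"
    by (simp add: power2_eq_square algebra_simps)
  then have "n * (\<Sum>i\<in>I. \<Sum>j\<in>I. if centred I X i j > 1 / card I then 0 else (centred I X i j)\<^sup>2)
      \<le> n * (1/4) ^ K + 128 * real K * \<Lambda>"
    using n by (simp only: mult_le_cancel_left_pos)
  then show ?thesis using n unfolding n_def[symmetric] by (simp only: pos_le_divide_eq mult.commute)
qed


section \<open>A one-sided bound for the trilinear form\<close>

definition frob :: "'a set \<Rightarrow> ('a \<Rightarrow> 'a \<Rightarrow> real) \<Rightarrow> real"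
  where "frob I x = (\<Sum>i\<in>I. \<Sum>j\<in>I. (x i j)\<^sup>2)"

definition tri :: "'a set \<Rightarrow> ('a \<Rightarrow> 'a \<Rightarrow> real) \<Rightarrow> ('a \<Rightarrow> 'a \<Rightarrow> real) \<Rightarrow> ('a \<Rightarrow> 'a \<Rightarrow> real) \<Rightarrow> real"
  where "tri I x y z = (\<Sum>i\<in>I. \<Sum>j\<in>I. \<Sum>k\<in>I. x i j * y j k * z i k)"

lemma frob_nonneg: "frob I x \<ge> 0"
  by (simp add: frob_def sum_nonneg)

lemma tri_square_le: "(tri I x y z)\<^sup>2 \<le> frob I x * frob I y * frob I z"
proof -
  define w where "w = (\<lambda>i k. \<Sum>j\<in>I. x i j * y j k)"
  have "frob I w \<le> (\<Sum>i\<in>I. \<Sum>k\<in>I. (\<Sum>j\<in>I. (x i j)\<^sup>2) * (\<Sum>j\<in>I. (y j k)\<^sup>2))"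
    unfolding frob_def w_def by (intro sum_mono Cauchy_Schwarz_ineq_sum)
  also have "\<dots> = frob I x * (\<Sum>k\<in>I. \<Sum>j\<in>I. (y j k)\<^sup>2)"
    unfolding frob_def sum_product by simp
  also have "(\<Sum>k\<in>I. \<Sum>j\<in>I. (y j k)\<^sup>2) = frob I y" unfolding frob_def by (rule sum.swap)
  finally have w: "frob I w \<le> frob I x * frob I y" .
  have "tri I x y z = (\<Sum>i\<in>I. \<Sum>k\<in>I. w i k * z i k)"
    unfolding tri_def w_def sum_distrib_right by (intro sum.cong sum.swap refl)
  also have "\<dots> = (\<Sum>a\<in>I \<times> I. w (fst a) (snd a) * z (fst a) (snd a))"
    by (simp add: sum.cartesian_product case_prod_beta)
  finally have "(tri I x y z)\<^sup>2 \<le> (\<Sum>a\<in>I \<times> I. (w (fst a) (snd a))\<^sup>2) * (\<Sum>a\<in>I \<times> I. (z (fst a) (snd a))\<^sup>2)"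
    using Cauchy_Schwarz_ineq_sum by metis
  also have "\<dots> = frob I w * frob I z"
    by (simp add: frob_def sum.cartesian_product case_prod_beta)
  also have "\<dots> \<le> (frob I x * frob I y) * frob I z"
    using w frob_nonneg by (rule mult_right_mono)
  finally show ?thesis .
qed

lemma tri_ge:
  assumes "frob I x \<le> a\<^sup>2" "frob I y \<le> b\<^sup>2" "frob I z \<le> c\<^sup>2" "a \<ge> 0" "b \<ge> 0" "c \<ge> 0"
  shows "tri I x y z \<ge> - (a * b * c)"
proof -
  have "(tri I x y z)\<^sup>2 \<le> a\<^sup>2 * b\<^sup>2 * c\<^sup>2"
    using assms by (intro order_trans[OF tri_square_le] mult_mono mult_nonneg_nonneg frob_nonneg) auto
  then have "(tri I x y z)\<^sup>2 \<le> (a * b * c)\<^sup>2" by (simp only: power_mult_distrib)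
  then have "\<bar>tri I x y z\<bar> \<le> \<bar>a * b * c\<bar>" by (simp only: abs_le_square_iff)
  moreover have "a * b * c \<ge> 0" using assms by simp
  ultimately show ?thesis by linarith
qed

lemma tri_add:
  "tri I (\<lambda>i j. x i j + x' i j) y z = tri I x y z + tri I x' y z"
  "tri I x (\<lambda>i j. y i j + y' i j) z = tri I x y z + tri I x y' z"
  "tri I x y (\<lambda>i j. z i j + z' i j) = tri I x y z + tri I x y z'"
  by (simp_all add: tri_def sum.distrib algebra_simps)

lemma tri_nonneg:
  assumes "\<And>i j. x i j \<ge> 0" "\<And>i j. y i j \<ge> 0" "\<And>i j. z i j \<ge> 0"
  shows "tri I x y z \<ge> 0"
  unfolding tri_def by (intro sum_nonneg mult_nonneg_nonneg assms)

text \<open>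
  Of the eight terms only the one with three nonnegative factors can be large, and it has the
  favourable sign.
\<close>
lemma tri_split_ge:
  assumes F: "F \<ge> 0" "G \<ge> 0"
    and s: "frob I s \<le> F\<^sup>2" "frob I s' \<le> F\<^sup>2"
    and b: "frob I b \<le> G\<^sup>2" "frob I b' \<le> G\<^sup>2"
    and nn: "\<And>i j. b i j \<ge> 0" "\<And>i j. b' i j \<ge> 0"
  shows "tri I (\<lambda>i j. s i j + b i j) (\<lambda>i j. s i j + b i j) (\<lambda>i j. s' i j + b' i j)
    \<ge> - (F ^ 3 + 3 * F\<^sup>2 * G + 3 * F * G\<^sup>2)"
proof -
  have "tri I b b b' \<ge> 0" by (intro tri_nonneg nn)
  moreover note tri_ge[OF s(1) s(1) s(2)] tri_ge[OF s(1) s(1) b(2)] tri_ge[OF s(1) b(1) s(2)]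
    tri_ge[OF b(1) s(1) s(2)] tri_ge[OF s(1) b(1) b(2)] tri_ge[OF b(1) s(1) b(2)] tri_ge[OF b(1) b(1) s(2)]
  ultimately show ?thesis
    unfolding tri_add using F by (simp add: power2_eq_square power3_eq_cube algebra_simps)
qed

text \<open>
  \<open>F\<close> bounds the Frobenius norm of the part of each matrix with entries at most \<open>1/n\<close>, and \<open>G\<close> that of
  the large part, whose entries are at most \<open>m\<close> and have total mass at most \<open>32 \<Lambda>\<close>.
\<close>
lemma tri_centred_ge:
  fixes I :: "'a set" and \<Lambda> :: real
  assumes I: "finite I" "I \<noteq> {}" and X: "X \<subseteq> {p. p permutes I}" "X \<noteq> {}"
    and Z: "Z \<subseteq> {p. p permutes I}" "Z \<noteq> {}"
    and \<Lambda>: "ln (fact (card I) / card X) \<le> \<Lambda>" "ln (fact (card I) / card Z) \<le> \<Lambda>" "\<Lambda> \<ge> 0"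
    and m: "m \<ge> 0" "\<And>i j. i \<in> I \<Longrightarrow> j \<in> I \<Longrightarrow> freq X i j \<le> m" "\<And>i j. i \<in> I \<Longrightarrow> j \<in> I \<Longrightarrow> freq Z i j \<le> m"
    and F: "F \<ge> 0" "(real (card I) * (1/4) ^ K + 128 * real K * \<Lambda>) / card I \<le> F\<^sup>2"
    and G: "G \<ge> 0" "32 * \<Lambda> * m \<le> G\<^sup>2"
  shows "tri I (centred I X) (centred I X) (centred I Z) \<ge> - (F ^ 3 + 3 * F\<^sup>2 * G + 3 * F * G\<^sup>2)"
proof -
  define s where "s = (\<lambda>Y i j. if centred I Y i j > 1 / card I then 0 else centred I Y i j)"
  define b where "b = (\<lambda>Y i j. if centred I Y i j > 1 / card I then centred I Y i j else 0)"
  have sb: "centred I Y = (\<lambda>i j. s Y i j + b Y i j)" for Y by (auto simp: s_def b_def fun_eq_iff)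
  have nn: "b Y i j \<ge> 0" for Y i j
  proof (cases "centred I Y i j > 1 / card I")
    case True
    moreover have "1 / real (card I) \<ge> 0" by simp
    ultimately have "centred I Y i j \<ge> 0" by linarith
    then show ?thesis by (simp add: b_def)
  qed (simp add: b_def)
  have fs: "frob I (s Y) \<le> F\<^sup>2"
    if Y: "Y \<subseteq> {p. p permutes I}" "Y \<noteq> {}" "ln (fact (card I) / card Y) \<le> \<Lambda>" for Y
  proof -
    have "frob I (s Y) = (\<Sum>i\<in>I. \<Sum>j\<in>I. if centred I Y i j > 1 / card I then 0 else (centred I Y i j)\<^sup>2)"
      unfolding frob_def s_def by (intro sum.cong) auto
    also have "\<dots> \<le> F\<^sup>2"
      by (rule order_trans[OF small_entries_square_sum[OF I Y(1,2,3) \<Lambda>(3)] F(2)])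
    finally show ?thesis .
  qed
  have fb: "frob I (b Y) \<le> G\<^sup>2"
    if Y: "Y \<subseteq> {p. p permutes I}" "Y \<noteq> {}" "ln (fact (card I) / card Y) \<le> \<Lambda>"
      and m': "\<And>i j. i \<in> I \<Longrightarrow> j \<in> I \<Longrightarrow> freq Y i j \<le> m" for Y
  proof -
    have "frob I (b Y) \<le> (\<Sum>i\<in>I. \<Sum>j\<in>I. m * (if centred I Y i j > 1 / card I then freq Y i j else 0))"
      unfolding frob_def
    proof (intro sum_mono)
      fix i j assume ij: "i \<in> I" "j \<in> I"
      have "b Y i j \<le> (if centred I Y i j > 1 / card I then freq Y i j else 0)"
        by (simp add: b_def centred_def)
      moreover have "b Y i j \<le> m"
        using m'[OF ij] m(1) by (auto simp: b_def centred_def intro: order_trans[rotated])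
      ultimately show "(b Y i j)\<^sup>2 \<le> m * (if centred I Y i j > 1 / card I then freq Y i j else 0)"
        unfolding power2_eq_square using nn m(1) by (intro mult_mono) auto
    qed
    also have "\<dots> = m * (\<Sum>i\<in>I. \<Sum>j\<in>I. if centred I Y i j > 1 / card I then freq Y i j else 0)"
      by (simp only: sum_distrib_left)
    also have "\<dots> \<le> m * (32 * \<Lambda>)"
      by (intro mult_left_mono large_entries_mass[OF I Y] m(1))
    also have "\<dots> \<le> G\<^sup>2" using G(2) by (simp add: mult_ac)
    finally show ?thesis .
  qed
  show ?thesis
    unfolding sb by (intro tri_split_ge F(1) G(1) fs fb nn X Z \<Lambda> m)
qed

section \<open>Projection to degree one\<close>

lemma card_Alt_point:
  assumes n: "n \<ge> 3" and ij: "i \<in> {1..n}" "j \<in> {1..n}"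
  shows "n * card {p \<in> Alt n. p i = j} = card (Alt n)"
proof -
  have eq: "card {p \<in> Alt n. p i = j'} = card {p \<in> Alt n. p i = j}" if j': "j' \<in> {1..n}" for j'
  proof -
    obtain s where s: "s \<in> Alt n" "s j' = j"
      using Alt_transitive[of "[j']" "[j]" n] ij j' n by auto
    have "bij_betw (\<lambda>p. s \<circ> p) {p \<in> Alt n. p i = j'} {p \<in> Alt n. p i = j}"
    proof (rule bij_betw_byWitness[where f' = "\<lambda>p. inv' s \<circ> p"])
      have "inv' s j = j'" using s Alt_permutes permutes_inv_eq by metis
      then show "(\<lambda>p. inv' s \<circ> p) ` {p \<in> Alt n. p i = j} \<subseteq> {p \<in> Alt n. p i = j'}"
        using s by auto
    qed (use s in \<open>auto simp: o_assoc inv_comp_Alt\<close>)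
    then show ?thesis by (rule bij_betw_same_card)
  qed
  have "card (Alt n) = (\<Sum>j'\<in>{1..n}. card {p \<in> Alt n. p i = j'})"
    using sum.group[of "Alt n" "{1..n}" "\<lambda>p. p i" "\<lambda>_. 1::nat"] ij Alt_in_range by fastforce
  also have "\<dots> = (\<Sum>j'\<in>{1..n}. card {p \<in> Alt n. p i = j})"
    by (intro sum.cong eq) auto
  finally show ?thesis by simp
qed

lemma card_Alt_two_points:
  assumes n: "n \<ge> 4" and ik: "i \<in> {1..n}" "k \<in> {1..n}" "i \<noteq> k" and jl: "j \<in> {1..n}" "l \<in> {1..n}" "j \<noteq> l"
  shows "(n - 1) * card {p \<in> Alt n. p i = j \<and> p k = l} = card {p \<in> Alt n. p k = l}"
proof -
  have eq: "card {p \<in> Alt n. p i = j' \<and> p k = l} = card {p \<in> Alt n. p i = j \<and> p k = l}"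
    if j': "j' \<in> {1..n} - {l}" for j'
  proof -
    obtain s where s: "s \<in> Alt n" "\<And>m. m < 2 \<Longrightarrow> s ([j', l] ! m) = [j, l] ! m"
      by (rule Alt_transitive[of "[j', l]" "[j, l]" n]) (use jl j' n in auto)
    have sv: "s j' = j" "s l = l" using s(2)[of 0] s(2)[of 1] by simp_all
    have "bij_betw (\<lambda>p. s \<circ> p) {p \<in> Alt n. p i = j' \<and> p k = l} {p \<in> Alt n. p i = j \<and> p k = l}"
    proof (rule bij_betw_byWitness[where f' = "\<lambda>p. inv' s \<circ> p"])
      have "inv' s j = j'" "inv' s l = l" using s(1) sv Alt_permutes permutes_inv_eq by metis+
      then show "(\<lambda>p. inv' s \<circ> p) ` {p \<in> Alt n. p i = j \<and> p k = l} \<subseteq> {p \<in> Alt n. p i = j' \<and> p k = l}"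
        using s(1) by auto
    qed (use s(1) sv in \<open>auto simp: o_assoc inv_comp_Alt\<close>)
    then show ?thesis by (rule bij_betw_same_card)
  qed
  have "card {p \<in> Alt n. p k = l} = (\<Sum>j'\<in>{1..n} - {l}. card {p \<in> {p \<in> Alt n. p k = l}. p i = j'})"
  proof -
    have "(\<lambda>p. p i) ` {p \<in> Alt n. p k = l} \<subseteq> {1..n} - {l}" using ik Alt_in_range by fastforce
    from sum.group[OF _ _ this, of "\<lambda>_. 1::nat"] show ?thesis by simp
  qed
  also have "\<dots> = (\<Sum>j'\<in>{1..n} - {l}. card {p \<in> Alt n. p i = j' \<and> p k = l})"
    by (intro sum.cong arg_cong[where f = card]) auto
  also have "\<dots> = (\<Sum>j'\<in>{1..n} - {l}. card {p \<in> Alt n. p i = j \<and> p k = l})"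
    by (intro sum.cong eq) auto
  finally show ?thesis using jl by simp
qed


lemma Alt_subset_permutes: "X \<subseteq> Alt n \<Longrightarrow> X \<subseteq> {p. p permutes {1..n}}"
  using Alt_permutes by blast

text \<open>
  The coefficients of the orthogonal projection of the indicator of \<open>X\<close> onto degree one functions.
  The factor \<open>n - 1\<close> inverts the Gram matrix of the functions \<open>[p i = j]\<close> on matrices with zero row
  and column sums; the constant \<open>1 / n\<close> reproduces the mean.
\<close>
definition proj_coeff :: "nat \<Rightarrow> (nat \<Rightarrow> nat) set \<Rightarrow> nat \<Rightarrow> nat \<Rightarrow> real"
  where "proj_coeff n X i j = card X / card (Alt n) * ((real n - 1) * centred {1..n} X i j + 1 / n)"

definition deg1_part :: "nat \<Rightarrow> (nat \<Rightarrow> nat) set \<Rightarrow> (nat \<Rightarrow> nat) \<Rightarrow> real"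
  where "deg1_part n X p = rearr_sum {1..n} (proj_coeff n X) p"

definition perp_part :: "nat \<Rightarrow> (nat \<Rightarrow> nat) set \<Rightarrow> (nat \<Rightarrow> nat) \<Rightarrow> real"
  where "perp_part n X p = (if p \<in> Alt n then (if p \<in> X then 1 else 0) - deg1_part n X p else 0)"

context
  fixes n :: nat and X :: "(nat \<Rightarrow> nat) set"
  assumes n: "n \<ge> 9" and X: "X \<subseteq> Alt n" "X \<noteq> {}"
begin

lemma finite_X: "finite X"
  using X(1) finite_Alt by (rule finite_subset)

lemma card_X_pos: "real (card X) > 0"
  using finite_X X(2) by (simp add: card_gt_0_iff)

lemma centred_row_sum: "i \<in> {1..n} \<Longrightarrow> (\<Sum>j\<in>{1..n}. centred {1..n} X i j) = 0"
  using freq_row_sum[OF _ Alt_subset_permutes[OF X(1)] X(2), of i] n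
  by (simp add: centred_def sum_subtractf)

lemma centred_column_sum: "j \<in> {1..n} \<Longrightarrow> (\<Sum>i\<in>{1..n}. centred {1..n} X i j) = 0"
  using freq_column_sum[OF _ Alt_subset_permutes[OF X(1)] X(2), of j] n
  by (simp add: centred_def sum_subtractf)

lemma proj_coeff_row_sum: "i \<in> {1..n} \<Longrightarrow> (\<Sum>j\<in>{1..n}. proj_coeff n X i j) = card X / card (Alt n)"
  using n unfolding proj_coeff_def sum_distrib_left[symmetric] sum.distrib
  by (simp add: centred_row_sum del: One_nat_def)

lemma proj_coeff_column_sum: "j \<in> {1..n} \<Longrightarrow> (\<Sum>i\<in>{1..n}. proj_coeff n X i j) = card X / card (Alt n)"
  using n unfolding proj_coeff_def sum_distrib_left[symmetric] sum.distrib
  by (simp add: centred_column_sum del: One_nat_def)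

text \<open>
  The projection has the same inner products with the degree one functions as the indicator of \<open>X\<close>,
  by two-fold transitivity of the alternating group.
\<close>
lemma deg1_part_point_sum:
  assumes kl: "k \<in> {1..n}" "l \<in> {1..n}"
  shows "(\<Sum>p | p \<in> Alt n \<and> p k = l. deg1_part n X p) = card {p \<in> X. p k = l}"
proof -
  let ?I = "{1..n}" and ?A = "{p \<in> Alt n. p k = l}"
  define a where "a = real (card ?A)"
  define \<alpha> where "\<alpha> = card X / card (Alt n)"
  define c where "c = proj_coeff n X"
  have "n * card ?A = card (Alt n)" by (rule card_Alt_point[OF _ kl]) (use n in simp)
  then have a: "real n * a = card (Alt n)" unfolding a_def of_nat_mult[symmetric] by (simp only:)
  have in_k: "(\<Sum>p\<in>?A. c k (p k)) = a * c k l"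
    by (simp add: a_def)
  have out_k: "(\<Sum>p\<in>?A. c i (p i)) = a / (real n - 1) * (\<alpha> - c i l)" if i: "i \<in> ?I - {k}" for i
  proof -
    have img: "(\<lambda>p. p i) ` ?A \<subseteq> ?I - {l}"
    proof
      fix j assume "j \<in> (\<lambda>p. p i) ` ?A"
      then obtain p where p: "p \<in> Alt n" "p k = l" "j = p i" by blast
      have "p i \<noteq> p k" using Alt_eq_iff[OF p(1)] i by blast
      moreover have "p i \<in> ?I" using Alt_in_range[OF p(1)] i by blast
      ultimately show "j \<in> ?I - {l}" unfolding p(3) p(2)[symmetric] by blast
    qed
    have "(\<Sum>p\<in>?A. c i (p i)) = (\<Sum>j\<in>?I - {l}. \<Sum>p\<in>{p \<in> ?A. p i = j}. c i (p i))"
      by (rule sum.group[OF _ _ img, symmetric]) auto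
    also have "\<dots> = (\<Sum>j\<in>?I - {l}. a / (real n - 1) * c i j)"
    proof (intro sum.cong refl)
      fix j assume j: "j \<in> ?I - {l}"
      have eq: "{p \<in> ?A. p i = j} = {p \<in> Alt n. p i = j \<and> p k = l}" by auto
      have "(n - 1) * card {p \<in> ?A. p i = j} = card ?A"
        unfolding eq using n i j kl by (intro card_Alt_two_points) auto
      then have "real (n - 1) * real (card {p \<in> ?A. p i = j}) = a"
        unfolding a_def of_nat_mult[symmetric] by (simp only:)
      moreover have "real (n - 1) = real n - 1" using n by (simp add: of_nat_diff)
      ultimately have "(real n - 1) * real (card {p \<in> ?A. p i = j}) = a" by simp
      then have "real (card {p \<in> ?A. p i = j}) = a / (real n - 1)"
        using n by (simp add: field_simps)
      moreover have "(\<Sum>p\<in>{p \<in> ?A. p i = j}. c i (p i)) = (\<Sum>p\<in>{p \<in> ?A. p i = j}. c i j)"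
        by (intro sum.cong) auto
      ultimately show "(\<Sum>p\<in>{p \<in> ?A. p i = j}. c i (p i)) = a / (real n - 1) * c i j" by simp
    qed
    also have "\<dots> = a / (real n - 1) * ((\<Sum>j\<in>?I. c i j) - c i l)"
      unfolding sum_distrib_left[symmetric] using kl by (simp add: sum_diff1)
    also have "(\<Sum>j\<in>?I. c i j) = \<alpha>" using i unfolding c_def \<alpha>_def by (intro proj_coeff_row_sum) blast
    finally show ?thesis .
  qed
  have "(\<Sum>p\<in>?A. deg1_part n X p) = (\<Sum>i\<in>?I. \<Sum>p\<in>?A. c i (p i))"
    unfolding deg1_part_def rearr_sum_def c_def by (rule sum.swap)
  also have "\<dots> = (\<Sum>p\<in>?A. c k (p k)) + (\<Sum>i\<in>?I - {k}. \<Sum>p\<in>?A. c i (p i))"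
    by (rule sum.remove) (use kl in auto)
  also have "(\<Sum>i\<in>?I - {k}. \<Sum>p\<in>?A. c i (p i)) = (\<Sum>i\<in>?I - {k}. a / (real n - 1) * (\<alpha> - c i l))"
    by (intro sum.cong refl out_k)
  also note in_k
  also have "(\<Sum>i\<in>?I - {k}. a / (real n - 1) * (\<alpha> - c i l))
      = a / (real n - 1) * ((real n - 1) * \<alpha> - ((\<Sum>i\<in>?I. c i l) - c k l))"
    unfolding sum_distrib_left[symmetric] using kl n by (simp add: sum_subtractf sum_diff1 of_nat_diff)
  also have "(\<Sum>i\<in>?I. c i l) = \<alpha>" unfolding c_def \<alpha>_def by (intro proj_coeff_column_sum kl)
  finally have "(\<Sum>p\<in>?A. deg1_part n X p) = a * c k l + a / (real n - 1) * ((real n - 1) * \<alpha> - (\<alpha> - c k l))" .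
  also have "\<dots> = a * \<alpha> * real n * freq X k l"
  proof -
    define m where "m = real n - 1"
    have m: "m > 0" "real n = m + 1" using n by (simp_all add: m_def)
    have c: "c k l = \<alpha> * (m * (freq X k l - 1 / (m + 1)) + 1 / (m + 1))"
      by (simp add: c_def proj_coeff_def centred_def \<alpha>_def m(2))
    have c': "c k l * (m + 1) = \<alpha> * (m * (m + 1) * freq X k l - m + 1)"
      unfolding c using m(1) by (simp add: field_simps)
    have "a * c k l + a / m * (m * \<alpha> - (\<alpha> - c k l)) = a / m * (c k l * (m + 1) + (m - 1) * \<alpha>)"
      using m(1) by (simp add: field_simps)
    also have "\<dots> = a * \<alpha> * (m + 1) * freq X k l"
      unfolding c' using m(1) by (simp add: field_simps)
    finally show ?thesis by (simp add: m(2))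
  qed
  also have "\<dots> = card X * freq X k l"
  proof -
    have "a * \<alpha> * real n = card X"
    proof -
      have "a * \<alpha> * real n = (real n * a) * \<alpha>" by simp
      also have "\<dots> = card X" unfolding a \<alpha>_def using less_imp_neq[OF card_Alt_pos[of n]] by (simp only: times_divide_eq_right nonzero_mult_div_cancel_left not_False_eq_True)
      finally show ?thesis .
    qed
    then show ?thesis by simp
  qed
  also have "\<dots> = card {p \<in> X. p k = l}"
    using card_X_pos by (simp add: freq_def)
  finally show ?thesis .
qed

lemma perp_part_mem: "perp_part n X \<in> deg1_perp n"
proof -
  have "(\<Sum>p | p \<in> Alt n \<and> p k = l. perp_part n X p) = 0" if kl: "k \<in> {1..n}" "l \<in> {1..n}" for k l
  proof -
    have "(\<Sum>p | p \<in> Alt n \<and> p k = l. perp_part n X p)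
        = (\<Sum>p | p \<in> Alt n \<and> p k = l. (if p \<in> X then 1 else 0) - deg1_part n X p)"
      by (intro sum.cong) (auto simp: perp_part_def)
    also have "\<dots> = (\<Sum>p | p \<in> Alt n \<and> p k = l. if p \<in> X then 1 else (0::real)) - card {p \<in> X. p k = l}"
      by (simp add: sum_subtractf deg1_part_point_sum[OF kl])
    also have "(\<Sum>p | p \<in> Alt n \<and> p k = l. if p \<in> X then 1 else (0::real)) = card {p \<in> X. p k = l}"
    proof -
      have "{p. p \<in> Alt n \<and> p k = l} \<inter> X = {p \<in> X. p k = l}" using X(1) by auto
      then show ?thesis by (simp add: sum.inter_restrict[symmetric])
    qed
    finally show ?thesis by simp
  qed
  then show ?thesis by (auto simp: deg1_perp_def perp_part_def)
qed

lemma ip_perp_part_le: "ip n (perp_part n X) (perp_part n X) \<le> card X"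
proof -
  let ?I = "{1..n}"
  define c where "c = proj_coeff n X"
  have perp: "(\<Sum>p\<in>Alt n. c i (p i) * perp_part n X p) = 0" if i: "i \<in> ?I" for i
  proof -
    have "(\<lambda>p. p i) ` Alt n \<subseteq> ?I" using i Alt_in_range by blast
    then have "(\<Sum>p\<in>Alt n. c i (p i) * perp_part n X p)
        = (\<Sum>j\<in>?I. \<Sum>p | p \<in> Alt n \<and> p i = j. c i (p i) * perp_part n X p)"
      by (intro sum.group[symmetric]) auto
    also have "\<dots> = (\<Sum>j\<in>?I. c i j * (\<Sum>p | p \<in> Alt n \<and> p i = j. perp_part n X p))"
      unfolding sum_distrib_left by (intro sum.cong) auto
    also have "\<dots> = 0"
      using perp_part_mem i by (intro sum.neutral) (auto simp: deg1_perp_def)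
    finally show ?thesis .
  qed
  have "ip n (deg1_part n X) (perp_part n X) = (\<Sum>i\<in>?I. \<Sum>p\<in>Alt n. c i (p i) * perp_part n X p)"
    unfolding ip_def deg1_part_def rearr_sum_def c_def sum_distrib_right by (rule sum.swap)
  also have "\<dots> = 0" by (intro sum.neutral ballI perp)
  finally have orth: "ip n (deg1_part n X) (perp_part n X) = 0" .
  have "card X = (\<Sum>p\<in>Alt n. if p \<in> X then 1 else (0::real))"
    using X(1) by (simp add: sum.inter_restrict[symmetric] Int_absorb1)
  also have "\<dots> = (\<Sum>p\<in>Alt n. (deg1_part n X p + perp_part n X p) * (deg1_part n X p + perp_part n X p))"
    by (intro sum.cong) (auto simp: perp_part_def)
  also have "\<dots> = ip n (deg1_part n X) (deg1_part n X) + 2 * ip n (deg1_part n X) (perp_part n X) + ip n (perp_part n X) (perp_part n X)"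
    by (simp add: ip_def sum.distrib sum_distrib_left algebra_simps)
  finally show ?thesis using orth ip_nonneg[of n "deg1_part n X"] by simp
qed

text \<open>
  If \<open>y = x\<^sup>-\<^sup>1 z\<close> then \<open>y i = j\<close> means \<open>z i = x j\<close>, so the sum factors through the value \<open>k = x j\<close> and
  becomes the trilinear form of the coefficient matrix and the two frequency matrices. Since centred
  matrices have zero row and column sums, all constant parts drop out except the main term 1.
\<close>
lemma conv_deg1_part_sum:
  assumes Z: "Z \<subseteq> Alt n" "Z \<noteq> {}"
  shows "(\<Sum>z\<in>Z. conv X (deg1_part n X) z)
    = card X / card (Alt n) * card X * card Z
      * (1 + (real n - 1) * tri {1..n} (centred {1..n} X) (centred {1..n} X) (centred {1..n} Z))"
proof -
  let ?I = "{1..n}"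
  define c where "c = proj_coeff n X"
  have fZ: "finite Z" using Z(1) finite_Alt by (rule finite_subset)
  have kZ: "real (card Z) > 0" using fZ Z(2) by (simp add: card_gt_0_iff)
  have 1: "(\<Sum>z\<in>Z. deg1_part n X (inv' x \<circ> z)) = card Z * (\<Sum>i\<in>?I. \<Sum>k\<in>?I. c i (inv' x k) * freq Z i k)" for x
    using average_rearr_sum[OF _ Alt_subset_permutes[OF Z(1)], of "\<lambda>i k. c i (inv' x k)"] kZ
    by (simp add: deg1_part_def rearr_sum_def c_def field_simps)
  have 2: "(\<Sum>x\<in>X. c i (inv' x k)) = card X * (\<Sum>j\<in>?I. c i j * freq X j k)" if k: "k \<in> ?I" for i k
  proof -
    have img: "(\<lambda>x. inv' x k) ` X \<subseteq> ?I" using X(1) k Alt_in_range inv_Alt by blast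
    have "(\<Sum>x\<in>X. c i (inv' x k)) = (\<Sum>j\<in>?I. \<Sum>x | x \<in> X \<and> inv' x k = j. c i (inv' x k))"
      by (rule sum.group[OF finite_X _ img, symmetric]) simp
    also have "\<dots> = (\<Sum>j\<in>?I. \<Sum>x | x \<in> X \<and> x j = k. c i j)"
    proof -
      have iff: "inv' x k = j \<longleftrightarrow> x j = k" if "x \<in> X" for x j
        by (rule permutes_inv_eq[OF Alt_permutes[OF subsetD[OF X(1) that]]])
      then have sets: "{x. x \<in> X \<and> inv' x k = j} = {x. x \<in> X \<and> x j = k}" for j by blast
      show ?thesis
        unfolding sets by (intro sum.cong refl arg_cong[where f = "c i"]) (use iff in blast)
    qed
    also have "\<dots> = card X * (\<Sum>j\<in>?I. c i j * freq X j k)"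
      unfolding sum_distrib_left freq_def using card_X_pos by (intro sum.cong) auto
    finally show ?thesis .
  qed
  have "(\<Sum>z\<in>Z. conv X (deg1_part n X) z) = (\<Sum>x\<in>X. \<Sum>z\<in>Z. deg1_part n X (inv' x \<circ> z))"
    unfolding conv_def by (rule sum.swap)
  also have "\<dots> = card Z * (\<Sum>i\<in>?I. \<Sum>k\<in>?I. (\<Sum>x\<in>X. c i (inv' x k)) * freq Z i k)"
    unfolding 1 sum_distrib_left[symmetric]
    by (simp only: sum_distrib_right sum.swap[of _ _ X])
  also have "\<dots> = card Z * (\<Sum>i\<in>?I. \<Sum>k\<in>?I. (card X * (\<Sum>j\<in>?I. c i j * freq X j k)) * freq Z i k)"
    by (intro arg_cong2[where f = "(*)"] sum.cong refl) (simp add: 2)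
  also have "\<dots> = card X * card Z * (\<Sum>i\<in>?I. \<Sum>k\<in>?I. \<Sum>j\<in>?I. c i j * freq X j k * freq Z i k)"
    by (simp add: sum_distrib_left sum_distrib_right mult_ac)
  also have "(\<Sum>i\<in>?I. \<Sum>k\<in>?I. \<Sum>j\<in>?I. c i j * freq X j k * freq Z i k) = tri ?I c (freq X) (freq Z)"
    unfolding tri_def by (intro sum.cong refl sum.swap)
  finally have main: "(\<Sum>z\<in>Z. conv X (deg1_part n X) z) = card X * card Z * tri ?I c (freq X) (freq Z)" .
  define CX where "CX = centred ?I X"
  define CZ where "CZ = centred ?I Z"
  have fX: "freq X = (\<lambda>i j. CX i j + 1 / n)" and fZ': "freq Z = (\<lambda>i j. CZ i j + 1 / n)"
    by (simp_all add: CX_def CZ_def centred_def fun_eq_iff)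
  have rowX: "(\<Sum>j\<in>?I. CX i j) = 0" if "i \<in> ?I" for i unfolding CX_def using that by (rule centred_row_sum)
  have colX: "(\<Sum>i\<in>?I. CX i j) = 0" if "j \<in> ?I" for j unfolding CX_def using that by (rule centred_column_sum)
  have tri1: "tri ?I CX (\<lambda>i j. 1 / n) z = 0" for z
  proof -
    have "tri ?I CX (\<lambda>i j. 1 / n) z = (\<Sum>i\<in>?I. \<Sum>k\<in>?I. (\<Sum>j\<in>?I. CX i j) * (1 / n) * z i k)"
      unfolding tri_def sum_distrib_right by (intro sum.cong refl sum.swap)
    then show ?thesis by (simp add: rowX del: One_nat_def)
  qed
  have tri2: "tri ?I CX y (\<lambda>i j. 1 / n) = 0" for y
  proof -
    have "tri ?I CX y (\<lambda>i j. 1 / n) = (\<Sum>j\<in>?I. \<Sum>i\<in>?I. \<Sum>k\<in>?I. CX i j * y j k * (1 / n))"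
      unfolding tri_def by (rule sum.swap)
    also have "\<dots> = (\<Sum>j\<in>?I. \<Sum>k\<in>?I. (\<Sum>i\<in>?I. CX i j) * y j k * (1 / n))"
      unfolding sum_distrib_right by (intro sum.cong refl sum.swap)
    finally show ?thesis by (simp add: colX del: One_nat_def)
  qed
  have tri3: "tri ?I (\<lambda>i j. 1 / n) (freq X) (freq Z) = 1"
  proof -
    have "tri ?I (\<lambda>i j. 1 / n) (freq X) (freq Z)
        = (\<Sum>i\<in>?I. \<Sum>k\<in>?I. (\<Sum>j\<in>?I. freq X j k) * (1 / n) * freq Z i k)"
      unfolding tri_def sum_distrib_right by (rule sum.cong[OF refl], subst sum.swap) (simp add: mult_ac)
    also have "\<dots> = (\<Sum>i\<in>?I. \<Sum>k\<in>?I. (1 / n) * freq Z i k)"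
      using freq_column_sum[OF _ Alt_subset_permutes[OF X(1)] X(2)] by (intro sum.cong refl) simp
    also have "\<dots> = (1 / n) * (\<Sum>i\<in>?I. 1)"
      unfolding sum_distrib_left[symmetric]
      by (intro arg_cong2[where f = "(*)"] sum.cong refl freq_row_sum[OF _ Alt_subset_permutes[OF Z(1)] Z(2)]) simp
    also have "\<dots> = 1" using n by simp
    finally show ?thesis .
  qed
  have tri4: "tri ?I CX (freq X) (freq Z) = tri ?I CX CX CZ"
    unfolding fX fZ' tri_add tri1 tri2 by simp
  have tri_c: "tri ?I c y z = card X / card (Alt n) * ((real n - 1) * tri ?I CX y z + tri ?I (\<lambda>i j. 1 / n) y z)" for y z
    unfolding tri_def c_def proj_coeff_def CX_def sum_distrib_left sum.distrib[symmetric]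
    by (intro sum.cong refl) (simp add: algebra_simps)
  show ?thesis
    unfolding main tri_c tri3 tri4 CX_def[symmetric] CZ_def[symmetric] by (simp add: mult_ac add.commute)
qed

text \<open>
  Without solutions of \<open>x y = z\<close> the contributions of the two parts of the indicator cancel. The first
  is at least half of its main term by the assumption \<open>T\<close>, the second is small by
  \<open>conv_norm_bound\<close>.
\<close>
lemma product_avoiding_bound:
  assumes Z: "Z \<subseteq> Alt n" "Z \<noteq> {}"
    and avoid: "\<And>x z. x \<in> X \<Longrightarrow> z \<in> Z \<Longrightarrow> inv' x \<circ> z \<notin> X"
    and T: "real n * tri {1..n} (centred {1..n} X) (centred {1..n} X) (centred {1..n} Z) \<ge> - (1/2)"
  shows "(card X / card (Alt n))\<^sup>2 * (card Z / card (Alt n)) * real ((n div 8) choose 2) \<le> 4"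
proof -
  define x where "x = real (card X)"
  define z where "z = real (card Z)"
  define N where "N = real (card (Alt n))"
  define D where "D = real ((n div 8) choose 2)"
  define t where "t = tri {1..n} (centred {1..n} X) (centred {1..n} X) (centred {1..n} Z)"
  have fZ: "finite Z" using Z(1) finite_Alt by (rule finite_subset)
  have pos: "x > 0" "z > 0" "N > 0"
    using card_X_pos card_Alt_pos fZ Z(2) by (auto simp: x_def z_def N_def card_gt_0_iff)
  have t: "1 + (real n - 1) * t \<ge> 1 / 2"
  proof (cases "t \<ge> 0")
    case True
    then have "(real n - 1) * t \<ge> 0" using n by simp
    then show ?thesis by linarith
  next
    case False
    then show ?thesis using T unfolding t_def[symmetric] by (simp add: algebra_simps)
  qed
  have neg: "conv X (perp_part n X) w = - conv X (deg1_part n X) w" if "w \<in> Z" for w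
  proof -
    have "perp_part n X (inv' y \<circ> w) = - deg1_part n X (inv' y \<circ> w)" if "y \<in> X" for y
    proof -
      have "inv' y \<circ> w \<in> Alt n" using that \<open>w \<in> Z\<close> X(1) Z(1) by (intro comp_Alt inv_Alt) auto
      then show ?thesis using avoid[OF that \<open>w \<in> Z\<close>] by (simp add: perp_part_def)
    qed
    then show ?thesis by (simp add: conv_def sum_negf)
  qed
  have "(x / N * x * z * (1/2))\<^sup>2 \<le> (x / N * x * z * (1 + (real n - 1) * t))\<^sup>2"
    using pos t by (intro power_mono mult_left_mono) auto
  also have "\<dots> = (\<Sum>w\<in>Z. conv X (deg1_part n X) w)\<^sup>2"
    unfolding conv_deg1_part_sum[OF Z] by (simp add: x_def z_def N_def t_def)
  also have "\<dots> = (\<Sum>w\<in>Z. 1 * conv X (perp_part n X) w)\<^sup>2"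
    by (simp add: neg sum_negf)
  also have "\<dots> \<le> (\<Sum>w\<in>Z. 1\<^sup>2) * (\<Sum>w\<in>Z. (conv X (perp_part n X) w)\<^sup>2)"
    by (rule Cauchy_Schwarz_ineq_sum)
  also have "\<dots> \<le> z * ip n (conv X (perp_part n X)) (conv X (perp_part n X))"
    unfolding ip_def z_def using Z(1)
    by (auto simp: power2_eq_square[symmetric] intro!: mult_left_mono sum_mono2)
  finally have "(x / N * x * z * (1/2))\<^sup>2 * D \<le> z * ip n (conv X (perp_part n X)) (conv X (perp_part n X)) * D"
    by (intro mult_right_mono) (simp_all add: D_def)
  also have "\<dots> \<le> z * (N * x * ip n (perp_part n X) (perp_part n X))"
    unfolding mult.assoc
    using conv_norm_bound[OF n X(1) perp_part_mem] pos
    by (intro mult_left_mono) (simp_all add: D_def N_def x_def)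
  also have "\<dots> \<le> z * (N * x * x)"
    using ip_perp_part_le pos by (intro mult_left_mono) (auto simp: x_def)
  finally have "(z * N * x\<^sup>2) * ((x / N)\<^sup>2 * (z / N) * D) \<le> (z * N * x\<^sup>2) * 4"
    using pos by (simp add: power2_eq_square field_simps)
  then have "(x / N)\<^sup>2 * (z / N) * D \<le> 4"
    by (rule mult_left_le_imp_le) (use pos in simp)
  then show ?thesis by (simp add: x_def z_def N_def D_def)
qed

end


section \<open>Squares of dense sets and product-free sets\<close>

lemma freq_Alt_le:
  assumes n: "n \<ge> 3" and X: "X \<subseteq> Alt n" "X \<noteq> {}" and ij: "i \<in> {1..n}" "j \<in> {1..n}"
    and d: "0 < d" "d \<le> card X / card (Alt n)"
  shows "freq X i j \<le> 1 / (d * n)"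
proof -
  have k: "real (card X) > 0" using finite_subset[OF X(1) finite_Alt] X(2) by (simp add: card_gt_0_iff)
  note N = card_Alt_pos[of n]
  have "n * card {p \<in> Alt n. p i = j} = card (Alt n)" by (rule card_Alt_point[OF n ij])
  then have "real n * real (card {p \<in> Alt n. p i = j}) = card (Alt n)"
    unfolding of_nat_mult[symmetric] by (simp only:)
  moreover have "card {p \<in> X. p i = j} \<le> card {p \<in> Alt n. p i = j}"
    using X(1) by (intro card_mono) auto
  ultimately have "real n * card {p \<in> X. p i = j} \<le> card (Alt n)"
    using mult_left_mono[of "real (card {p \<in> X. p i = j})" "real (card {p \<in> Alt n. p i = j})" "real n"] by simp
  also have "\<dots> \<le> card X / d" using d N by (simp add: field_simps)
  finally show ?thesis using d k n by (simp add: freq_def field_simps)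
qed

lemma real_choose_2: "real (k choose 2) = real k * (real k - 1) / 2"
proof (cases k)
  case (Suc m)
  have "even (k * (k - 1))" by (cases "even k") auto
  then have "real (k choose 2) = real (k * (k - 1)) / 2"
    unfolding choose_two by (simp add: real_of_nat_div)
  then show ?thesis using Suc by (simp add: field_simps)
qed simp

definition threshold :: "nat \<Rightarrow> real"
  where "threshold n = real n powr (-1/2) * ln (real n) powr (7/2)"

text \<open>
  The numerical conditions on \<open>n\<close>, in the order of use. The two expressions that recur are the bounds \<open>F\<close> and
  \<open>G\<close> for the Frobenius norms, with \<open>17\<^sup>2 \<ge> 1 + 2 * 128\<close> and \<open>6\<^sup>2 \<ge> 32\<close>. The term
  \<open>n F G\<^sup>2\<close> is of order \<open>(log n) powr (-3/2)\<close>; the other error terms carry a negative power of \<open>n\<close>.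
\<close>
lemma large_n:
  obtains n0 where "\<And>n. n \<ge> n0 \<Longrightarrow> n \<ge> 24"
    "\<And>n. n \<ge> n0 \<Longrightarrow> ln (real n) \<ge> 1"
    "\<And>n. n \<ge> n0 \<Longrightarrow> 2 / threshold n \<le> real n"
    "\<And>n. n \<ge> n0 \<Longrightarrow> 32 * ln (real n) * (1 / (threshold n * real n))
      \<le> (6 * ln (real n) powr (-5/4) * real n powr (-1/4))\<^sup>2"
    "\<And>n F G. n \<ge> n0 \<Longrightarrow> F = 17 * ln (real n) * real n powr (-1/2) \<Longrightarrow>
      G = 6 * ln (real n) powr (-5/4) * real n powr (-1/4) \<Longrightarrow>
      real n * (F ^ 3 + 3 * F\<^sup>2 * G + 3 * F * G\<^sup>2) \<le> 1 / 2"
    "\<And>n. n \<ge> n0 \<Longrightarrow> threshold n ^ 3 * ((real n / 8 - 1) * (real n / 8 - 2) / 2) > 4"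
proof -
  have "eventually (\<lambda>n. n \<ge> 24 \<and> ln (real n) \<ge> 1 \<and> 2 / threshold n \<le> real n \<and>
    32 * ln (real n) * (1 / (threshold n * real n)) \<le> (6 * ln (real n) powr (-5/4) * real n powr (-1/4))\<^sup>2 \<and>
    real n * ((17 * ln (real n) * real n powr (-1/2)) ^ 3
      + 3 * (17 * ln (real n) * real n powr (-1/2))\<^sup>2 * (6 * ln (real n) powr (-5/4) * real n powr (-1/4))
      + 3 * (17 * ln (real n) * real n powr (-1/2)) * (6 * ln (real n) powr (-5/4) * real n powr (-1/4))\<^sup>2) \<le> 1 / 2 \<and>
    threshold n ^ 3 * ((real n / 8 - 1) * (real n / 8 - 2) / 2) > 4) at_top"
    unfolding threshold_def by (intro eventually_conj eventually_ge_at_top) real_asymp+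
  then show thesis unfolding eventually_at_top_linorder using that by blast
qed

lemma square_density:
  assumes X: "X \<subseteq> Alt n" and dX: "density (alt_group n) X \<ge> threshold n"
    and n: "n \<ge> 24" "ln (real n) \<ge> 1" "2 / threshold n \<le> real n"
    and G: "32 * ln (real n) * (1 / (threshold n * real n)) \<le> (6 * ln (real n) powr (-5/4) * real n powr (-1/4))\<^sup>2"
    and FG: "\<And>F G. F = 17 * ln (real n) * real n powr (-1/2) \<Longrightarrow>
      G = 6 * ln (real n) powr (-5/4) * real n powr (-1/4) \<Longrightarrow>
      real n * (F ^ 3 + 3 * F\<^sup>2 * G + 3 * F * G\<^sup>2) \<le> 1 / 2"
    and D: "threshold n ^ 3 * ((real n / 8 - 1) * (real n / 8 - 2) / 2) > 4"
  shows "density (alt_group n) (X <#>\<^bsub>alt_group n\<^esub> X) \<ge> 1 - threshold n"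
proof (rule ccontr)
  define N where "N = real (card (Alt n))"
  define L where "L = ln (real n)"
  define XX where "XX = X <#>\<^bsub>alt_group n\<^esub> X"
  define Z where "Z = Alt n - XX"
  define F where "F = 17 * L * real n powr (-1/2)"
  define G where "G = 6 * L powr (-5/4) * real n powr (-1/4)"
  assume "\<not> ?thesis"
  then have dXX: "card XX / N < 1 - threshold n"
    by (simp add: density_def order_def XX_def N_def)
  have dX: "threshold n \<le> card X / N" using dX by (simp add: density_def order_def N_def)
  have threshold: "threshold n > 0" unfolding threshold_def using n by simp
  have N: "N > 0" unfolding N_def by (rule card_Alt_pos)
  have XX: "x \<circ> y \<in> XX" if "x \<in> X" "y \<in> X" for x y
    using that unfolding XX_def set_mult_def alt_group_mult by blast
  have "XX \<subseteq> Alt n"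
  proof
    fix z assume "z \<in> XX"
    then obtain x y where "x \<in> X" "y \<in> X" "z = x \<circ> y"
      unfolding XX_def set_mult_def alt_group_mult by blast
    then show "z \<in> Alt n" using X by (metis comp_Alt subsetD)
  qed
  then have "card Z = card (Alt n) - card XX" "card XX \<le> card (Alt n)"
    unfolding Z_def by (simp_all add: card_Diff_subset finite_subset card_mono)
  then have "real (card Z) = N - card XX" by (simp add: of_nat_diff N_def)
  then have "card Z / N = 1 - card XX / N" using N by (simp add: diff_divide_distrib)
  then have dZ: "threshold n \<le> card Z / N" using dXX by simp
  have Xne: "X \<noteq> {}" and Zne: "Z \<noteq> {}" using dX dZ threshold by auto
  have ZA: "Z \<subseteq> Alt n" by (auto simp: Z_def)
  have avoid: "inv' x \<circ> z \<notin> X" if "x \<in> X" "z \<in> Z" for x z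
  proof
    assume "inv' x \<circ> z \<in> X"
    then have "x \<circ> (inv' x \<circ> z) \<in> XX" using that by (intro XX)
    moreover have "x \<circ> (inv' x \<circ> z) = z"
      unfolding o_assoc inv_comp_Alt(2)[OF subsetD[OF X that(1)]] by simp
    ultimately show False using that by (simp add: Z_def)
  qed
  have fact_N: "fact n = 2 * N"
  proof -
    have "2 * card (Alt n) = fact n" by (rule alt_group_card_carrier) (use n in simp)
    then have "real (2 * card (Alt n)) = real (fact n)" by (simp only:)
    then show ?thesis by (simp add: N_def)
  qed
  have Lam: "ln (fact (card {1..n}) / card Y) \<le> L" if "Y \<noteq> {}" "threshold n \<le> card Y / N" for Y :: "(nat \<Rightarrow> nat) set"
  proof -
    have c: "real (card Y) > 0" using that threshold N by (metis divide_le_0_iff less_le_not_le linorder_le_less_linear of_nat_0_le_iff order_less_le_trans)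
    have "fact (card {1..n}) / card Y = 2 / (card Y / N)" using fact_N N by simp
    also have "\<dots> \<le> 2 / threshold n" using that threshold by (intro divide_left_mono) (auto intro!: mult_pos_pos divide_pos_pos c N)
    also have "\<dots> \<le> real n" by (rule n(3))
    finally have "fact (card {1..n}) / card Y \<le> real n" .
    then show ?thesis unfolding L_def using c n by (subst ln_le_cancel_iff) auto
  qed
  \<comment> \<open>\<open>K\<close> dyadic levels, so that the discarded part is at most \<open>1/n\<close>\<close>
  define K where "K = nat \<lceil>L\<rceil>"
  have K: "L \<le> real K" "real K \<le> 2 * L"
    using n(2) unfolding K_def L_def by linarith+
  have "real n = exp L" unfolding L_def using n by simp
  also have "\<dots> \<le> exp (real K)" using K by simp
  also have "\<dots> = exp 1 ^ K" by (simp add: exp_of_nat_mult[symmetric])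
  also have "\<dots> \<le> 4 ^ K" using exp_le by (intro power_mono) auto
  finally have nK: "real n * (1/4) ^ K \<le> 1" by (simp add: power_divide)
  have Fsq: "(real (card {1..n}) * (1/4) ^ K + 128 * real K * L) / card {1..n} \<le> F\<^sup>2"
  proof -
    have "128 * real K * L \<le> 128 * (2 * L) * L"
      using K n(2) by (intro mult_right_mono mult_left_mono) (auto simp: L_def)
    moreover have "1 * 1 \<le> L * L" using n(2) unfolding L_def by (intro mult_mono) auto
    ultimately have "real n * (1/4) ^ K + 128 * real K * L \<le> 289 * (L * L)"
      using nK by linarith
    then have "(real n * (1/4) ^ K + 128 * real K * L) / n \<le> 289 * (L * L) / n"
      by (intro divide_right_mono) auto
    also have "\<dots> = F\<^sup>2"
    proof -
      have "(real n powr (-1/2))\<^sup>2 = real n powr (-1/2 + -1/2)"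
        by (simp only: power2_eq_square powr_add)
      also have "\<dots> = real n powr (-1)" by simp
      also have "\<dots> = 1 / n" using n by (simp add: powr_minus_divide)
      finally have "F\<^sup>2 = 17\<^sup>2 * L\<^sup>2 * (1 / n)" unfolding F_def power_mult_distrib by (simp only:)
      then show ?thesis by (simp add: power2_eq_square)
    qed
    finally show ?thesis by simp
  qed
  have T: "tri {1..n} (centred {1..n} X) (centred {1..n} X) (centred {1..n} Z)
      \<ge> - (F ^ 3 + 3 * F\<^sup>2 * G + 3 * F * G\<^sup>2)"
  proof (rule tri_centred_ge[where \<Lambda> = L and m = "1 / (threshold n * n)" and K = K])
    show "finite {1..n}" "{1..n} \<noteq> {}" using n by auto
    show "X \<subseteq> {p. p permutes {1..n}}" "Z \<subseteq> {p. p permutes {1..n}}"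
      using X ZA by (intro Alt_subset_permutes; blast)+
    show "freq X i j \<le> 1 / (threshold n * n)" if "i \<in> {1..n}" "j \<in> {1..n}" for i j
      using n dX by (intro freq_Alt_le X Xne that threshold) (auto simp: N_def)
    show "freq Z i j \<le> 1 / (threshold n * n)" if "i \<in> {1..n}" "j \<in> {1..n}" for i j
      using n dZ by (intro freq_Alt_le ZA Zne that threshold) (auto simp: N_def)
    show "0 \<le> L" "0 \<le> F" "0 \<le> G" using n(2) by (auto simp: L_def F_def G_def)
    show "0 \<le> 1 / (threshold n * real n)" using threshold by simp
    show "32 * L * (1 / (threshold n * real n)) \<le> G\<^sup>2" using G unfolding L_def G_def .
  qed (use Xne Zne Lam[OF Xne dX] Lam[OF Zne dZ] Fsq in auto)
  have "real n * (F ^ 3 + 3 * F\<^sup>2 * G + 3 * F * G\<^sup>2) \<le> 1 / 2"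
    by (rule FG) (simp_all add: F_def G_def L_def)
  moreover have "real n * tri {1..n} (centred {1..n} X) (centred {1..n} X) (centred {1..n} Z)
      \<ge> real n * (- (F ^ 3 + 3 * F\<^sup>2 * G + 3 * F * G\<^sup>2))"
    using T by (rule mult_left_mono) simp
  ultimately have "real n * tri {1..n} (centred {1..n} X) (centred {1..n} X) (centred {1..n} Z) \<ge> - (1/2)"
    unfolding mult_minus_right by linarith
  then have "(card X / N)\<^sup>2 * (card Z / N) * real ((n div 8) choose 2) \<le> 4"
    unfolding N_def using n avoid by (intro product_avoiding_bound X Xne ZA Zne) auto
  moreover have "threshold n ^ 3 * ((real n / 8 - 1) * (real n / 8 - 2) / 2)
      \<le> (card X / N)\<^sup>2 * (card Z / N) * real ((n div 8) choose 2)"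
  proof (rule mult_mono)
    have "threshold n ^ 3 = (threshold n)\<^sup>2 * threshold n" by (simp add: power2_eq_square power3_eq_cube)
    also have "\<dots> \<le> (card X / N)\<^sup>2 * (card Z / N)"
      using dX dZ threshold by (intro mult_mono power_mono) auto
    finally show "threshold n ^ 3 \<le> (card X / N)\<^sup>2 * (card Z / N)" .
    have k: "real (n div 8) \<ge> real n / 8 - 1" by linarith
    have "(real n / 8 - 1) * (real n / 8 - 2) \<le> real (n div 8) * (real (n div 8) - 1)"
      using k n by (intro mult_mono) auto
    then show "(real n / 8 - 1) * (real n / 8 - 2) / 2 \<le> real ((n div 8) choose 2)"
      unfolding real_choose_2 by simp
    show "0 \<le> (real n / 8 - 1) * (real n / 8 - 2) / 2" using n by simp
  qed (use N in simp)
  ultimately show False using D by linarith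
qed

theorem mainTheorem2:
  shows "\<exists>(C::real) (K::real) (n\<^sub>0::nat). C > 0 \<and> K > 0 \<and>
    (\<forall>n\<ge>n\<^sub>0. \<forall>X. X \<subseteq> carrier (alt_group n) \<longrightarrow>
      (density (alt_group n) X \<ge> C * real n powr (-1/2) * ln (real n) powr (7/2) \<longrightarrow>
        density (alt_group n) (X <#>\<^bsub>alt_group n\<^esub> X)
          \<ge> 1 - K * real n powr (-1/2) * ln (real n) powr (7/2)) \<and>
      (product_free (alt_group n) X \<longrightarrow>
        density (alt_group n) X \<le> K * real n powr (-1/2) * ln (real n) powr (7/2)))"
proof -
  obtain n0 where n0: "\<And>n. n \<ge> n0 \<Longrightarrow> n \<ge> 24"
    "\<And>n. n \<ge> n0 \<Longrightarrow> ln (real n) \<ge> 1"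
    "\<And>n. n \<ge> n0 \<Longrightarrow> 2 / threshold n \<le> real n"
    "\<And>n. n \<ge> n0 \<Longrightarrow> 32 * ln (real n) * (1 / (threshold n * real n))
      \<le> (6 * ln (real n) powr (-5/4) * real n powr (-1/4))\<^sup>2"
    "\<And>n F G. n \<ge> n0 \<Longrightarrow> F = 17 * ln (real n) * real n powr (-1/2) \<Longrightarrow>
      G = 6 * ln (real n) powr (-5/4) * real n powr (-1/4) \<Longrightarrow>
      real n * (F ^ 3 + 3 * F\<^sup>2 * G + 3 * F * G\<^sup>2) \<le> 1 / 2"
    "\<And>n. n \<ge> n0 \<Longrightarrow> threshold n ^ 3 * ((real n / 8 - 1) * (real n / 8 - 2) / 2) > 4"
    using large_n by blast
  have sq: "density (alt_group n) (X <#>\<^bsub>alt_group n\<^esub> X) \<ge> 1 - threshold n"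
    if "n \<ge> n0" "X \<subseteq> Alt n" "density (alt_group n) X \<ge> threshold n" for n X
    by (rule square_density[OF that(2,3)]) (use n0 that(1) in blast)+
  have free: "density (alt_group n) X \<le> threshold n"
    if n: "n \<ge> n0" and X: "X \<subseteq> Alt n" and pf: "product_free (alt_group n) X" for n X
  proof (rule ccontr)
    assume "\<not> ?thesis"
    then have big: "density (alt_group n) X > threshold n" by simp
    define XX where "XX = X <#>\<^bsub>alt_group n\<^esub> X"
    note N = card_Alt_pos[of n]
    have XXA: "XX \<subseteq> Alt n"
    proof
      fix z assume "z \<in> XX"
      then obtain x y where "x \<in> X" "y \<in> X" "z = x \<circ> y"
        unfolding XX_def set_mult_def alt_group_mult by blast
      then show "z \<in> Alt n" using X by (metis comp_Alt subsetD)
    qed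
    have "X \<inter> XX = {}"
      using pf unfolding product_free_def XX_def set_mult_def by blast
    then have "card X + card XX = card (X \<union> XX)"
      using X XXA by (simp add: card_Un_disjoint finite_subset[OF _ finite_Alt])
    also have "\<dots> \<le> card (Alt n)" using X XXA by (intro card_mono) auto
    finally have "real (card X + card XX) \<le> real (card (Alt n))" by (simp only: of_nat_le_iff)
    then have "(real (card X) + real (card XX)) / card (Alt n) \<le> 1" using N by simp
    then have "density (alt_group n) X + density (alt_group n) XX \<le> 1"
      by (simp add: density_def order_def add_divide_distrib)
    moreover have "density (alt_group n) XX \<ge> 1 - threshold n"
      unfolding XX_def using sq[OF n X] big by simp
    ultimately show False using big by linarith
  qed
  show ?thesis
    using sq free unfolding threshold_def
    by (intro exI[of _ 1] exI[of _ n0] conjI allI impI) simp_all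
qed

end
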